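(* Consider a stable Mn/Gn/1 queue with arrival rates $\lambda_n>0$, $n\ge 0$, and service time LSTs $G_n^*$, $n\ge 1$. Let $\pi_n$, $n\ge 0$, be the steady-state probability of having $n$ customers in the system at an arbitrary instance, let $R_n^*$, $n\ge 1$, be the LST of the steady-state residual service time at an arrival instance given that the arrival finds $n$ customers in the system, and set $R_0^*=G_1^*$. Then $$\pi_{n-1}\lambda_{n-1}\bigl(1-R_{n-1}^*(\lambda_n)\bigr)=\pi_n\lambda_n G_n^*(\lambda_n),\quad n\ge 1.$$
   Context: Mn/Gn/1 queue: a single-server queue in which service times are independent, and a service that commences with $n\ge 1$ customers in the system has (nonnegative) duration with CDF $G_n$ and LST $G_n^*(s)=\int_0^\infty e^{-sx}\,dG_n(x)$. Arrivals: given that there are $n$ customers in the system at time $t$, the number of arrivals in $[t,t+\Delta]$ is independent of the past, the probability of a single arrival in this interval is $\lambda_n\Delta+o(\Delta)$, and the probability of two or more is $o(\Delta)$. The system is assumed stable; steady-state probabilities and distributions are long-run averages. The residual service time at an arrival instance is the remaining service time of the customer in service at that instance; the number $n$ of customers in the system in the definition of $R_n^*$ is the number found by the arriving customer (not counting herself). *)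

theory Defs
  imports "HOL-Probability.Probability" "HOL-Library.Landau_Symbols"
begin

section \<open>Sample paths of a single-server queue\<close>

text \<open>
  A sample path on the time axis \<open>t \<ge> 0\<close> is given by the number of customers present at time 0
  (any initial state is allowed), the epochs of the subsequent arrivals, and the durations of the
  successive services.  If customers are present at time 0, service 0 is the one then in progress,
  and its duration is counted from time 0 (that is, it is the initial residual service time).
\<close>

record queue_path =
  initial_number :: nat
  arrival_epoch :: "nat \<Rightarrow> real"
  service_duration :: "nat \<Rightarrow> real"

definition valid_path :: "queue_path \<Rightarrow> bool" where
  "valid_path q \<longleftrightarrow>
     0 < arrival_epoch q 0 \<and> strict_mono (arrival_epoch q) \<and>
     filterlim (arrival_epoch q) at_top sequentially \<and>
     (\<forall>j. 0 \<le> service_duration q j)"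

text \<open>
  Customers are numbered in the order of arrival, those present at time 0 first.  Service \<open>j\<close> is
  identified with customer \<open>j\<close>; for a non-idling, non-preemptive server the order of service
  affects none of the quantities below, which count customers and service completions only.
\<close>

definition customer_epoch :: "queue_path \<Rightarrow> nat \<Rightarrow> real" where
  "customer_epoch q j =
     (if j < initial_number q then 0 else arrival_epoch q (j - initial_number q))"

primrec service_start :: "queue_path \<Rightarrow> nat \<Rightarrow> real" where
  "service_start q 0 = customer_epoch q 0"
| "service_start q (Suc j) =
     max (service_start q j + service_duration q j) (customer_epoch q (Suc j))"

definition service_end :: "queue_path \<Rightarrow> nat \<Rightarrow> real" where
  "service_end q j = service_start q j + service_duration q j"

definition number_in_system :: "queue_path \<Rightarrow> real \<Rightarrow> nat" where
  "number_in_system q t = card {j. customer_epoch q j \<le> t \<and> t < service_end q j}"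

text \<open>
  The number of customers when service \<open>j\<close> commences, including the one whose service commences.
  It is not expressed through \<^const>\<open>number_in_system\<close> because services of duration 0 are allowed,
  so that several services may commence at the same instant.
\<close>

definition number_at_start :: "queue_path \<Rightarrow> nat \<Rightarrow> nat" where
  "number_at_start q j = card {i. j \<le> i \<and> customer_epoch q i \<le> service_start q j}"

text \<open>The number found by arrival \<open>k\<close>, not counting the arriving customer herself.\<close>

definition number_found :: "queue_path \<Rightarrow> nat \<Rightarrow> nat" where
  "number_found q k =
     card {j. j < initial_number q + k \<and> arrival_epoch q k < service_end q j}"

text \<open>Meaningful only when a service is in progress at time \<open>t\<close>, which is then unique.\<close>

definition residual_service :: "queue_path \<Rightarrow> real \<Rightarrow> real" where
  "residual_service q t =
     service_end q (THE j. service_start q j \<le> t \<and> t < service_end q j) - t"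

definition arrivals_in :: "queue_path \<Rightarrow> real \<Rightarrow> real \<Rightarrow> nat" where
  "arrivals_in q a b = card {k. a \<le> arrival_epoch q k \<and> arrival_epoch q k \<le> b}"


section \<open>The past\<close>

text \<open>
  The past at time \<open>t\<close> is generated by the initial number, the arrivals up to time \<open>t\<close>, and the
  durations of all services that have commenced by time \<open>t\<close>.  In particular it determines the
  residual service time at \<open>t\<close>.
\<close>

definition past :: "'a measure \<Rightarrow> ('a \<Rightarrow> queue_path) \<Rightarrow> real \<Rightarrow> 'a measure" where
  "past M Q t = sigma (space M)
     (range (\<lambda>n. {\<omega> \<in> space M. initial_number (Q \<omega>) = n}) \<union>
      {{\<omega> \<in> space M. arrival_epoch (Q \<omega>) k \<le> s} | k s. s \<le> t} \<union>
      {{\<omega> \<in> space M. service_start (Q \<omega>) j \<le> t \<and> service_duration (Q \<omega>) j \<le> x} | j x. True})"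

text \<open>
  The past when service \<open>j\<close> commences, excluding its duration: generated by the initial number,
  the arrivals up to the random time at which service \<open>j\<close> starts, and the preceding durations.
\<close>

definition past_at_start :: "'a measure \<Rightarrow> ('a \<Rightarrow> queue_path) \<Rightarrow> nat \<Rightarrow> 'a measure" where
  "past_at_start M Q j = sigma (space M)
     (range (\<lambda>n. {\<omega> \<in> space M. initial_number (Q \<omega>) = n}) \<union>
      {{\<omega> \<in> space M. arrival_epoch (Q \<omega>) k \<le> service_start (Q \<omega>) j \<and> arrival_epoch (Q \<omega>) k \<le> s}
        | k s. True} \<union>
      {{\<omega> \<in> space M. service_duration (Q \<omega>) i \<le> x} | i x. i < j})"


section \<open>The Mn/Gn/1 queue\<close>

text \<open>
  In \<open>service_law\<close>, the condition \<open>0 < j \<or> initial_number (Q \<omega>) = 0\<close> only leaves out the service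
  that is already in progress at time 0.

  In the arrival laws the remainder terms may depend on \<open>t\<close>, on \<open>n\<close> and on the past event \<open>E\<close>.
  Exact independence of \<open>E\<close> for a fixed interval length cannot hold, since a service completion
  within the interval changes the arrival rate; it is the rate that does not depend on the past.
\<close>

locale Mn_Gn_1_queue = prob_space M for M :: "'a measure" +
  fixes Q :: "'a \<Rightarrow> queue_path"
    and rate :: "nat \<Rightarrow> real"
    and G :: "nat \<Rightarrow> real measure"
  assumes valid: "\<And>\<omega>. \<omega> \<in> space M \<Longrightarrow> valid_path (Q \<omega>)"
    and initial_number_measurable:
      "(\<lambda>\<omega>. initial_number (Q \<omega>)) \<in> measurable M (count_space UNIV)"
    and arrival_epoch_measurable: "\<And>k. (\<lambda>\<omega>. arrival_epoch (Q \<omega>) k) \<in> borel_measurable M"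
    and service_duration_measurable: "\<And>j. (\<lambda>\<omega>. service_duration (Q \<omega>) j) \<in> borel_measurable M"
    and rate_pos: "\<And>n. 0 < rate n"
    and service_distribution: "\<And>n. 1 \<le> n \<Longrightarrow> real_distribution (G n)"
    and service_nonneg: "\<And>n. 1 \<le> n \<Longrightarrow> AE x in G n. 0 \<le> x"
    and service_law:
      "\<And>j n E x. \<lbrakk>1 \<le> n; E \<in> sets (past_at_start M Q j);
         0 < \<P>(\<omega> in M. \<omega> \<in> E \<and> (0 < j \<or> initial_number (Q \<omega>) = 0) \<and> number_at_start (Q \<omega>) j = n)\<rbrakk> \<Longrightarrow>
         \<P>(\<omega> in M. service_duration (Q \<omega>) j \<le> x \<bar>
            \<omega> \<in> E \<and> (0 < j \<or> initial_number (Q \<omega>) = 0) \<and> number_at_start (Q \<omega>) j = n) = cdf (G n) x"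
    and single_arrival:
      "\<And>t n E. \<lbrakk>0 \<le> t; E \<in> sets (past M Q t);
         0 < \<P>(\<omega> in M. \<omega> \<in> E \<and> number_in_system (Q \<omega>) t = n)\<rbrakk> \<Longrightarrow>
         (\<lambda>\<Delta>. \<P>(\<omega> in M. arrivals_in (Q \<omega>) t (t + \<Delta>) = 1 \<bar> \<omega> \<in> E \<and> number_in_system (Q \<omega>) t = n)
              - rate n * \<Delta>) \<in> o[at_right 0](\<lambda>\<Delta>. \<Delta>)"
    and multiple_arrivals:
      "\<And>t n E. \<lbrakk>0 \<le> t; E \<in> sets (past M Q t);
         0 < \<P>(\<omega> in M. \<omega> \<in> E \<and> number_in_system (Q \<omega>) t = n)\<rbrakk> \<Longrightarrow>
         (\<lambda>\<Delta>. \<P>(\<omega> in M. 2 \<le> arrivals_in (Q \<omega>) t (t + \<Delta>) \<bar> \<omega> \<in> E \<and> number_in_system (Q \<omega>) t = n))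
           \<in> o[at_right 0](\<lambda>\<Delta>. \<Delta>)"


section \<open>Steady-state quantities as long-run averages\<close>

text \<open>The long-run fraction of time with \<open>n\<close> customers in the system is \<open>p\<close>.\<close>

definition steady_state_prob :: "'a measure \<Rightarrow> ('a \<Rightarrow> queue_path) \<Rightarrow> nat \<Rightarrow> real \<Rightarrow> bool" where
  "steady_state_prob M Q n p \<longleftrightarrow>
     (AE \<omega> in M. ((\<lambda>t. measure lborel {s \<in> {0..t}. number_in_system (Q \<omega>) s = n} / t) \<longlongrightarrow> p) at_top)"

definition stable_queue :: "'a measure \<Rightarrow> ('a \<Rightarrow> queue_path) \<Rightarrow> bool" where
  "stable_queue M Q \<longleftrightarrow> (\<exists>p. (\<forall>n. steady_state_prob M Q n (p n)) \<and> p sums 1)"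

text \<open>
  Among the arrivals that find \<open>n\<close> customers, the long-run fraction of those with residual service
  time at most \<open>x\<close> is the value at \<open>x\<close> of the distribution function of \<open>F\<close>.
\<close>

definition steady_state_residual ::
    "'a measure \<Rightarrow> ('a \<Rightarrow> queue_path) \<Rightarrow> nat \<Rightarrow> real measure \<Rightarrow> bool" where
  "steady_state_residual M Q n F \<longleftrightarrow> real_distribution F \<and>
     (\<forall>x. AE \<omega> in M.
        (\<lambda>m. real (card {k. k < m \<and> number_found (Q \<omega>) k = n \<and>
                            residual_service (Q \<omega>) (arrival_epoch (Q \<omega>) k) \<le> x})
             / real (card {k. k < m \<and> number_found (Q \<omega>) k = n}))
          \<longlonglongrightarrow> cdf F x)"

text \<open>The Laplace--Stieltjes transform of a distribution on the nonnegative reals.\<close>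

definition LST :: "real measure \<Rightarrow> real \<Rightarrow> real" where
  "LST F s = (\<integral>x. exp (- s * x) \<partial>F)"

end

theory Submission
  imports Defs
begin

text \<open>
Fix a level \<open>n\<close> and give an instant with \<open>n\<close> customers present and residual service time \<open>r\<close> the
weight \<open>exp (- rate n * r)\<close>.  While the level lasts, \<open>r\<close> decreases at unit speed, so the weight grows at
relative rate \<open>rate n\<close>; arrivals, which end the level, come at intensity \<open>rate n\<close> and remove the weight at
the same relative rate.  On average the weight therefore changes only when level \<open>n\<close> is entered,
and when it is left by a service completion, at which moment \<open>r = 0\<close> and one unit is lost.  Level
\<open>n\<close> is entered by the start of a service with \<open>n\<close> customers, of mean weight \<open>LST (G n) (rate n)\<close>, or,
if \<open>n \<ge> 2\<close>, by an arrival that finds \<open>n - 1\<close>, of long-run mean weight \<open>R (n - 1) (rate n)\<close>.  Level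
crossings turn departures and starts into arrivals: up to bounded errors there are as many departures
from level \<open>n\<close> as arrivals that find \<open>n - 1\<close>, and as many service starts at level \<open>n\<close> as arrivals that
find \<open>n\<close>, to which for \<open>n = 1\<close> the arrivals that find an empty system are added.  The latter enter
level 1 with a fresh service, which is what \<open>R 0 = LST (G 1)\<close> expresses.  Arrivals that find
\<open>m\<close> occur at the long-run rate \<open>\<pi> m * rate m\<close>, and dividing the balance by the length of time
gives the claim.

All long-run averages in the statement have deterministic limits, so it is enough to balance
expectations, restricted to an event of positive probability on which the initial number is a
constant \<open>c\<close>.  Three ingredients make this rigorous.

The arrival laws are infinitesimal, with error terms that depend on the time and on the past event.
Lemma \<open>arrival_compensator\<close> integrates them: the expectation of a mark carried by arrival \<open>k\<close> is, as a
function of the time horizon, continuous with a known right derivative, and these two properties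
determine it.  Only one arrival is treated at a time, because then at most
\<open>c + k\<close> customers are present while it is awaited and only finitely many rates occur.

The balance along a path, \<open>phase_balance\<close>, is taken service by service: numbering
customers in the order of arrival, \<open>n\<close> customers are present during service \<open>j\<close> exactly between the
epochs of customers \<open>j + n - 1\<close> and \<open>j + n\<close>.  It needs that no arrival coincides with a
completion, which is a further consequence of the compensator formula.  Together with
\<open>level_crossing\<close> it gives \<open>expected_balance_bounded\<close>.

Long-run averages hold almost surely, and expectations of ratios must be compared with ratios of
expectations.  For occupation times bounded convergence is enough.  For the residual service
times seen by arrivals the number of arrivals is unbounded, and its second moment,
\<open>expected_square_count_le\<close>, provides the uniform integrability.
\<close>

section \<open>Right derivatives and right-continuous processes\<close>

lemma eventually_at_right_less_real:
  fixes t b :: real assumes "t < b" shows "eventually (\<lambda>s. t < s \<and> s < b) (at_right t)"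
  using assms eventually_at_right by blast

text \<open>
Were \<open>f b \<noteq> f a\<close>, the slope \<open>\<epsilon>\<close> could be chosen below half the mean slope.  The points up
to which \<open>f\<close> stays in the cone of slope \<open>\<epsilon>\<close> at \<open>a\<close> form a closed interval, by continuity, and the
right derivative lets that interval be extended beyond any of its points except \<open>b\<close>.
\<close>

lemma constant_of_zero_right_derivative:
  fixes f :: "real \<Rightarrow> real"
  assumes cont: "continuous_on {a..b} f"
    and deriv: "\<And>t. a \<le> t \<Longrightarrow> t < b \<Longrightarrow> ((\<lambda>h. (f (t + h) - f t) / h) \<longlongrightarrow> 0) (at_right 0)"
    and "a \<le> b"
  shows "f b = f a"
proof (rule ccontr)
  assume neq: "f b \<noteq> f a"
  then have ab: "a < b" using \<open>a \<le> b\<close> by (cases "a = b") auto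
  \<comment> \<open>half of the mean slope on the interval\<close>
  define \<epsilon> where "\<epsilon> = \<bar>f b - f a\<bar> / (2 * (b - a))"
  have \<epsilon>: "\<epsilon> > 0" "\<epsilon> * (b - a) < \<bar>f b - f a\<bar>"
    using neq ab by (auto simp: \<epsilon>_def field_simps)
  define S where "S = {t \<in> {a..b}. \<bar>f t - f a\<bar> \<le> \<epsilon> * (t - a)}"
  have aS: "a \<in> S" using ab by (auto simp: S_def)
  have "closed S"
  proof -
    have "continuous_on {a..b} (\<lambda>t. \<bar>f t - f a\<bar> - \<epsilon> * (t - a))"
      by (intro continuous_intros cont)
    then have "closed ({a..b} \<inter> (\<lambda>t. \<bar>f t - f a\<bar> - \<epsilon> * (t - a)) -` {..0})"
      by (intro continuous_closed_preimage) auto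
    also have "{a..b} \<inter> (\<lambda>t. \<bar>f t - f a\<bar> - \<epsilon> * (t - a)) -` {..0} = S"
      by (auto simp: S_def)
    finally show ?thesis .
  qed
  define A where "A = {t \<in> {a..b}. {a..t} \<subseteq> S}"
  have aA: "a \<in> A" using aS ab by (auto simp: A_def)
  have bdd: "bdd_above A" by (auto simp: A_def intro!: bdd_aboveI[of _ b])
  define s where "s = Sup A"
  have s: "a \<le> s" "s \<le> b"
  proof -
    show "a \<le> s" unfolding s_def by (rule cSup_upper[OF aA bdd])
    show "s \<le> b" unfolding s_def by (rule cSup_least) (use aA in \<open>auto simp: A_def\<close>)
  qed
  have below: "t \<in> S" if "a \<le> t" "t < s" for t
  proof -
    from that obtain u where "u \<in> A" "t < u" using less_cSup_iff[of A t] aA bdd unfolding s_def by blast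
    moreover from this have "{a..u} \<subseteq> S" by (simp add: A_def)
    ultimately show ?thesis using that by (simp add: subset_iff)
  qed
  have sS: "s \<in> S"
  proof (cases "s = a")
    case False
    then have "a < s" using s by auto
    then have "s \<in> closure {a<..<s}" by simp
    also have "closure {a<..<s} \<subseteq> S"
      using below by (intro closure_minimal \<open>closed S\<close>) auto
    finally show ?thesis .
  qed (use aS in simp)
  then have "s \<noteq> b" using \<epsilon>(2) by (auto simp: S_def)
  then have sb: "s < b" using s by simp
  from tendstoD[OF deriv[OF s(1) sb] \<epsilon>(1)]
  have "eventually (\<lambda>h. \<bar>(f (s + h) - f s) / h\<bar> < \<epsilon>) (at_right 0)"
    by (simp add: dist_real_def)
  then obtain d where d: "d > 0" "\<And>h. 0 < h \<Longrightarrow> h < d \<Longrightarrow> \<bar>(f (s + h) - f s) / h\<bar> < \<epsilon>"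
    by (auto simp: eventually_at_right[of 0 1] )
  define u where "u = min b (s + d / 2)"
  have u: "s < u" "u \<le> b" using sb d by (auto simp: u_def)
  have "{a..u} \<subseteq> S"
  proof
    fix t assume t: "t \<in> {a..u}"
    show "t \<in> S"
    proof (cases "t \<le> s")
      case True
      then show ?thesis using below sS t by (cases "t = s") auto
    next
      case False
      then have "\<bar>(f (s + (t - s)) - f s) / (t - s)\<bar> < \<epsilon>"
        using t d(1) by (intro d(2)) (auto simp: u_def)
      then have "\<bar>f t - f s\<bar> \<le> \<epsilon> * (t - s)"
        using False by (simp add: abs_divide field_simps)
      moreover have "\<bar>f s - f a\<bar> \<le> \<epsilon> * (s - a)" using sS by (simp add: S_def)
      ultimately have "\<bar>f t - f a\<bar> \<le> \<epsilon> * (t - a)" by (simp add: algebra_simps)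
      then show ?thesis using t u by (auto simp: S_def)
    qed
  qed
  then have "u \<in> A" using u s by (auto simp: A_def)
  then have "u \<le> s" unfolding s_def by (intro cSup_upper bdd)
  then show False using u by simp
qed

text \<open>
A right-continuous process is the limit of the step processes that look ahead to the next point of
a grid.
\<close>

lemma borel_measurable_right_continuous:
  fixes Y :: "real \<Rightarrow> 'a \<Rightarrow> real"
  assumes meas: "\<And>t. Y t \<in> borel_measurable M"
    and rc: "\<And>\<omega> t. \<omega> \<in> space M \<Longrightarrow> ((\<lambda>s. Y s \<omega>) \<longlongrightarrow> Y t \<omega>) (at_right t)"
  shows "(\<lambda>(t, \<omega>). Y t \<omega>) \<in> borel_measurable (borel \<Otimes>\<^sub>M M)"
proof (rule borel_measurable_LIMSEQ_real)
  let ?u = "\<lambda>n t. (real_of_int \<lfloor>t * real (Suc n)\<rfloor> + 1) / real (Suc n)"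
  show "(\<lambda>n. case x of (t, \<omega>) \<Rightarrow> Y (?u n t) \<omega>) \<longlonglongrightarrow> (case x of (t, \<omega>) \<Rightarrow> Y t \<omega>)"
    if x: "x \<in> space (borel \<Otimes>\<^sub>M M)" for x
  proof -
    obtain t \<omega> where [simp]: "x = (t, \<omega>)" by (cases x)
    have \<omega>: "\<omega> \<in> space M" using x by (simp add: space_pair_measure)
    have gt: "?u n t > t" for n
    proof -
      have "t * real (Suc n) < real_of_int \<lfloor>t * real (Suc n)\<rfloor> + 1" by linarith
      then show ?thesis by (simp add: field_simps)
    qed
    have le: "?u n t \<le> t + 1 / real (Suc n)" for n
    proof -
      have "real_of_int \<lfloor>t * real (Suc n)\<rfloor> \<le> t * real (Suc n)" by linarith
      then have "real_of_int \<lfloor>t * real (Suc n)\<rfloor> + 1 \<le> (t + 1 / real (Suc n)) * real (Suc n)"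
        by (simp add: distrib_right del: of_nat_Suc)
      then show ?thesis by (subst pos_divide_le_eq) (auto simp del: of_nat_Suc)
    qed
    have "(\<lambda>n. ?u n t) \<longlonglongrightarrow> t"
    proof (rule tendsto_sandwich[OF always_eventually always_eventually])
      show "\<forall>n. t \<le> ?u n t" using gt less_imp_le by blast
      show "\<forall>n. ?u n t \<le> t + 1 / real (Suc n)" using le by blast
      have "(\<lambda>n. 1 / real (Suc n)) \<longlonglongrightarrow> 0" using LIMSEQ_Suc[OF lim_1_over_n] by simp
      from tendsto_add[OF tendsto_const[of t] this] show "(\<lambda>n. t + 1 / real (Suc n)) \<longlonglongrightarrow> t" by simp
    qed simp
    then have "filterlim (\<lambda>n. ?u n t) (at_right t) sequentially"
      using gt by (intro tendsto_imp_filterlim_at_right) auto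
    from filterlim_compose[OF rc[OF \<omega>] this] show ?thesis by simp
  qed
  show "(\<lambda>(t, \<omega>). Y (?u n t) \<omega>) \<in> borel_measurable (borel \<Otimes>\<^sub>M M)" for n
  proof -
    have "(\<lambda>x. (\<lambda>z x. Y ((real_of_int z + 1) / real (Suc n)) (snd x)) \<lfloor>fst x * real (Suc n)\<rfloor> x)
        \<in> borel_measurable (borel \<Otimes>\<^sub>M M)"
      by (rule measurable_compose_countable) (auto intro!: measurable_compose[OF measurable_snd meas])
    then show ?thesis by (simp add: case_prod_beta)
  qed
qed

lemma tendsto_at_right_if_seq:
  fixes f :: "real \<Rightarrow> real"
  assumes "\<And>S. (\<And>n. t < S n) \<Longrightarrow> S \<longlonglongrightarrow> t \<Longrightarrow> (\<lambda>n. f (S n)) \<longlonglongrightarrow> l"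
  shows "(f \<longlongrightarrow> l) (at_right t)"
  by (rule tendsto_at_right_sequentially[of t "t+1"]) (use assms in auto)

lemma (in finite_measure) tendsto_expectation_at_right:
  fixes Y :: "real \<Rightarrow> 'a \<Rightarrow> real"
  assumes meas: "\<And>t. Y t \<in> borel_measurable M"
    and rc: "\<And>\<omega>. \<omega> \<in> space M \<Longrightarrow> ((\<lambda>s. Y s \<omega>) \<longlongrightarrow> y \<omega>) (at_right t)"
    and y: "y \<in> borel_measurable M"
    and bound: "\<And>s \<omega>. \<omega> \<in> space M \<Longrightarrow> \<bar>Y s \<omega>\<bar> \<le> B"
  shows "((\<lambda>s. \<integral>\<omega>. Y s \<omega> \<partial>M) \<longlongrightarrow> (\<integral>\<omega>. y \<omega> \<partial>M)) (at_right t)"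
proof (rule tendsto_at_right_if_seq)
  fix S :: "nat \<Rightarrow> real" assume S: "\<And>n. t < S n" "S \<longlonglongrightarrow> t"
  then have fl: "filterlim S (at_right t) sequentially"
    by (intro tendsto_imp_filterlim_at_right) auto
  show "(\<lambda>n. \<integral>\<omega>. Y (S n) \<omega> \<partial>M) \<longlonglongrightarrow> (\<integral>\<omega>. y \<omega> \<partial>M)"
    by (rule integral_dominated_convergence[where w = "\<lambda>_. B"])
       (auto intro!: meas y bound filterlim_compose[OF rc fl] AE_I2)
qed

section \<open>Sample paths\<close>

text \<open>
The number of the first \<open>i\<close> customers who have not left at time \<open>t\<close>.  It is the common form of
\<^const>\<open>number_in_system\<close> and \<^const>\<open>number_found\<close>: both coincide with it if \<open>i\<close> counts the customers
who came before.
\<close>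

definition busy :: "queue_path \<Rightarrow> nat \<Rightarrow> real \<Rightarrow> nat" where
  "busy q i t = card {j. j < i \<and> t < service_end q j}"

text \<open>
The initial number is part of the event because it relates the numbers of arrivals to those of customers: while
arrival \<open>k\<close> is the next one, exactly the first \<open>c + k\<close> customers have come.
\<close>

definition awaiting :: "nat \<Rightarrow> nat \<Rightarrow> queue_path \<Rightarrow> real \<Rightarrow> bool" where
  "awaiting c k q t \<longleftrightarrow> initial_number q = c \<and> 0 \<le> t \<and>
     (0 < k \<longrightarrow> arrival_epoch q (k - 1) \<le> t) \<and> t < arrival_epoch q k"

lemma customer_epoch_arrival [simp]: "customer_epoch q (initial_number q + k) = arrival_epoch q k"
  by (simp add: customer_epoch_def)

lemma service_start_le_end: "valid_path q \<Longrightarrow> service_start q j \<le> service_end q j"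
  by (simp add: service_end_def valid_path_def)

lemma service_start_Suc:
  "service_start q (Suc j) = max (service_end q j) (customer_epoch q (Suc j))"
  by (simp add: service_end_def)

declare service_start.simps(2) [simp del]

lemma customer_epoch_le_start: "customer_epoch q j \<le> service_start q j"
  by (cases j) (auto simp: service_start_Suc)

lemma service_end_le_start_Suc: "service_end q j \<le> service_start q (Suc j)"
  by (simp add: service_start_Suc)

lemma customer_epoch_le_end: "valid_path q \<Longrightarrow> customer_epoch q j \<le> service_end q j"
  by (rule order_trans[OF customer_epoch_le_start service_start_le_end])

lemma mono_service_end: "valid_path q \<Longrightarrow> i \<le> j \<Longrightarrow> service_end q i \<le> service_end q j"
  by (rule lift_Suc_mono_le[of "service_end q"])
     (rule order_trans[OF service_end_le_start_Suc service_start_le_end])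

lemma service_end_le_start:
  "valid_path q \<Longrightarrow> i < j \<Longrightarrow> service_end q i \<le> service_start q j"
  using mono_service_end[of q i "j - 1"] service_end_le_start_Suc[of q "j - 1"] by (cases j) auto

lemma mono_service_start: "valid_path q \<Longrightarrow> i \<le> j \<Longrightarrow> service_start q i \<le> service_start q j"
  using service_end_le_start[of q i j] service_start_le_end[of q i] by (cases "i = j") auto

lemma arrival_epoch_pos: "valid_path q \<Longrightarrow> 0 < arrival_epoch q k"
  using strict_mono_less_eq[of "arrival_epoch q" 0 k] by (auto simp: valid_path_def)

lemma arrival_epoch_less_iff:
  "valid_path q \<Longrightarrow> arrival_epoch q k < arrival_epoch q l \<longleftrightarrow> k < l"
  by (simp add: valid_path_def strict_mono_less)

lemma arrival_epoch_le_iff: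
  "valid_path q \<Longrightarrow> arrival_epoch q k \<le> arrival_epoch q l \<longleftrightarrow> k \<le> l"
  by (simp add: valid_path_def strict_mono_less_eq)

lemma customer_epoch_nonneg: "valid_path q \<Longrightarrow> 0 \<le> customer_epoch q j"
  using arrival_epoch_pos[of q "j - initial_number q"] by (simp add: customer_epoch_def)

lemma customer_epoch_strict:
  "valid_path q \<Longrightarrow> i < j \<Longrightarrow> initial_number q \<le> j \<Longrightarrow> customer_epoch q i < customer_epoch q j"
  by (auto simp: customer_epoch_def arrival_epoch_pos arrival_epoch_less_iff)

lemma mono_customer_epoch:
  "valid_path q \<Longrightarrow> i \<le> j \<Longrightarrow> customer_epoch q i \<le> customer_epoch q j"
  using customer_epoch_strict[of q i j] customer_epoch_nonneg[of q j]
  by (cases "initial_number q \<le> j"; cases "i = j") (auto simp: customer_epoch_def)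

lemma arrivals_eventually_late:
  assumes "valid_path q" shows "\<exists>K. \<forall>k\<ge>K. t < arrival_epoch q k"
proof -
  have "filterlim (arrival_epoch q) at_top sequentially" using assms by (simp add: valid_path_def)
  then have "\<forall>\<^sub>F k in sequentially. t < arrival_epoch q k"
    by (simp add: filterlim_at_top_dense)
  then show ?thesis by (simp add: eventually_sequentially)
qed

lemma finite_arrivals_until: 
  assumes "valid_path q" shows "finite {k. arrival_epoch q k \<le> t}"
proof -
  obtain K where "\<And>k. k \<ge> K \<Longrightarrow> t < arrival_epoch q k" using arrivals_eventually_late[OF assms] by blast
  then have "{k. arrival_epoch q k \<le> t} \<subseteq> {..<K}" by (auto simp: not_le[symmetric])
  then show ?thesis by (rule finite_subset) simp
qed

lemma exists_awaiting:
  assumes "valid_path q" "0 \<le> t"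
  shows "\<exists>k. awaiting (initial_number q) k q t"
proof -
  define k where "k = (LEAST k. t < arrival_epoch q k)"
  obtain K where "t < arrival_epoch q K" using arrivals_eventually_late[OF assms(1), of t] by blast
  then have "t < arrival_epoch q k" unfolding k_def by (rule LeastI)
  moreover have "arrival_epoch q (k - 1) \<le> t" if "0 < k"
    using not_less_Least[of "k - 1" "\<lambda>k. t < arrival_epoch q k"] that unfolding k_def by auto
  ultimately have "awaiting (initial_number q) k q t" using assms(2) by (simp add: awaiting_def)
  then show ?thesis ..
qed

lemma awaiting_unique:
  assumes "valid_path q" "awaiting c k q t" "awaiting c' k' q t"
  shows "k = k'"
proof -
  have "\<not> l < l'" if "awaiting c l q t" "awaiting c' l' q t" for l l' c c'
  proof
    assume "l < l'"
    then have "arrival_epoch q l \<le> arrival_epoch q (l' - 1)"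
      using arrival_epoch_le_iff[OF assms(1)] by simp
    then show False using that \<open>l < l'\<close> by (auto simp: awaiting_def)
  qed
  from this[OF assms(2,3)] this[OF assms(3,2)] show ?thesis by simp
qed

lemma customer_epoch_awaiting:
  assumes "valid_path q" "awaiting c k q t"
  shows "customer_epoch q j \<le> t \<longleftrightarrow> j < c + k"
proof (cases "j < c + k")
  case True
  have "customer_epoch q j \<le> t"
  proof (cases "j < c")
    case False
    then have "arrival_epoch q (j - c) \<le> arrival_epoch q (k - 1)" "0 < k"
      using True arrival_epoch_le_iff[OF assms(1)] by auto
    then show ?thesis using assms(2) False by (auto simp: awaiting_def customer_epoch_def)
  qed (use assms(2) in \<open>auto simp: awaiting_def customer_epoch_def\<close>)
  then show ?thesis using True by simp
next
  case False
  then have "arrival_epoch q k \<le> arrival_epoch q (j - c)"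
    using arrival_epoch_le_iff[OF assms(1)] by simp
  then show ?thesis using assms(2) False by (auto simp: awaiting_def customer_epoch_def)
qed

lemma number_in_system_awaiting:
  assumes "valid_path q" "awaiting c k q t"
  shows "number_in_system q t = busy q (c + k) t"
  using customer_epoch_awaiting[OF assms] by (simp add: number_in_system_def busy_def)

lemma number_found_busy: "number_found q k = busy q (initial_number q + k) (arrival_epoch q k)"
  by (simp add: number_found_def busy_def)

lemma busy_le: "busy q i t \<le> i"
proof -
  have "card {j. j < i \<and> t < service_end q j} \<le> card {..<i}" by (intro card_mono) auto
  then show ?thesis by (simp add: busy_def)
qed

lemma busy_eq_0_iff: "busy q i t = 0 \<longleftrightarrow> (\<forall>j<i. service_end q j \<le> t)"
proof -
  have "busy q i t = 0 \<longleftrightarrow> {j. j < i \<and> t < service_end q j} = {}"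
    unfolding busy_def by (subst card_0_eq) auto
  also have "\<dots> \<longleftrightarrow> (\<forall>j<i. \<not> t < service_end q j)" by blast
  finally show ?thesis by (simp only: not_less)
qed

text \<open>
Departures are in the order of arrival, so the customers still present are the last \<open>m\<close> of the \<open>i\<close>.
\<close>

lemma busy_eq_iff_ends:
  assumes v: "valid_path q" and m: "0 < m"
  shows "busy q i t = m \<longleftrightarrow>
    m \<le> i \<and> t < service_end q (i - m) \<and> (\<forall>j<i - m. service_end q j \<le> t)"
proof
  assume R: "m \<le> i \<and> t < service_end q (i - m) \<and> (\<forall>j<i - m. service_end q j \<le> t)"
  then have "{j. j < i \<and> t < service_end q j} = {i - m..<i}"
  proof (intro set_eqI)
    fix j
    have "t < service_end q j" if "i - m \<le> j"
      using R mono_service_end[OF v that] by linarith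
    moreover have "i - m \<le> j" if "t < service_end q j"
      using R that by (meson not_le)
    ultimately show "j \<in> {j. j < i \<and> t < service_end q j} \<longleftrightarrow> j \<in> {i - m..<i}" by auto
  qed
  then show "busy q i t = m" using R by (simp add: busy_def)
next
  assume b: "busy q i t = m"
  define j0 where "j0 = (LEAST j. t < service_end q j)"
  from b m have "busy q i t \<noteq> 0" by simp
  then obtain j where j: "j < i" "t < service_end q j"
    unfolding busy_eq_0_iff by (auto simp: not_le)
  have j0: "t < service_end q j0" "j0 \<le> j"
    unfolding j0_def using LeastI[of "\<lambda>j. t < service_end q j", OF j(2)]
      Least_le[of "\<lambda>j. t < service_end q j", OF j(2)] by auto
  have less: "service_end q j \<le> t" if "j < j0" for j
    using not_less_Least[of j "\<lambda>j. t < service_end q j"] that unfolding j0_def[symmetric] by simp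
  have "t < service_end q j \<longleftrightarrow> j0 \<le> j" for j
    using less[of j] mono_service_end[OF v, of j0 j] j0 by (cases "j0 \<le> j") auto
  then have "{j. j < i \<and> t < service_end q j} = {j0..<i}"
    by (intro set_eqI) (simp only: mem_Collect_eq atLeastLessThan_iff conj_commute)
  then have "m = i - j0" using b by (simp add: busy_def)
  then have "i - m = j0" "m \<le> i" using j0 j by auto
  then show "m \<le> i \<and> t < service_end q (i - m) \<and> (\<forall>j<i - m. service_end q j \<le> t)"
    using j0(1) less by metis
qed

lemma service_start_le_iff:
  assumes "valid_path q" "customer_epoch q j \<le> t"
  shows "service_start q j \<le> t \<longleftrightarrow> (\<forall>i<j. service_end q i \<le> t)"
proof (cases j)
  case (Suc i)
  have "(\<forall>i'<j. service_end q i' \<le> t) \<longleftrightarrow> service_end q i \<le> t"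
    using mono_service_end[OF assms(1), of _ i] unfolding Suc less_Suc_eq_le
    by (meson order_refl order_trans)
  then show ?thesis using assms(2) by (simp add: Suc service_start_Suc)
qed (use assms in auto)

lemma busy_eq_iff:
  assumes "valid_path q" "0 < m" "\<And>j. j < i \<Longrightarrow> customer_epoch q j \<le> t"
  shows "busy q i t = m \<longleftrightarrow>
    m \<le> i \<and> service_start q (i - m) \<le> t \<and> t < service_end q (i - m)"
proof (cases "m \<le> i")
  case True
  then have "customer_epoch q (i - m) \<le> t" using assms(2,3) by simp
  from service_start_le_iff[OF assms(1) this] busy_eq_iff_ends[OF assms(1,2), of i t]
  show ?thesis by metis
qed (use busy_eq_iff_ends[OF assms(1,2), of i t] in simp)

lemma number_found_eq_iff:
  assumes "valid_path q" "0 < m" "initial_number q = c"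
  shows "number_found q k = m \<longleftrightarrow> m \<le> c + k \<and>
    service_start q (c + k - m) \<le> customer_epoch q (c + k) \<and>
    customer_epoch q (c + k) < service_end q (c + k - m)"
proof -
  have e: "customer_epoch q (c + k) = arrival_epoch q k" using assms(3) by auto
  show ?thesis unfolding e number_found_busy assms(3)
    by (rule busy_eq_iff[OF assms(1,2)])
       (use mono_customer_epoch[OF assms(1), of _ "c + k"] e in auto)
qed

lemma number_found_eq_0_iff:
  assumes "initial_number q = c"
  shows "number_found q k = 0 \<longleftrightarrow> (\<forall>j<c + k. service_end q j \<le> customer_epoch q (c + k))"
  using assms by (auto simp: number_found_busy busy_eq_0_iff)

lemma number_in_system_eq_iff:
  assumes "valid_path q" "0 < m" "awaiting c k q t"
  shows "number_in_system q t = m \<longleftrightarrow> m \<le> c + k \<and>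
    service_start q (c + k - m) \<le> t \<and> t < service_end q (c + k - m)"
  unfolding number_in_system_awaiting[OF assms(1,3)]
  by (rule busy_eq_iff) (use assms customer_epoch_awaiting in auto)

lemma service_in_progress_unique:
  assumes "valid_path q" "service_start q i \<le> t" "t < service_end q i"
    "service_start q j \<le> t" "t < service_end q j"
  shows "i = j"
  using service_end_le_start[OF assms(1), of i j] service_end_le_start[OF assms(1), of j i] assms
  by (cases i j rule: linorder_cases) auto

lemma residual_service_eq:
  assumes "valid_path q" "service_start q j \<le> t" "t < service_end q j"
  shows "residual_service q t = service_end q j - t"
proof -
  have "(THE j. service_start q j \<le> t \<and> t < service_end q j) = j"
    using assms service_in_progress_unique[OF assms(1)] by blast
  then show ?thesis by (simp add: residual_service_def)
qed

lemma residual_service_found: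
  assumes "valid_path q" "initial_number q = c" "number_found q k = m" "0 < m"
  shows "residual_service q (arrival_epoch q k) = service_end q (c + k - m) - arrival_epoch q k"
  using number_found_eq_iff[OF assms(1,4,2), of k] customer_epoch_arrival[of q k] assms(2,3)
  by (intro residual_service_eq assms(1)) simp_all

text \<open>
The customers counted by \<^const>\<open>number_at_start\<close> are numbered consecutively from \<open>j\<close>, so their number is
determined by the first customer who comes after the start.
\<close>

lemma number_at_start_eq_iff:
  assumes v: "valid_path q" and "0 < n" "initial_number q \<le> j"
  shows "number_at_start q j = n \<longleftrightarrow>
    customer_epoch q (j + n - 1) \<le> service_start q j \<and> service_start q j < customer_epoch q (j + n)"
proof -
  let ?S = "{i. j \<le> i \<and> customer_epoch q i \<le> service_start q j}"
  obtain K where K: "\<And>k. k \<ge> K \<Longrightarrow> service_start q j < arrival_epoch q k"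
    using arrivals_eventually_late[OF v] by blast
  define c where "c = initial_number q"
  define l where "l = (LEAST i. j \<le> i \<and> service_start q j < customer_epoch q i)"
  have ex: "j \<le> K + j + c \<and> service_start q j < customer_epoch q (K + j + c)"
    using K[of "K + j"] by (simp add: customer_epoch_def c_def)
  have l: "j \<le> l" "service_start q j < customer_epoch q l"
    using LeastI[of "\<lambda>i. j \<le> i \<and> service_start q j < customer_epoch q i", OF ex] unfolding l_def by auto
  have less: "customer_epoch q i \<le> service_start q j" if "j \<le> i" "i < l" for i
    using not_less_Least[of i "\<lambda>i. j \<le> i \<and> service_start q j < customer_epoch q i"] that
    unfolding l_def by auto
  have iff: "customer_epoch q i \<le> service_start q j \<longleftrightarrow> i < l" if "j \<le> i" for i
    using l less[OF that] mono_customer_epoch[OF v, of l i] by (cases "i < l") auto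
  have "?S = {j..<l}"
    using iff by (intro set_eqI) (metis (no_types, lifting) atLeastLessThan_iff mem_Collect_eq)
  then have card: "number_at_start q j = l - j" by (simp add: number_at_start_def)
  have jl: "j < l" using customer_epoch_le_start[of q j] iff[of j] by simp
  show ?thesis
  proof -
    have "service_start q j < customer_epoch q (j + n) \<longleftrightarrow> \<not> j + n < l"
      using iff[of "j + n"] by (simp only: le_add1 not_le[symmetric])
    moreover have "customer_epoch q (j + n - 1) \<le> service_start q j \<longleftrightarrow> j + n - 1 < l"
      using iff[of "j + n - 1"] \<open>0 < n\<close> by simp
    moreover have "l - j = n \<longleftrightarrow> j + n - 1 < l \<and> \<not> j + n < l"
      using jl \<open>0 < n\<close> by linarith
    ultimately show ?thesis unfolding card by simp
  qed
qed

section \<open>What the past determines\<close>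

text \<open>
Hides from an epoch everything beyond \<open>t\<close>: an epoch after \<open>t\<close> is replaced by the dummy value
\<open>t + 1\<close>.  The epochs hidden in this way are observable at time \<open>t\<close>, and the recursion for service starts
commutes with the hiding.
\<close>

definition cut :: "real \<Rightarrow> real \<Rightarrow> real" where
  "cut t x = (if x \<le> t then x else t + 1)"

lemma cut_le_iff: "cut t x \<le> t \<longleftrightarrow> x \<le> t" by (simp add: cut_def)
lemma less_cut_iff: "t < cut t x \<longleftrightarrow> t < x" by (simp add: cut_def)
lemma cut_max: "cut t (max x y) = max (cut t x) (cut t y)" by (simp add: cut_def max_def)
lemma cut_add: "0 \<le> d \<Longrightarrow> cut t (x + d) = cut t (cut t x + (if x \<le> t then d else 0))"
  by (simp add: cut_def)
lemma cut_less_cut_iff: "x \<le> t \<Longrightarrow> cut t x < cut t y \<longleftrightarrow> x < y" by (simp add: cut_def)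

context Mn_Gn_1_queue begin

declare initial_number_measurable [measurable] arrival_epoch_measurable [measurable]
  service_duration_measurable [measurable]

lemma customer_epoch_measurable [measurable]:
  "(\<lambda>\<omega>. customer_epoch (Q \<omega>) j) \<in> borel_measurable M"
proof -
  have "(\<lambda>\<omega>. (\<lambda>n \<omega>. if j < n then 0 else arrival_epoch (Q \<omega>) (j - n)) (initial_number (Q \<omega>)) \<omega>)
      \<in> borel_measurable M"
    by (rule measurable_compose_countable) auto
  then show ?thesis by (simp add: customer_epoch_def)
qed

lemma service_start_measurable [measurable]:
  "(\<lambda>\<omega>. service_start (Q \<omega>) j) \<in> borel_measurable M"
  by (induction j) (auto simp: service_start.simps(2))

lemma service_end_measurable [measurable]:
  "(\<lambda>\<omega>. service_end (Q \<omega>) j) \<in> borel_measurable M"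
  unfolding service_end_def by measurable

lemma number_found_measurable [measurable]:
  "(\<lambda>\<omega>. number_found (Q \<omega>) k) \<in> measurable M (count_space UNIV)"
  unfolding number_found_def by measurable

lemma number_in_system_measurable [measurable]:
  "(\<lambda>\<omega>. number_in_system (Q \<omega>) t) \<in> measurable M (count_space UNIV)"
  unfolding number_in_system_def by measurable

lemma number_at_start_measurable [measurable]:
  "(\<lambda>\<omega>. number_at_start (Q \<omega>) j) \<in> measurable M (count_space UNIV)"
  unfolding number_at_start_def by measurable

lemma past_generators:
  "range (\<lambda>n. {\<omega> \<in> space M. initial_number (Q \<omega>) = n}) \<union>
      {{\<omega> \<in> space M. arrival_epoch (Q \<omega>) k \<le> s} | k s. s \<le> t} \<union>
      {{\<omega> \<in> space M. service_start (Q \<omega>) j \<le> t \<and> service_duration (Q \<omega>) j \<le> x} | j x. True} \<subseteq> sets M"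
  (is "?G \<subseteq> _")
  by (auto simp del: service_start.simps)

lemma space_past [simp]: "space (past M Q t) = space M"
  unfolding past_def by (rule space_measure_of) (use past_generators sets.sets_into_space in blast)

lemma sets_past: "sets (past M Q t) = sigma_sets (space M)
     (range (\<lambda>n. {\<omega> \<in> space M. initial_number (Q \<omega>) = n}) \<union>
      {{\<omega> \<in> space M. arrival_epoch (Q \<omega>) k \<le> s} | k s. s \<le> t} \<union>
      {{\<omega> \<in> space M. service_start (Q \<omega>) j \<le> t \<and> service_duration (Q \<omega>) j \<le> x} | j x. True})"
  unfolding past_def by (rule sets_measure_of) (use past_generators sets.sets_into_space in blast)

lemma subalgebra_past: "subalgebra M (past M Q t)"
  unfolding subalgebra_def sets_past using sets.sigma_sets_subset[OF past_generators] by simp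

lemma sets_past_subset: "E \<in> sets (past M Q t) \<Longrightarrow> E \<in> sets M"
  using subalgebra_past by (auto simp: subalgebra_def)

lemma past_initial_number [measurable]:
  "(\<lambda>\<omega>. initial_number (Q \<omega>)) \<in> measurable (past M Q t) (count_space UNIV)"
proof (rule measurableI)
  fix X :: "nat set"
  have "(\<lambda>\<omega>. initial_number (Q \<omega>)) -` X \<inter> space (past M Q t) =
      (\<Union>n\<in>X. {\<omega> \<in> space M. initial_number (Q \<omega>) = n})" by auto
  also have "\<dots> \<in> sets (past M Q t)"
    by (intro sets.countable_UN') (auto simp: sets_past intro!: sigma_sets.Basic)
  finally show "(\<lambda>\<omega>. initial_number (Q \<omega>)) -` X \<inter> space (past M Q t) \<in> sets (past M Q t)" .
qed simp

lemma past_cut_arrival [measurable]: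
  "(\<lambda>\<omega>. cut t (arrival_epoch (Q \<omega>) k)) \<in> borel_measurable (past M Q t)"
proof (subst borel_measurable_iff_le, rule allI)
  fix a
  have "{\<omega> \<in> space M. arrival_epoch (Q \<omega>) k \<le> min a t} \<in> sets (past M Q t)"
    unfolding sets_past by (intro sigma_sets.Basic) (use min.cobounded2 in blast)
  moreover have "{\<omega> \<in> space M. cut t (arrival_epoch (Q \<omega>) k) \<le> a} =
      (if t + 1 \<le> a then space M else {\<omega> \<in> space M. arrival_epoch (Q \<omega>) k \<le> min a t})"
    by (auto simp: cut_def)
  moreover have "space M \<in> sets (past M Q t)" using sets.top[of "past M Q t"] by simp
  ultimately show "{w \<in> space (past M Q t). cut t (arrival_epoch (Q w) k) \<le> a} \<in> sets (past M Q t)"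
    by simp
qed

lemma past_cut_customer [measurable]:
  "(\<lambda>\<omega>. cut t (customer_epoch (Q \<omega>) j)) \<in> borel_measurable (past M Q t)"
proof -
  have "(\<lambda>\<omega>. (\<lambda>n \<omega>. if j < n then cut t 0 else cut t (arrival_epoch (Q \<omega>) (j - n)))
      (initial_number (Q \<omega>)) \<omega>) \<in> borel_measurable (past M Q t)"
    by (rule measurable_compose_countable) auto
  then show ?thesis by (simp add: customer_epoch_def if_distrib)
qed

text \<open>
The generators of the past show the duration of a service only once it has started, whence the
default value 0 before.
\<close>

lemma past_started_duration:
  assumes [measurable]: "(\<lambda>\<omega>. cut t (service_start (Q \<omega>) j)) \<in> borel_measurable (past M Q t)"
  shows "(\<lambda>\<omega>. if service_start (Q \<omega>) j \<le> t then service_duration (Q \<omega>) j else 0)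
    \<in> borel_measurable (past M Q t)"
proof (subst borel_measurable_iff_le, rule allI)
  fix a
  have 1: "{\<omega> \<in> space M. service_start (Q \<omega>) j \<le> t \<and> service_duration (Q \<omega>) j \<le> a} \<in> sets (past M Q t)"
    unfolding sets_past by (intro sigma_sets.Basic) blast
  have "{\<omega> \<in> space (past M Q t). t < cut t (service_start (Q \<omega>) j)} \<in> sets (past M Q t)" by measurable
  then have 2: "{\<omega> \<in> space M. t < service_start (Q \<omega>) j} \<in> sets (past M Q t)" by (simp add: less_cut_iff)
  have "{w \<in> space (past M Q t). (if service_start (Q w) j \<le> t then service_duration (Q w) j else 0) \<le> a}
    = {\<omega> \<in> space M. service_start (Q \<omega>) j \<le> t \<and> service_duration (Q \<omega>) j \<le> a} \<union>
      (if 0 \<le> a then {\<omega> \<in> space M. t < service_start (Q \<omega>) j} else {})"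
    by (auto simp: not_le)
  then show "{w \<in> space (past M Q t). (if service_start (Q w) j \<le> t then service_duration (Q w) j else 0) \<le> a}
    \<in> sets (past M Q t)" using 1 2 by auto
qed

lemma service_duration_nonneg: "\<omega> \<in> space M \<Longrightarrow> 0 \<le> service_duration (Q \<omega>) j"
  using valid by (simp add: valid_path_def)

lemma past_cut_end:
  assumes [measurable]: "(\<lambda>\<omega>. cut t (service_start (Q \<omega>) j)) \<in> borel_measurable (past M Q t)"
  shows "(\<lambda>\<omega>. cut t (service_end (Q \<omega>) j)) \<in> borel_measurable (past M Q t)"
proof -
  note past_started_duration[OF assms, measurable]
  have c: "cut t \<in> borel_measurable borel"
    unfolding cut_def[abs_def] by measurable
  have "(\<lambda>\<omega>. cut t (cut t (service_start (Q \<omega>) j) +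
      (if service_start (Q \<omega>) j \<le> t then service_duration (Q \<omega>) j else 0))) \<in> borel_measurable (past M Q t)"
    by (intro measurable_compose[OF _ c] borel_measurable_add assms past_started_duration)
  also have "?this \<longleftrightarrow> ?thesis"
    by (rule measurable_cong)
      (simp only: service_end_def space_past cut_add[OF service_duration_nonneg, symmetric])
  finally show ?thesis .
qed

lemma past_cut_service_start [measurable]:
  "(\<lambda>\<omega>. cut t (service_start (Q \<omega>) j)) \<in> borel_measurable (past M Q t)"
proof (induction j)
  case (Suc j)
  from past_cut_end[OF this] show ?case by (simp add: service_start_Suc cut_max)
qed simp

lemmas past_cut_service_end [measurable] = past_cut_end[OF past_cut_service_start]

lemma past_service_end_started [measurable]:
  "(\<lambda>\<omega>. if service_start (Q \<omega>) j \<le> t then service_end (Q \<omega>) j else 0) \<in> borel_measurable (past M Q t)"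
proof -
  have "(\<lambda>\<omega>. if cut t (service_start (Q \<omega>) j) \<le> t then cut t (service_start (Q \<omega>) j) +
     (if service_start (Q \<omega>) j \<le> t then service_duration (Q \<omega>) j else 0) else 0) \<in> borel_measurable (past M Q t)"
    by (rule measurable_If)
       (intro borel_measurable_add past_started_duration past_cut_service_start measurable_const, simp,
         measurable)
  also have "(\<lambda>\<omega>. if cut t (service_start (Q \<omega>) j) \<le> t then cut t (service_start (Q \<omega>) j) +
     (if service_start (Q \<omega>) j \<le> t then service_duration (Q \<omega>) j else 0) else 0) =
     (\<lambda>\<omega>. if service_start (Q \<omega>) j \<le> t then service_end (Q \<omega>) j else 0)"
    by (auto simp: fun_eq_iff service_end_def cut_def)
  finally show ?thesis .
qed

lemma past_number_in_system [measurable]: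
  "(\<lambda>\<omega>. number_in_system (Q \<omega>) t) \<in> measurable (past M Q t) (count_space UNIV)"
proof -
  have "(\<lambda>\<omega>. card {j. cut t (customer_epoch (Q \<omega>) j) \<le> t \<and> t < cut t (service_end (Q \<omega>) j)})
    \<in> measurable (past M Q t) (count_space UNIV)" by measurable
  then show ?thesis by (simp only: number_in_system_def cut_le_iff less_cut_iff)
qed

lemma past_awaiting [measurable]:
  "Measurable.pred (past M Q t) (\<lambda>\<omega>. awaiting c k (Q \<omega>) t)"
proof -
  have "Measurable.pred (past M Q t) (\<lambda>\<omega>. initial_number (Q \<omega>) = c \<and> 0 \<le> t \<and>
     (0 < k \<longrightarrow> cut t (arrival_epoch (Q \<omega>) (k - 1)) \<le> t) \<and> t < cut t (arrival_epoch (Q \<omega>) k))"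
    by measurable
  then show ?thesis by (simp only: awaiting_def cut_le_iff less_cut_iff)
qed

lemma past_number_found:
  "Measurable.pred (past M Q t) (\<lambda>\<omega>. arrival_epoch (Q \<omega>) k \<le> t \<and> number_found (Q \<omega>) k = m)"
proof -
  have "Measurable.pred (past M Q t) (\<lambda>\<omega>. cut t (arrival_epoch (Q \<omega>) k) \<le> t \<and>
    card {j. j < initial_number (Q \<omega>) + k \<and> cut t (arrival_epoch (Q \<omega>) k) < cut t (service_end (Q \<omega>) j)} = m)"
    by measurable
  also have "(\<lambda>\<omega>. cut t (arrival_epoch (Q \<omega>) k) \<le> t \<and>
    card {j. j < initial_number (Q \<omega>) + k \<and> cut t (arrival_epoch (Q \<omega>) k) < cut t (service_end (Q \<omega>) j)} = m)
    = (\<lambda>\<omega>. arrival_epoch (Q \<omega>) k \<le> t \<and> number_found (Q \<omega>) k = m)"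
    by (auto simp: fun_eq_iff number_found_def cut_less_cut_iff cut_le_iff)
  finally show ?thesis .
qed

end

section \<open>Arrival intensity given the past\<close>

lemma cond_prob_quotient_tendsto:
  fixes p :: "real \<Rightarrow> real"
  assumes "(\<lambda>h. p h - l * h) \<in> o[at_right 0](\<lambda>h. h)"
  shows "((\<lambda>h. p h / h) \<longlongrightarrow> l) (at_right 0)"
proof -
  have "((\<lambda>h. (p h - l * h) / h) \<longlongrightarrow> 0) (at_right 0)"
    by (rule smalloD_tendsto[OF assms])
  then have "((\<lambda>h. (p h - l * h) / h + l) \<longlongrightarrow> 0 + l) (at_right 0)"
    by (intro tendsto_add tendsto_const)
  moreover have "\<forall>\<^sub>F h in at_right 0. (p h - l * h) / h + l = p h / h"
    by (intro eventually_at_right_less[THEN eventually_mono]) (auto simp: field_simps)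
  ultimately show ?thesis using Lim_transform_eventually by fastforce
qed

context Mn_Gn_1_queue begin

lemma arrivals_in_measurable [measurable]:
  "(\<lambda>\<omega>. arrivals_in (Q \<omega>) a b) \<in> measurable M (count_space UNIV)"
  unfolding arrivals_in_def by measurable

lemma single_arrival_rate:
  assumes t: "0 \<le> t" and E: "E \<in> sets (past M Q t)"
  shows "((\<lambda>h. \<P>(\<omega> in M. \<omega> \<in> E \<and> number_in_system (Q \<omega>) t = n \<and> arrivals_in (Q \<omega>) t (t + h) = 1) / h)
      \<longlongrightarrow> rate n * \<P>(\<omega> in M. \<omega> \<in> E \<and> number_in_system (Q \<omega>) t = n)) (at_right 0)"
proof (cases "0 < \<P>(\<omega> in M. \<omega> \<in> E \<and> number_in_system (Q \<omega>) t = n)")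
  case True
  let ?p = "\<P>(\<omega> in M. \<omega> \<in> E \<and> number_in_system (Q \<omega>) t = n)"
  from tendsto_mult_right[OF cond_prob_quotient_tendsto[OF single_arrival[OF t E True]], of ?p] True
  show ?thesis by (simp add: cond_prob_def conj_ac)
next
  case False
  have [measurable]: "E \<in> sets M" by (rule sets_past_subset[OF E])
  from False have p0: "\<P>(\<omega> in M. \<omega> \<in> E \<and> number_in_system (Q \<omega>) t = n) = 0"
    by (simp add: not_less measure_le_0_iff)
  moreover have "\<P>(\<omega> in M. \<omega> \<in> E \<and> number_in_system (Q \<omega>) t = n \<and> arrivals_in (Q \<omega>) t (t + h) = 1)
    \<le> \<P>(\<omega> in M. \<omega> \<in> E \<and> number_in_system (Q \<omega>) t = n)" for h
    by (intro finite_measure_mono) auto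
  ultimately have "\<P>(\<omega> in M. \<omega> \<in> E \<and> number_in_system (Q \<omega>) t = n \<and> arrivals_in (Q \<omega>) t (t + h) = 1) = 0"
    for h by (simp add: measure_le_0_iff)
  then show ?thesis using p0 by simp
qed

lemma multiple_arrivals_negligible:
  assumes t: "0 \<le> t" and E: "E \<in> sets (past M Q t)"
  shows "((\<lambda>h. \<P>(\<omega> in M. \<omega> \<in> E \<and> number_in_system (Q \<omega>) t = n \<and> 2 \<le> arrivals_in (Q \<omega>) t (t + h)) / h)
      \<longlongrightarrow> 0) (at_right 0)"
proof (cases "0 < \<P>(\<omega> in M. \<omega> \<in> E \<and> number_in_system (Q \<omega>) t = n)")
  case True
  let ?p = "\<P>(\<omega> in M. \<omega> \<in> E \<and> number_in_system (Q \<omega>) t = n)"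
  from tendsto_mult_right[OF smalloD_tendsto[OF multiple_arrivals[OF t E True]], of ?p] True
  show ?thesis by (simp add: cond_prob_def conj_ac)
next
  case False
  have [measurable]: "E \<in> sets M" by (rule sets_past_subset[OF E])
  from False have p0: "\<P>(\<omega> in M. \<omega> \<in> E \<and> number_in_system (Q \<omega>) t = n) = 0"
    by (simp add: not_less measure_le_0_iff)
  moreover have "\<P>(\<omega> in M. \<omega> \<in> E \<and> number_in_system (Q \<omega>) t = n \<and> 2 \<le> arrivals_in (Q \<omega>) t (t + h))
    \<le> \<P>(\<omega> in M. \<omega> \<in> E \<and> number_in_system (Q \<omega>) t = n)" for h
    by (intro finite_measure_mono) auto
  ultimately have "\<P>(\<omega> in M. \<omega> \<in> E \<and> number_in_system (Q \<omega>) t = n \<and> 2 \<le> arrivals_in (Q \<omega>) t (t + h)) = 0"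
    for h by (simp add: measure_le_0_iff)
  then show ?thesis by simp
qed

lemma some_arrival_rate:
  assumes t: "0 \<le> t" and E: "E \<in> sets (past M Q t)"
  shows "((\<lambda>h. \<P>(\<omega> in M. \<omega> \<in> E \<and> number_in_system (Q \<omega>) t = n \<and> 1 \<le> arrivals_in (Q \<omega>) t (t + h)) / h)
      \<longlongrightarrow> rate n * \<P>(\<omega> in M. \<omega> \<in> E \<and> number_in_system (Q \<omega>) t = n)) (at_right 0)"
proof -
  have [measurable]: "E \<in> sets M" by (rule sets_past_subset[OF E])
  have "\<P>(\<omega> in M. \<omega> \<in> E \<and> number_in_system (Q \<omega>) t = n \<and> 1 \<le> arrivals_in (Q \<omega>) t (t + h)) =
      \<P>(\<omega> in M. \<omega> \<in> E \<and> number_in_system (Q \<omega>) t = n \<and> arrivals_in (Q \<omega>) t (t + h) = 1) +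
      \<P>(\<omega> in M. \<omega> \<in> E \<and> number_in_system (Q \<omega>) t = n \<and> 2 \<le> arrivals_in (Q \<omega>) t (t + h))" for h
    by (subst finite_measure_Union[symmetric]) (auto intro!: arg_cong[where f = "measure M"])
  then show ?thesis
    using tendsto_add[OF single_arrival_rate[OF assms, of n] multiple_arrivals_negligible[OF assms, of n]]
    by (simp add: add_divide_distrib)
qed

lemma arrivals_in_finite: "\<omega> \<in> space M \<Longrightarrow> finite {k. a \<le> arrival_epoch (Q \<omega>) k \<and> arrival_epoch (Q \<omega>) k \<le> b}"
  using finite_arrivals_until[OF valid] by (rule rev_finite_subset) auto

lemma arrivals_in_ge_1:
  assumes "\<omega> \<in> space M"
  shows "1 \<le> arrivals_in (Q \<omega>) a b \<longleftrightarrow> (\<exists>k. a \<le> arrival_epoch (Q \<omega>) k \<and> arrival_epoch (Q \<omega>) k \<le> b)"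
  using card_gt_0_iff[of "{k. a \<le> arrival_epoch (Q \<omega>) k \<and> arrival_epoch (Q \<omega>) k \<le> b}"]
    arrivals_in_finite[OF assms, of a b] by (auto simp: arrivals_in_def Suc_le_eq)

lemma arrivals_in_ge_2:
  assumes "\<omega> \<in> space M" "a \<le> arrival_epoch (Q \<omega>) k" "arrival_epoch (Q \<omega>) k \<le> b"
    "a \<le> arrival_epoch (Q \<omega>) l" "arrival_epoch (Q \<omega>) l \<le> b" "k \<noteq> l"
  shows "2 \<le> arrivals_in (Q \<omega>) a b"
proof -
  have "card {k, l} \<le> arrivals_in (Q \<omega>) a b"
    unfolding arrivals_in_def by (rule card_mono[OF arrivals_in_finite]) (use assms in auto)
  then show ?thesis using assms by simp
qed

text \<open>
The interval in \<^const>\<open>arrivals_in\<close> contains its left endpoint \<open>t\<close>.  An arrival at \<open>t\<close> therefore belongs to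
every interval starting there, and the probability of an arrival in such an interval vanishes with its
length.
\<close>

lemma arrival_epoch_no_atom:
  assumes t: "0 \<le> t"
  shows "AE \<omega> in M. arrival_epoch (Q \<omega>) k \<noteq> t"
proof -
  have "\<P>(\<omega> in M. number_in_system (Q \<omega>) t = n \<and> arrival_epoch (Q \<omega>) k = t) \<le> 0" for n
  proof (rule tendsto_lowerbound)
    let ?P = "\<lambda>h. \<P>(\<omega> in M. \<omega> \<in> space M \<and> number_in_system (Q \<omega>) t = n \<and> 1 \<le> arrivals_in (Q \<omega>) t (t + h))"
    have "space M \<in> sets (past M Q t)" using sets.top[of "past M Q t"] by simp
    from tendsto_mult[OF some_arrival_rate[OF t this, of n] tendsto_ident_at]
    have "((\<lambda>h. ?P h / h * h) \<longlongrightarrow> 0) (at_right 0)" by simp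
    moreover have "\<forall>\<^sub>F h in at_right 0. ?P h / h * h = ?P h"
      by (intro eventually_at_right_less[THEN eventually_mono]) auto
    ultimately show "(?P \<longlongrightarrow> 0) (at_right 0)" by (rule Lim_transform_eventually)
    show "\<forall>\<^sub>F h in at_right 0. \<P>(\<omega> in M. number_in_system (Q \<omega>) t = n \<and> arrival_epoch (Q \<omega>) k = t) \<le> ?P h"
    proof (rule eventually_at_right_less[THEN eventually_mono])
      fix h :: real assume "0 < h"
      then show "\<P>(\<omega> in M. number_in_system (Q \<omega>) t = n \<and> arrival_epoch (Q \<omega>) k = t) \<le> ?P h"
        by (intro finite_measure_mono subsetI)
           (auto simp: arrivals_in_ge_1 simp del: One_nat_def intro!: exI[of _ k])
    qed
  qed simp
  then have p0: "\<P>(\<omega> in M. number_in_system (Q \<omega>) t = n \<and> arrival_epoch (Q \<omega>) k = t) = 0" for n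
    by (simp add: measure_le_0_iff)
  have notin: "AE \<omega> in M. \<omega> \<notin> {\<omega> \<in> space M. number_in_system (Q \<omega>) t = n \<and> arrival_epoch (Q \<omega>) k = t}" for n
    by (rule prob_eq_0[THEN iffD1, OF _ p0]) measurable
  have "AE \<omega> in M. \<not> (number_in_system (Q \<omega>) t = n \<and> arrival_epoch (Q \<omega>) k = t)" for n
    using notin[of n] AE_space by eventually_elim auto
  then have "AE \<omega> in M. \<forall>n. \<not> (number_in_system (Q \<omega>) t = n \<and> arrival_epoch (Q \<omega>) k = t)"
    by (rule AE_all_countable[THEN iffD2, OF allI])
  then show ?thesis by eventually_elim auto
qed

text \<open>
While arrival \<open>k\<close> is awaited, \<open>k\<close> comes within \<open>h\<close> if and only if there is an arrival in the interval,
apart from the null event of an arrival at \<open>t\<close> itself.  At most \<open>c + k\<close> customers are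
present, so the arrival laws are summed over finitely many levels and no uniformity of their error
terms is needed.
\<close>

lemma next_arrival_rate:
  assumes t: "0 \<le> t" and E: "E \<in> sets (past M Q t)"
    and sub: "\<And>\<omega>. \<omega> \<in> E \<Longrightarrow> awaiting c k (Q \<omega>) t"
  shows "((\<lambda>h. \<P>(\<omega> in M. \<omega> \<in> E \<and> arrival_epoch (Q \<omega>) k \<le> t + h) / h)
      \<longlongrightarrow> (\<Sum>n\<le>c + k. rate n * \<P>(\<omega> in M. \<omega> \<in> E \<and> number_in_system (Q \<omega>) t = n))) (at_right 0)"
proof -
  have EM [measurable]: "E \<in> sets M" by (rule sets_past_subset[OF E])
  have AE: "AE \<omega> in M. \<forall>l. arrival_epoch (Q \<omega>) l \<noteq> t"
    using arrival_epoch_no_atom[OF t] by (simp add: AE_all_countable)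
  have eq: "\<P>(\<omega> in M. \<omega> \<in> E \<and> arrival_epoch (Q \<omega>) k \<le> t + h) =
      (\<Sum>n\<le>c + k. \<P>(\<omega> in M. \<omega> \<in> E \<and> number_in_system (Q \<omega>) t = n \<and> 1 \<le> arrivals_in (Q \<omega>) t (t + h)))" for h
  proof -
    have "\<P>(\<omega> in M. \<omega> \<in> E \<and> arrival_epoch (Q \<omega>) k \<le> t + h) =
      measure M (\<Union>n\<le>c + k. {\<omega> \<in> space M. \<omega> \<in> E \<and> number_in_system (Q \<omega>) t = n \<and> 1 \<le> arrivals_in (Q \<omega>) t (t + h)})"
    proof (rule finite_measure_eq_AE)
      show "AE \<omega> in M. (\<omega> \<in> {\<omega> \<in> space M. \<omega> \<in> E \<and> arrival_epoch (Q \<omega>) k \<le> t + h}) =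
        (\<omega> \<in> (\<Union>n\<le>c + k. {\<omega> \<in> space M. \<omega> \<in> E \<and> number_in_system (Q \<omega>) t = n \<and> 1 \<le> arrivals_in (Q \<omega>) t (t + h)}))"
        using AE AE_space
      proof eventually_elim
        case (elim \<omega>)
        have "arrival_epoch (Q \<omega>) k \<le> t + h \<longleftrightarrow> 1 \<le> arrivals_in (Q \<omega>) t (t + h)" if "\<omega> \<in> E"
        proof -
          note v = valid[OF elim(2)]
          have aw: "awaiting c k (Q \<omega>) t" by (rule sub[OF that])
          have "k \<le> l" if "t \<le> arrival_epoch (Q \<omega>) l" for l
          proof (rule ccontr)
            assume "\<not> k \<le> l"
            then have "arrival_epoch (Q \<omega>) l \<le> arrival_epoch (Q \<omega>) (k - 1)" "0 < k"
              using arrival_epoch_le_iff[OF v] by auto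
            then show False using aw elim(1) that by (metis awaiting_def order_antisym order_trans)
          qed
          then show ?thesis
            using aw arrival_epoch_le_iff[OF v, of k] unfolding arrivals_in_ge_1[OF elim(2)] awaiting_def
            by (meson less_imp_le order_trans)
        qed
        moreover have "number_in_system (Q \<omega>) t \<le> c + k" if "\<omega> \<in> E"
          using number_in_system_awaiting[OF valid[OF elim(2)] sub[OF that]] busy_le by simp
        ultimately show ?case by auto
      qed
    qed measurable
    also have "\<dots> = (\<Sum>n\<le>c + k. \<P>(\<omega> in M. \<omega> \<in> E \<and> number_in_system (Q \<omega>) t = n \<and> 1 \<le> arrivals_in (Q \<omega>) t (t + h)))"
      by (rule finite_measure_finite_Union) (auto simp: disjoint_family_on_def)
    finally show ?thesis .
  qed
  show ?thesis
    unfolding eq sum_divide_distrib by (intro tendsto_sum some_arrival_rate t E)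
qed

lemma next_arrival_rate_level:
  assumes t: "0 \<le> t" and E: "E \<in> sets (past M Q t)"
    and sub: "\<And>\<omega>. \<omega> \<in> E \<Longrightarrow> awaiting c k (Q \<omega>) t \<and> number_in_system (Q \<omega>) t = m"
  shows "((\<lambda>h. \<P>(\<omega> in M. \<omega> \<in> E \<and> arrival_epoch (Q \<omega>) k \<le> t + h) / h)
      \<longlongrightarrow> rate m * measure M E) (at_right 0)"
proof -
  have EM: "E \<in> sets M" by (rule sets_past_subset[OF E])
  then have EsM: "E \<subseteq> space M" by (rule sets.sets_into_space)
  have p: "\<P>(\<omega> in M. \<omega> \<in> E \<and> number_in_system (Q \<omega>) t = n) = (if n = m then measure M E else 0)" for n
  proof -
    have "{\<omega> \<in> space M. \<omega> \<in> E \<and> number_in_system (Q \<omega>) t = n} = (if n = m then E else {})"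
      using sub EsM by auto
    then show ?thesis by simp
  qed
  have "E = {}" if "\<not> m \<le> c + k"
    using sub that number_in_system_awaiting[OF valid] busy_le EsM by (metis equals0I subsetD)
  then have "(\<Sum>n\<le>c + k. rate n * \<P>(\<omega> in M. \<omega> \<in> E \<and> number_in_system (Q \<omega>) t = n)) = rate m * measure M E"
    unfolding p by (cases "m \<le> c + k") (auto simp: if_distrib cong: if_cong)
  then show ?thesis using next_arrival_rate[OF t E, of c k] sub by simp
qed

text \<open>
The arrival laws concern events of the past; a bounded function of the past is approximated uniformly by
functions with finitely many values, namely by rounding to multiples of \<open>1 / K\<close>.
\<close>

lemma next_arrival_rate_integral:
  assumes t: "0 \<le> t" and Y [measurable]: "Y \<in> borel_measurable (past M Q t)"
    and bound: "\<And>\<omega>. \<omega> \<in> space M \<Longrightarrow> \<bar>Y \<omega>\<bar> \<le> B"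
    and supp: "\<And>\<omega>. \<omega> \<in> space M \<Longrightarrow> Y \<omega> \<noteq> 0 \<Longrightarrow> awaiting c k (Q \<omega>) t \<and> number_in_system (Q \<omega>) t = m"
  shows "((\<lambda>h. (\<integral>\<omega>. (if arrival_epoch (Q \<omega>) k \<le> t + h then Y \<omega> else 0) \<partial>M) / h)
      \<longlongrightarrow> rate m * (\<integral>\<omega>. Y \<omega> \<partial>M)) (at_right 0)"
proof -
  have YM [measurable]: "Y \<in> borel_measurable M"
    by (rule measurable_from_subalg[OF subalgebra_past Y])
  define W where "W = {\<omega> \<in> space M. awaiting c k (Q \<omega>) t \<and> number_in_system (Q \<omega>) t = m}"
  have "{\<omega> \<in> space (past M Q t). awaiting c k (Q \<omega>) t \<and> number_in_system (Q \<omega>) t = m} \<in> sets (past M Q t)"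
    by measurable
  then have W: "W \<in> sets (past M Q t)" by (simp add: W_def)
  have WM [measurable]: "W \<in> sets M" by (rule sets_past_subset[OF W])
  let ?p = "\<lambda>h. \<P>(\<omega> in M. \<omega> \<in> W \<and> arrival_epoch (Q \<omega>) k \<le> t + h)"
  let ?G = "\<lambda>h. \<integral>\<omega>. (if arrival_epoch (Q \<omega>) k \<le> t + h then Y \<omega> else 0) \<partial>M"
  have pW: "((\<lambda>h. ?p h / h) \<longlongrightarrow> rate m * measure M W) (at_right 0)"
    by (rule next_arrival_rate_level[OF t W, where c = c]) (simp add: W_def)
  have B0: "0 \<le> B" using not_empty bound abs_ge_zero order_trans by (metis ex_in_conv)
  have iY: "integrable M Y"
    by (rule integrable_const_bound[where B = B]) (auto intro!: AE_I2 bound)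
  have iY': "integrable M (\<lambda>\<omega>. if arrival_epoch (Q \<omega>) k \<le> t + h then Y \<omega> else 0)" for h
    by (rule integrable_const_bound[where B = B]) (auto intro!: AE_I2 bound simp: B0)
  define y where "y = (\<lambda>K \<omega>. real_of_int \<lfloor>real K * Y \<omega>\<rfloor> / real K)"
  define Z where "Z = (\<lambda>K::nat. {- \<lceil>real K * B\<rceil> - 1..\<lceil>real K * B\<rceil> + 1})"
  have y_close: "\<bar>y K \<omega> - Y \<omega>\<bar> \<le> 1 / real K" if "0 < K" for K \<omega>
  proof -
    have "\<bar>real_of_int \<lfloor>real K * Y \<omega>\<rfloor> - real K * Y \<omega>\<bar> \<le> 1" by linarith
    then have "\<bar>(y K \<omega> - Y \<omega>) * real K\<bar> \<le> 1" using that by (simp add: y_def algebra_simps)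
    then show ?thesis using that by (simp add: abs_mult pos_le_divide_eq)
  qed
  have Y0: "Y \<omega> = 0" if "\<omega> \<in> space M" "\<omega> \<notin> W" for \<omega>
    using supp[OF that(1)] that by (auto simp: W_def)
  have y0: "y K \<omega> = 0" if "\<omega> \<in> space M" "\<omega> \<notin> W" for K \<omega>
    by (simp add: y_def Y0[OF that])
  have y_sum: "y K \<omega> = (\<Sum>z\<in>Z K. real_of_int z / real K * indicator {\<omega> \<in> W. \<lfloor>real K * Y \<omega>\<rfloor> = z} \<omega>)"
    if \<omega>: "\<omega> \<in> space M" for K \<omega>
  proof (cases "\<omega> \<in> W")
    case True
    have "\<bar>real K * Y \<omega>\<bar> \<le> real K * B" using bound[OF \<omega>] by (simp add: abs_mult mult_left_mono)
    then have "\<lfloor>real K * Y \<omega>\<rfloor> \<in> Z K" unfolding Z_def atLeastAtMost_iff by linarith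
    moreover have "(\<Sum>z\<in>Z K. real_of_int z / real K * indicator {\<omega> \<in> W. \<lfloor>real K * Y \<omega>\<rfloor> = z} \<omega>) =
       (\<Sum>z\<in>Z K. if z = \<lfloor>real K * Y \<omega>\<rfloor> then real_of_int z / real K else 0)"
      using True by (intro sum.cong) (auto simp: indicator_def)
    ultimately show ?thesis by (simp add: y_def Z_def)
  qed (use y0[OF \<omega>] in simp)
  have ySets: "{\<omega> \<in> W. \<lfloor>real K * Y \<omega>\<rfloor> = z} \<in> sets (past M Q t)" for K z
  proof -
    have "{\<omega> \<in> space (past M Q t). \<lfloor>real K * Y \<omega>\<rfloor> = z} \<in> sets (past M Q t)" by measurable
    then have "W \<inter> {\<omega> \<in> space M. \<lfloor>real K * Y \<omega>\<rfloor> = z} \<in> sets (past M Q t)" using W by auto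
    also have "W \<inter> {\<omega> \<in> space M. \<lfloor>real K * Y \<omega>\<rfloor> = z} = {\<omega> \<in> W. \<lfloor>real K * Y \<omega>\<rfloor> = z}"
      by (auto simp: W_def)
    finally show ?thesis .
  qed
  note [measurable] = sets_past_subset[OF ySets]
  let ?g = "\<lambda>K h. \<integral>\<omega>. (if arrival_epoch (Q \<omega>) k \<le> t + h then y K \<omega> else 0) \<partial>M"
  have yM [measurable]: "y K \<in> borel_measurable M" for K unfolding y_def by measurable
  have iy: "integrable M (y K)" "integrable M (\<lambda>\<omega>. if arrival_epoch (Q \<omega>) k \<le> t + h then y K \<omega> else 0)"
    if "0 < K" for K h
  proof -
    have b: "\<bar>y K \<omega>\<bar> \<le> B + 1 / real K" if "\<omega> \<in> space M" for \<omega>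
      using y_close[OF \<open>0 < K\<close>, of \<omega>] bound[OF that] by linarith
    show "integrable M (y K)"
      by (rule integrable_const_bound[where B = "B + 1 / real K"]) (auto intro!: AE_I2 b)
    show "integrable M (\<lambda>\<omega>. if arrival_epoch (Q \<omega>) k \<le> t + h then y K \<omega> else 0)"
      by (rule integrable_const_bound[where B = "B + 1 / real K"])
         (auto intro!: AE_I2 b simp: B0)
  qed
  have g_eq: "?g K h = (\<Sum>z\<in>Z K. real_of_int z / real K *
      \<P>(\<omega> in M. \<omega> \<in> {\<omega> \<in> W. \<lfloor>real K * Y \<omega>\<rfloor> = z} \<and> arrival_epoch (Q \<omega>) k \<le> t + h))" for K h
  proof -
    have "?g K h = (\<integral>\<omega>. (\<Sum>z\<in>Z K. real_of_int z / real K *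
        indicator {\<omega> \<in> space M. \<omega> \<in> {\<omega> \<in> W. \<lfloor>real K * Y \<omega>\<rfloor> = z} \<and> arrival_epoch (Q \<omega>) k \<le> t + h} \<omega>) \<partial>M)"
      by (intro Bochner_Integration.integral_cong refl) (auto simp: y_sum indicator_def intro!: sum.cong)
    also have "\<dots> = (\<Sum>z\<in>Z K. real_of_int z / real K *
      \<P>(\<omega> in M. \<omega> \<in> {\<omega> \<in> W. \<lfloor>real K * Y \<omega>\<rfloor> = z} \<and> arrival_epoch (Q \<omega>) k \<le> t + h))"
      by (subst Bochner_Integration.integral_sum) (auto simp: Z_def emeasure_eq_measure)
    finally show ?thesis .
  qed
  have y_eq: "(\<integral>\<omega>. y K \<omega> \<partial>M) = (\<Sum>z\<in>Z K. real_of_int z / real K * measure M {\<omega> \<in> W. \<lfloor>real K * Y \<omega>\<rfloor> = z})" for K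
  proof -
    have "(\<integral>\<omega>. y K \<omega> \<partial>M) = (\<integral>\<omega>. (\<Sum>z\<in>Z K. real_of_int z / real K *
        indicator {\<omega> \<in> W. \<lfloor>real K * Y \<omega>\<rfloor> = z} \<omega>) \<partial>M)"
      by (intro Bochner_Integration.integral_cong refl y_sum)
    also have "\<dots> = (\<Sum>z\<in>Z K. real_of_int z / real K * measure M {\<omega> \<in> W. \<lfloor>real K * Y \<omega>\<rfloor> = z})"
      by (subst Bochner_Integration.integral_sum) (auto simp: Z_def emeasure_eq_measure)
    finally show ?thesis .
  qed
  have g_lim: "((\<lambda>h. ?g K h / h) \<longlongrightarrow> rate m * (\<integral>\<omega>. y K \<omega> \<partial>M)) (at_right 0)" for K
  proof -
    have "((\<lambda>h. \<Sum>z\<in>Z K. real_of_int z / real K *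
      (\<P>(\<omega> in M. \<omega> \<in> {\<omega> \<in> W. \<lfloor>real K * Y \<omega>\<rfloor> = z} \<and> arrival_epoch (Q \<omega>) k \<le> t + h) / h))
      \<longlongrightarrow> (\<Sum>z\<in>Z K. real_of_int z / real K * (rate m * measure M {\<omega> \<in> W. \<lfloor>real K * Y \<omega>\<rfloor> = z}))) (at_right 0)"
      by (intro tendsto_sum tendsto_mult tendsto_const next_arrival_rate_level[OF t ySets, where c = c]) (simp add: W_def)
    then show ?thesis
      unfolding g_eq y_eq sum_divide_distrib sum_distrib_left by (simp add: mult_ac)
  qed
  show ?thesis
  proof (rule tendstoI)
    fix \<epsilon> :: real assume \<epsilon>: "0 < \<epsilon>"
    define r where "r = rate m * measure M W + 1"
    have r: "0 < r" using rate_pos[of m] by (simp add: r_def add_nonneg_pos)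
    \<comment> \<open>rounding costs \<open>r / K\<close> in the difference quotient, once \<open>h\<close> is small, and \<open>rate m / K\<close> in the limit\<close>
    obtain K :: nat where K: "3 * (r + rate m) / \<epsilon> < real K" using reals_Archimedean2 by blast
    have "0 < 3 * (r + rate m) / \<epsilon>" using r rate_pos[of m] \<epsilon> by simp
    then have K0: "0 < K" using K by linarith
    have K': "(r + rate m) / real K < \<epsilon> / 3" using K K0 \<epsilon> by (simp add: field_simps)
    have split: "(r + rate m) / real K = r / real K + rate m / real K" by (simp add: add_divide_distrib)
    have 1: "\<forall>\<^sub>F h in at_right 0. ?p h / h < r"
      by (rule order_tendstoD(2)[OF pW]) (simp add: r_def)
    have 2: "\<forall>\<^sub>F h in at_right 0. dist (?g K h / h) (rate m * (\<integral>\<omega>. y K \<omega> \<partial>M)) < \<epsilon> / 3"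
      by (rule tendstoD[OF g_lim]) (use \<epsilon> in simp)
    have 3: "\<bar>(\<integral>\<omega>. y K \<omega> \<partial>M) - (\<integral>\<omega>. Y \<omega> \<partial>M)\<bar> \<le> 1 / real K"
    proof -
      have "\<bar>\<integral>\<omega>. y K \<omega> - Y \<omega> \<partial>M\<bar> \<le> (\<integral>\<omega>. \<bar>y K \<omega> - Y \<omega>\<bar> \<partial>M)" by (rule integral_abs_bound)
      also have "\<dots> \<le> (\<integral>\<omega>. 1 / real K \<partial>M)"
        using iy(1)[OF K0] iY y_close[OF K0] by (intro integral_mono) auto
      finally show ?thesis using iy(1)[OF K0] iY by (simp add: prob_space)
    qed
    have 4: "\<bar>?G h - ?g K h\<bar> \<le> 1 / real K * ?p h" for h
    proof -
      have "\<bar>\<integral>\<omega>. (if arrival_epoch (Q \<omega>) k \<le> t + h then Y \<omega> else 0) -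
          (if arrival_epoch (Q \<omega>) k \<le> t + h then y K \<omega> else 0) \<partial>M\<bar> \<le>
          (\<integral>\<omega>. \<bar>(if arrival_epoch (Q \<omega>) k \<le> t + h then Y \<omega> else 0) -
          (if arrival_epoch (Q \<omega>) k \<le> t + h then y K \<omega> else 0)\<bar> \<partial>M)" by (rule integral_abs_bound)
      also have "\<dots> \<le> (\<integral>\<omega>. 1 / real K * indicator {\<omega> \<in> space M. \<omega> \<in> W \<and> arrival_epoch (Q \<omega>) k \<le> t + h} \<omega> \<partial>M)"
      proof (rule integral_mono)
        fix \<omega> assume \<omega>: "\<omega> \<in> space M"
        show "\<bar>(if arrival_epoch (Q \<omega>) k \<le> t + h then Y \<omega> else 0) -
          (if arrival_epoch (Q \<omega>) k \<le> t + h then y K \<omega> else 0)\<bar>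
          \<le> 1 / real K * indicator {\<omega> \<in> space M. \<omega> \<in> W \<and> arrival_epoch (Q \<omega>) k \<le> t + h} \<omega>"
          using y_close[OF K0, of \<omega>] \<omega> y0[OF \<omega>, of K] Y0[OF \<omega>]
          by (cases "\<omega> \<in> W") (auto simp: abs_minus_commute)
      qed (use iY' iy(2)[OF K0] in \<open>auto simp: emeasure_eq_measure\<close>)
      also have "\<dots> = 1 / real K * ?p h" by simp
      finally show ?thesis using iY'[of h] iy(2)[OF K0, of h] by simp
    qed
    show "\<forall>\<^sub>F h in at_right 0. dist (?G h / h) (rate m * (\<integral>\<omega>. Y \<omega> \<partial>M)) < \<epsilon>"
      using 1 2 eventually_at_right_less[of "0::real"]
    proof eventually_elim
      case (elim h)
      have "\<bar>?G h / h - ?g K h / h\<bar> = \<bar>?G h - ?g K h\<bar> / h"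
        using elim(3) by (simp add: diff_divide_distrib[symmetric] abs_divide)
      also have "\<dots> \<le> 1 / real K * ?p h / h" using 4[of h] elim(3) by (intro divide_right_mono) auto
      also have "\<dots> = 1 / real K * (?p h / h)" by simp
      also have "\<dots> \<le> 1 / real K * r" using elim(1) by (intro mult_left_mono) auto
      finally have "\<bar>?G h / h - ?g K h / h\<bar> \<le> r / real K" by simp
      moreover have "\<bar>rate m * (\<integral>\<omega>. y K \<omega> \<partial>M) - rate m * (\<integral>\<omega>. Y \<omega> \<partial>M)\<bar> \<le> rate m / real K"
        using mult_left_mono[OF 3, of "rate m"] rate_pos[of m]
        by (simp add: abs_mult right_diff_distrib[symmetric])
      ultimately show ?case using elim(2) K' split \<epsilon> unfolding dist_real_def by linarith
    qed
  qed
qed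

end

text \<open>
The first of the services that are not yet over at \<open>t\<close> is in progress at \<open>t\<close>, and it ends first.  This reduces
completions after \<open>t\<close> to the service in progress, whose end the past determines.
\<close>

lemma completion_in_progress:
  assumes v: "valid_path q" and aw: "awaiting c k q t"
    and j: "j < c + k" "t < service_end q j" "service_end q j \<le> u"
  shows "\<exists>i<c + k. service_start q i \<le> t \<and> t < service_end q i \<and> service_end q i \<le> u"
proof -
  define m where "m = busy q (c + k) t"
  have "m \<noteq> 0" using j unfolding m_def busy_eq_0_iff by (auto simp: not_le)
  then have m: "0 < m" by simp
  have 1: "m \<le> c + k" "service_start q (c + k - m) \<le> t" "t < service_end q (c + k - m)"
    using busy_eq_iff[OF v m, of "c + k" t] customer_epoch_awaiting[OF v aw] by (simp_all add: m_def)
  have "\<not> j < c + k - m"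
    using busy_eq_iff_ends[OF v m, of "c + k" t] j by (auto simp: m_def not_le)
  then have "service_end q (c + k - m) \<le> u"
    using mono_service_end[OF v, of "c + k - m" j] j by simp
  then show ?thesis using 1 m by (intro exI[of _ "c + k - m"]) auto
qed

lemma (in finite_measure) abs_integral_le_indicators:
  fixes f :: "'a \<Rightarrow> real"
  assumes f: "integrable M f" and [measurable]: "A \<in> sets M" "B \<in> sets M" "C \<in> sets M"
    and bound: "\<And>\<omega>. \<omega> \<in> space M \<Longrightarrow>
      \<bar>f \<omega>\<bar> \<le> a * indicator A \<omega> + b * indicator B \<omega> + c * indicator C \<omega>"
  shows "\<bar>\<integral>\<omega>. f \<omega> \<partial>M\<bar> \<le> a * measure M A + b * measure M B + c * measure M C"
proof -
  have i: "integrable M (\<lambda>\<omega>. r * indicator S \<omega>)" "(\<integral>\<omega>. r * indicator S \<omega> \<partial>M) = r * measure M S"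
    if "S \<in> sets M" for r :: real and S
    using that sets.sets_into_space[OF that] by (auto simp: emeasure_eq_measure Int_absorb2)
  have "\<bar>\<integral>\<omega>. f \<omega> \<partial>M\<bar> \<le> (\<integral>\<omega>. \<bar>f \<omega>\<bar> \<partial>M)" by (rule integral_abs_bound)
  also have "\<dots> \<le> (\<integral>\<omega>. a * indicator A \<omega> + b * indicator B \<omega> + c * indicator C \<omega> \<partial>M)"
    by (rule integral_mono) (use f in \<open>auto intro!: Bochner_Integration.integrable_add i assms bound\<close>)
  also have "\<dots> = a * measure M A + b * measure M B + c * measure M C"
    by (simp only: Bochner_Integration.integral_add[OF Bochner_Integration.integrable_add[OF i(1) i(1)] i(1)]
        Bochner_Integration.integral_add[OF i(1) i(1)] i(2) assms)
  finally show ?thesis .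
qed

context Mn_Gn_1_queue begin

definition completing_within :: "nat \<Rightarrow> nat \<Rightarrow> real \<Rightarrow> real \<Rightarrow> 'a set" where
  "completing_within c k t \<delta> = {\<omega> \<in> space M. awaiting c k (Q \<omega>) t \<and>
     (\<exists>j<c + k. service_start (Q \<omega>) j \<le> t \<and> t < service_end (Q \<omega>) j \<and> service_end (Q \<omega>) j \<le> t + \<delta>)}"

lemma completing_within_past: "completing_within c k t \<delta> \<in> sets (past M Q t)"
proof -
  have "{\<omega> \<in> space (past M Q t). awaiting c k (Q \<omega>) t \<and>
     (\<exists>j<c + k. cut t (service_start (Q \<omega>) j) \<le> t \<and> t < cut t (service_end (Q \<omega>) j) \<and>
       (if service_start (Q \<omega>) j \<le> t then service_end (Q \<omega>) j else 0) \<le> t + \<delta>)} \<in> sets (past M Q t)"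
    by measurable
  also have "{\<omega> \<in> space (past M Q t). awaiting c k (Q \<omega>) t \<and>
     (\<exists>j<c + k. cut t (service_start (Q \<omega>) j) \<le> t \<and> t < cut t (service_end (Q \<omega>) j) \<and>
       (if service_start (Q \<omega>) j \<le> t then service_end (Q \<omega>) j else 0) \<le> t + \<delta>)} = completing_within c k t \<delta>"
    by (auto simp: completing_within_def cut_le_iff less_cut_iff)
  finally show ?thesis .
qed

text \<open>
A service in progress at \<open>t\<close> ends strictly after \<open>t\<close>, so on each path the event fails for small \<open>\<delta>\<close>.
\<close>

lemma completing_within_vanishes:
  "(\<lambda>i. measure M (completing_within c k t (1 / real (Suc i)))) \<longlonglongrightarrow> 0"
proof -
  let ?A = "\<lambda>i. completing_within c k t (1 / real (Suc i))"
  have "(\<lambda>i. measure M (?A i)) \<longlonglongrightarrow> measure M (\<Inter>i. ?A i)"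
  proof (rule finite_Lim_measure_decseq)
    show "range ?A \<subseteq> sets M" using sets_past_subset[OF completing_within_past] by auto
    show "decseq ?A"
    proof (rule decseq_SucI, rule subsetI)
      fix i \<omega> assume "\<omega> \<in> ?A (Suc i)"
      moreover have "1 / real (Suc (Suc i)) \<le> 1 / real (Suc i)" by (simp add: frac_le)
      ultimately show "\<omega> \<in> ?A i" unfolding completing_within_def by force
    qed
  qed
  also have "(\<Inter>i. ?A i) = {}"
  proof (rule equals0I)
    fix \<omega> assume \<omega>: "\<omega> \<in> (\<Inter>i. ?A i)"
    then have sp: "\<omega> \<in> space M" by (auto simp: completing_within_def)
    have ex: "\<exists>j. service_start (Q \<omega>) j \<le> t \<and> t < service_end (Q \<omega>) j \<and>
        service_end (Q \<omega>) j \<le> t + 1 / real (Suc i)" for i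
      using \<omega> by (auto simp: completing_within_def)
    from ex[of 0] obtain j where j: "service_start (Q \<omega>) j \<le> t" "t < service_end (Q \<omega>) j" by blast
    have "service_end (Q \<omega>) j - t \<le> 1 / real (Suc i)" for i
    proof -
      obtain l where l: "service_start (Q \<omega>) l \<le> t" "t < service_end (Q \<omega>) l"
        "service_end (Q \<omega>) l \<le> t + 1 / real (Suc i)" using ex[of i] by blast
      have "l = j" by (rule service_in_progress_unique[OF valid[OF sp] l(1,2) j])
      then show ?thesis using l by simp
    qed
    moreover obtain i where "1 / real (Suc i) < service_end (Q \<omega>) j - t"
      using nat_approx_posE[of "service_end (Q \<omega>) j - t"] j by auto
    ultimately show False using not_le by blast
  qed
  finally show ?thesis by simp
qed

text \<open>
\<open>X\<close> is a mark carried by arrival \<open>k\<close>, and \<open>Y\<close> is its prediction at time \<open>t\<close>, which is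
accurate up to \<open>L\<close> times the remaining time if no service is completed before the arrival.  Within \<open>h\<close>, mark and
prediction can differ for three reasons: two arrivals, of probability \<open>o(h)\<close>; drift of the
prediction, of order \<open>L * h\<close> on an event of probability \<open>O(h)\<close>; a completion and an arrival.  The last
event has probability at most of order \<open>h\<close> times that of a completion within \<open>\<delta>\<close>, for every fixed
\<open>\<delta> \<ge> h\<close>, and is therefore \<open>o(h)\<close> as well.
\<close>

lemma arrival_functional_derivative:
  assumes t: "0 \<le> t"
    and X [measurable]: "X \<in> borel_measurable M" and Xb: "\<And>\<omega>. \<omega> \<in> space M \<Longrightarrow> \<bar>X \<omega>\<bar> \<le> B"
    and X0: "\<And>\<omega>. \<omega> \<in> space M \<Longrightarrow> X \<omega> \<noteq> 0 \<Longrightarrow> initial_number (Q \<omega>) = c"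
    and Y: "Y \<in> borel_measurable (past M Q t)" and Yb: "\<And>\<omega>. \<omega> \<in> space M \<Longrightarrow> \<bar>Y \<omega>\<bar> \<le> B"
    and supp: "\<And>\<omega>. \<omega> \<in> space M \<Longrightarrow> Y \<omega> \<noteq> 0 \<Longrightarrow> awaiting c k (Q \<omega>) t \<and> number_in_system (Q \<omega>) t = m"
    and freeze: "\<And>\<omega>. \<omega> \<in> space M \<Longrightarrow> awaiting c k (Q \<omega>) t \<Longrightarrow>
      (\<And>j. j < c + k \<Longrightarrow> t < service_end (Q \<omega>) j \<Longrightarrow> arrival_epoch (Q \<omega>) k < service_end (Q \<omega>) j) \<Longrightarrow>
      \<bar>X \<omega> - Y \<omega>\<bar> \<le> L * (arrival_epoch (Q \<omega>) k - t)"
    and L: "0 \<le> L"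
  shows "((\<lambda>h. ((\<integral>\<omega>. (if arrival_epoch (Q \<omega>) k \<le> t + h then X \<omega> else 0) \<partial>M) -
        (\<integral>\<omega>. (if arrival_epoch (Q \<omega>) k \<le> t then X \<omega> else 0) \<partial>M)) / h)
      \<longlongrightarrow> rate m * (\<integral>\<omega>. Y \<omega> \<partial>M)) (at_right 0)"
proof -
  have YM [measurable]: "Y \<in> borel_measurable M"
    by (rule measurable_from_subalg[OF subalgebra_past Y])
  have B0: "0 \<le> B" using not_empty Xb abs_ge_zero order_trans by (metis ex_in_conv)
  let ?X = "\<lambda>u \<omega>. if arrival_epoch (Q \<omega>) k \<le> u then X \<omega> else 0"
  let ?Y = "\<lambda>u \<omega>. if arrival_epoch (Q \<omega>) k \<le> u then Y \<omega> else 0"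
  have iX: "integrable M (?X u)" and iY: "integrable M (?Y u)" for u
    by (auto intro!: integrable_const_bound[where B = B] AE_I2 Xb Yb simp: B0)
  let ?S2 = "\<lambda>h. {\<omega> \<in> space M. number_in_system (Q \<omega>) t \<le> c + k \<and> 2 \<le> arrivals_in (Q \<omega>) t (t + h)}"
  define SA where "SA = {\<omega> \<in> space M. awaiting c k (Q \<omega>) t}"
  have SA: "SA \<in> sets (past M Q t)"
  proof -
    have "{\<omega> \<in> space (past M Q t). awaiting c k (Q \<omega>) t} \<in> sets (past M Q t)" by measurable
    then show ?thesis by (simp add: SA_def)
  qed
  let ?SW = "\<lambda>i. completing_within c k t (1 / real (Suc i))"
  note [measurable] = sets_past_subset[OF SA] sets_past_subset[OF completing_within_past]
  let ?p2 = "\<lambda>h. measure M (?S2 h)"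
  let ?pA = "\<lambda>h. \<P>(\<omega> in M. \<omega> \<in> SA \<and> arrival_epoch (Q \<omega>) k \<le> t + h)"
  let ?pW = "\<lambda>i h. \<P>(\<omega> in M. \<omega> \<in> ?SW i \<and> arrival_epoch (Q \<omega>) k \<le> t + h)"
  let ?D = "\<lambda>h. (\<integral>\<omega>. ?X (t + h) \<omega> \<partial>M) - (\<integral>\<omega>. ?X t \<omega> \<partial>M)"
  let ?G = "\<lambda>h. (\<integral>\<omega>. ?Y (t + h) \<omega> \<partial>M)"
  \<comment> \<open>if \<open>k\<close> arrives within \<open>h\<close> although it is not awaited at \<open>t\<close>, there are two arrivals or \<open>X\<close> and \<open>Y\<close> vanish\<close>
  have pathwise: "\<bar>?X (t + h) \<omega> - ?X t \<omega> - ?Y (t + h) \<omega>\<bar> \<le> B * indicator (?S2 h) \<omega> +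
      L * h * indicator {\<omega> \<in> space M. \<omega> \<in> SA \<and> arrival_epoch (Q \<omega>) k \<le> t + h} \<omega> +
      2 * B * indicator {\<omega> \<in> space M. \<omega> \<in> ?SW i \<and> arrival_epoch (Q \<omega>) k \<le> t + h} \<omega>"
    if \<omega>: "\<omega> \<in> space M" and h: "0 < h" "h \<le> 1 / real (Suc i)" for \<omega> h i
  proof -
    note v = valid[OF \<omega>]
    let ?a = "arrival_epoch (Q \<omega>) k"
    have nn: "0 \<le> B * indicator (?S2 h) \<omega>"
      "0 \<le> L * h * indicator {\<omega> \<in> space M. \<omega> \<in> SA \<and> arrival_epoch (Q \<omega>) k \<le> t + h} \<omega>"
      "0 \<le> 2 * B * indicator {\<omega> \<in> space M. \<omega> \<in> ?SW i \<and> arrival_epoch (Q \<omega>) k \<le> t + h} \<omega>"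
      using B0 L h by (auto simp: indicator_def)
    consider "t + h < ?a" | "?a \<le> t" | "t < ?a" "?a \<le> t + h" "awaiting c k (Q \<omega>) t"
      | "t < ?a" "?a \<le> t + h" "\<not> awaiting c k (Q \<omega>) t" by linarith
    then show ?thesis
    proof cases
      case 1
      then show ?thesis using nn h by simp
    next
      case 2
      then have "Y \<omega> = 0" using supp[OF \<omega>] by (auto simp: awaiting_def)
      then show ?thesis using nn h 2 by simp
    next
      case 3
      then have lhs: "\<bar>?X (t + h) \<omega> - ?X t \<omega> - ?Y (t + h) \<omega>\<bar> = \<bar>X \<omega> - Y \<omega>\<bar>" by simp
      show ?thesis
      proof (cases "\<omega> \<in> ?SW i")
        case True
        have "\<bar>X \<omega> - Y \<omega>\<bar> \<le> 2 * B" using Xb[OF \<omega>] Yb[OF \<omega>] by linarith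
        moreover have "2 * B * indicator {\<omega> \<in> space M. \<omega> \<in> ?SW i \<and> arrival_epoch (Q \<omega>) k \<le> t + h} \<omega> = 2 * B"
          using True 3(2) \<omega> by simp
        ultimately show ?thesis using lhs nn(1,2) by linarith
      next
        case False
        have "\<bar>X \<omega> - Y \<omega>\<bar> \<le> L * (?a - t)"
        proof (rule freeze[OF \<omega> 3(3)], rule ccontr)
          fix j assume "j < c + k" "t < service_end (Q \<omega>) j" "\<not> ?a < service_end (Q \<omega>) j"
          moreover from this have "service_end (Q \<omega>) j \<le> t + 1 / real (Suc i)" using 3(2) h by linarith
          ultimately show False
            using completion_in_progress[OF v 3(3)] False \<omega> 3(3) by (auto simp: completing_within_def)
        qed
        also have "\<dots> \<le> L * h" using 3(2) L by (intro mult_left_mono) auto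
        also have "L * h = L * h * indicator {\<omega> \<in> space M. \<omega> \<in> SA \<and> arrival_epoch (Q \<omega>) k \<le> t + h} \<omega>"
          using 3 \<omega> by (simp add: SA_def)
        finally show ?thesis using lhs nn(1,3) by linarith
      qed
    next
      case 4
      then have "Y \<omega> = 0" using supp[OF \<omega>] by auto
      moreover have "\<bar>X \<omega>\<bar> \<le> B * indicator (?S2 h) \<omega>"
      proof (cases "X \<omega> = 0")
        case False
        have c: "initial_number (Q \<omega>) = c" by (rule X0[OF \<omega> False])
        from 4 c t have k: "0 < k" "t < arrival_epoch (Q \<omega>) (k - 1)" by (auto simp: awaiting_def)
        have a: "arrival_epoch (Q \<omega>) (k - 1) < ?a" using arrival_epoch_less_iff[OF v] k by simp
        have "2 \<le> arrivals_in (Q \<omega>) t (t + h)"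
          by (rule arrivals_in_ge_2[OF \<omega>, of _ "k - 1" _ k]) (use 4 k a in auto)
        moreover have "number_in_system (Q \<omega>) t \<le> c + k"
        proof -
          obtain l where l: "awaiting c l (Q \<omega>) t" using exists_awaiting[OF v t] c by auto
          have "l \<le> k"
          proof (rule ccontr)
            assume "\<not> l \<le> k"
            then have "?a \<le> arrival_epoch (Q \<omega>) (l - 1)" "0 < l" using arrival_epoch_le_iff[OF v] by auto
            then show False using l 4(1) by (auto simp: awaiting_def)
          qed
          then show ?thesis using number_in_system_awaiting[OF v l] busy_le[of "Q \<omega>" "c + l" t] by simp
        qed
        ultimately show ?thesis using Xb[OF \<omega>] \<omega> by simp
      qed (use nn in simp)
      moreover have "?X (t + h) \<omega> - ?X t \<omega> = X \<omega>" using 4 by simp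
      ultimately show ?thesis using nn(2,3) by simp
    qed
  qed
  have bound: "\<bar>?D h - ?G h\<bar> \<le> B * ?p2 h + L * h * ?pA h + 2 * B * ?pW i h"
    if h: "0 < h" "h \<le> 1 / real (Suc i)" for h i
  proof -
    have m2: "?S2 h \<in> sets M" by measurable
    have mA: "{\<omega> \<in> space M. \<omega> \<in> SA \<and> arrival_epoch (Q \<omega>) k \<le> t + h} \<in> sets M" by measurable
    have mW: "{\<omega> \<in> space M. \<omega> \<in> ?SW i \<and> arrival_epoch (Q \<omega>) k \<le> t + h} \<in> sets M" by measurable
    have eq: "?D h - ?G h = (\<integral>\<omega>. ?X (t + h) \<omega> - ?X t \<omega> - ?Y (t + h) \<omega> \<partial>M)"
      by (simp only: Bochner_Integration.integral_diff[OF Bochner_Integration.integrable_diff[OF iX iX] iY]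
            Bochner_Integration.integral_diff[OF iX iX])
    show ?thesis unfolding eq
    proof (rule abs_integral_le_indicators[OF _ m2 mA mW])
      show "integrable M (\<lambda>\<omega>. ?X (t + h) \<omega> - ?X t \<omega> - ?Y (t + h) \<omega>)"
        by (rule Bochner_Integration.integrable_diff[OF Bochner_Integration.integrable_diff[OF
              iX[of "t + h"] iX[of t]] iY[of "t + h"]])
    qed (rule pathwise[OF _ h])
  qed
  have lim2: "((\<lambda>h. ?p2 h / h) \<longlongrightarrow> 0) (at_right 0)"
  proof -
    let ?q = "\<lambda>n h. \<P>(\<omega> in M. \<omega> \<in> space M \<and> number_in_system (Q \<omega>) t = n \<and> 2 \<le> arrivals_in (Q \<omega>) t (t + h))"
    have sp: "space M \<in> sets (past M Q t)" using sets.top[of "past M Q t"] by simp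
    have eq: "?p2 h = (\<Sum>n\<le>c + k. ?q n h)" for h
    proof -
      have "?S2 h = (\<Union>n\<le>c + k. {\<omega> \<in> space M. \<omega> \<in> space M \<and> number_in_system (Q \<omega>) t = n \<and>
          2 \<le> arrivals_in (Q \<omega>) t (t + h)})" by auto
      then show ?thesis
        by (simp only:) (rule finite_measure_finite_Union; auto simp: disjoint_family_on_def)
    qed
    have "((\<lambda>h. \<Sum>n\<le>c + k. ?q n h / h) \<longlongrightarrow> (\<Sum>n\<le>c + k. 0)) (at_right 0)"
      by (intro tendsto_sum multiple_arrivals_negligible t sp)
    then show ?thesis unfolding eq sum_divide_distrib by simp
  qed
  have limA: "(?pA \<longlongrightarrow> 0) (at_right 0)"
  proof (rule Lim_transform_eventually)
    have "((\<lambda>h. ?pA h / h * h) \<longlongrightarrow> (\<Sum>n\<le>c + k. rate n * \<P>(\<omega> in M. \<omega> \<in> SA \<and> number_in_system (Q \<omega>) t = n)) * 0) (at_right 0)"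
      by (intro tendsto_mult next_arrival_rate[OF t SA] tendsto_ident_at) (simp add: SA_def)
    then show "((\<lambda>h. ?pA h / h * h) \<longlongrightarrow> 0) (at_right 0)" by simp
    show "\<forall>\<^sub>F h in at_right 0. ?pA h / h * h = ?pA h"
      by (intro eventually_at_right_less[THEN eventually_mono]) auto
  qed
  define \<Lambda> where "\<Lambda> = (\<Sum>n\<le>c + k. rate n)"
  have \<Lambda>0: "0 \<le> \<Lambda>" unfolding \<Lambda>_def using rate_pos by (intro sum_nonneg) (auto intro: less_imp_le)
  have DG: "((\<lambda>h. (?D h - ?G h) / h) \<longlongrightarrow> 0) (at_right 0)"
  proof (rule tendstoI)
    fix \<epsilon> :: real assume \<epsilon>: "0 < \<epsilon>"
    \<comment> \<open>first \<open>\<delta> = 1 / (i + 1)\<close> is fixed by the choice of \<open>i\<close>, and only then does \<open>h\<close> tend to 0\<close>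
    have "(\<lambda>i. 2 * B * (\<Lambda> * measure M (?SW i))) \<longlonglongrightarrow> 2 * B * (\<Lambda> * 0)"
      by (intro tendsto_mult tendsto_const completing_within_vanishes)
    then have "\<forall>\<^sub>F i in sequentially. 2 * B * (\<Lambda> * measure M (?SW i)) < \<epsilon>"
      using \<epsilon> by (intro order_tendstoD(2)[of _ "0::real"]) auto
    then obtain i where i: "2 * B * (\<Lambda> * measure M (?SW i)) < \<epsilon>"
      by (auto simp: eventually_sequentially)
    have limW: "((\<lambda>h. ?pW i h / h) \<longlongrightarrow> (\<Sum>n\<le>c + k. rate n * \<P>(\<omega> in M. \<omega> \<in> ?SW i \<and> number_in_system (Q \<omega>) t = n)))
        (at_right 0)" (is "(_ \<longlongrightarrow> ?w) _")
      by (intro next_arrival_rate[OF t completing_within_past]) (simp add: completing_within_def)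
    have "?w \<le> \<Lambda> * measure M (?SW i)"
      unfolding \<Lambda>_def sum_distrib_right
      by (intro sum_mono mult_left_mono finite_measure_mono) (auto intro: less_imp_le rate_pos)
    then have w: "B * 0 + L * 0 + 2 * B * ?w < \<epsilon>"
      using i mult_left_mono[of ?w "\<Lambda> * measure M (?SW i)" "2 * B"] B0 by linarith
    have "((\<lambda>h. B * (?p2 h / h) + L * ?pA h + 2 * B * (?pW i h / h)) \<longlongrightarrow> B * 0 + L * 0 + 2 * B * ?w) (at_right 0)"
      by (intro tendsto_add tendsto_mult tendsto_const lim2 limA limW)
    from order_tendstoD(2)[OF this w]
    have ev: "\<forall>\<^sub>F h in at_right 0. B * (?p2 h / h) + L * ?pA h + 2 * B * (?pW i h / h) < \<epsilon>" .
    have evi: "\<forall>\<^sub>F h in at_right 0. 0 < h \<and> h < 1 / real (Suc i)"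
      by (rule eventually_at_right_less_real) simp
    show "\<forall>\<^sub>F h in at_right 0. dist ((?D h - ?G h) / h) 0 < \<epsilon>"
      using ev evi
    proof eventually_elim
      case (elim h)
      have "\<bar>?D h - ?G h\<bar> / h \<le> (B * ?p2 h + L * h * ?pA h + 2 * B * ?pW i h) / h"
        using elim(2) by (intro divide_right_mono bound) auto
      also have "\<dots> = B * (?p2 h / h) + L * ?pA h + 2 * B * (?pW i h / h)"
        using elim(2) by (simp add: add_divide_distrib)
      finally show ?case using elim by (simp add: abs_divide)
    qed
  qed
  have "((\<lambda>h. (?D h - ?G h) / h + ?G h / h) \<longlongrightarrow> 0 + rate m * (\<integral>\<omega>. Y \<omega> \<partial>M)) (at_right 0)"
    by (intro tendsto_add DG next_arrival_rate_integral[OF t Y Yb supp])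
  then show ?thesis by (simp add: add_divide_distrib[symmetric])
qed

end

section \<open>The compensator of an arrival\<close>

lemma right_derivative_integral:
  fixes \<phi> :: "real \<Rightarrow> real"
  assumes int: "\<And>a b. \<phi> integrable_on {a..b}" and rc: "(\<phi> \<longlongrightarrow> \<phi> t) (at_right t)"
    and t: "a \<le> t"
  shows "((\<lambda>h. (integral {a..t + h} \<phi> - integral {a..t} \<phi>) / h) \<longlongrightarrow> \<phi> t) (at_right 0)"
proof -
  have aw: "at t within {t..t + 1} = at_right t" by (rule at_within_Icc_at_right) simp
  have "((\<lambda>u. integral {t..u} \<phi>) has_vector_derivative \<phi> t) (at t within ({t..t + 1} - {}))"
    by (rule integral_has_vector_derivative_continuous_at)
       (use int rc aw in \<open>auto simp: continuous_within\<close>)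
  then have "((\<lambda>u. integral {t..u} \<phi>) has_field_derivative \<phi> t) (at t within {t..t + 1})"
    by (simp add: has_real_derivative_iff_has_vector_derivative)
  then have "((\<lambda>u. (integral {t..u} \<phi> - integral {t..t} \<phi>) / (u - t)) \<longlongrightarrow> \<phi> t) (at_right t)"
    by (simp add: has_field_derivative_iff aw)
  then have "((\<lambda>h. integral {t..h + t} \<phi> / h) \<longlongrightarrow> \<phi> t) (at_right 0)"
    by (subst (asm) filterlim_at_right_to_0) simp
  moreover have "\<forall>\<^sub>F h in at_right 0. integral {t..h + t} \<phi> / h = (integral {a..t + h} \<phi> - integral {a..t} \<phi>) / h"
  proof (rule eventually_at_right_less[THEN eventually_mono])
    fix h :: real assume "0 < h"
    then show "integral {t..h + t} \<phi> / h = (integral {a..t + h} \<phi> - integral {a..t} \<phi>) / h"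
      using Henstock_Kurzweil_Integration.integral_combine[of a t "t + h" \<phi>] t int by (simp add: add.commute)
  qed
  ultimately show ?thesis by (rule Lim_transform_eventually)
qed

context Mn_Gn_1_queue begin

text \<open>
Both sides are continuous in \<open>T\<close>, vanish at \<open>T = 0\<close>, and have the same right derivative by
\<open>arrival_functional_derivative\<close>.  The left side is continuous because the arrival epoch has no atom.
\<close>

lemma arrival_compensator:
  assumes X [measurable]: "X \<in> borel_measurable M" and Xb: "\<And>\<omega>. \<omega> \<in> space M \<Longrightarrow> \<bar>X \<omega>\<bar> \<le> B"
    and X0: "\<And>\<omega>. \<omega> \<in> space M \<Longrightarrow> X \<omega> \<noteq> 0 \<Longrightarrow> initial_number (Q \<omega>) = c"
    and Y: "\<And>t. 0 \<le> t \<Longrightarrow> Y t \<in> borel_measurable (past M Q t)"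
    and Yb: "\<And>t \<omega>. \<omega> \<in> space M \<Longrightarrow> \<bar>Y t \<omega>\<bar> \<le> B"
    and supp: "\<And>t \<omega>. \<omega> \<in> space M \<Longrightarrow> Y t \<omega> \<noteq> 0 \<Longrightarrow> awaiting c k (Q \<omega>) t \<and> number_in_system (Q \<omega>) t = m"
    and freeze: "\<And>t \<omega>. \<omega> \<in> space M \<Longrightarrow> awaiting c k (Q \<omega>) t \<Longrightarrow>
      (\<And>j. j < c + k \<Longrightarrow> t < service_end (Q \<omega>) j \<Longrightarrow> arrival_epoch (Q \<omega>) k < service_end (Q \<omega>) j) \<Longrightarrow>
      \<bar>X \<omega> - Y t \<omega>\<bar> \<le> L * (arrival_epoch (Q \<omega>) k - t)"
    and L: "0 \<le> L"
    and rc: "\<And>t \<omega>. \<omega> \<in> space M \<Longrightarrow> ((\<lambda>s. Y s \<omega>) \<longlongrightarrow> Y t \<omega>) (at_right t)"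
    and T: "0 \<le> T"
  shows "(\<integral>\<omega>. (if arrival_epoch (Q \<omega>) k \<le> T then X \<omega> else 0) \<partial>M) =
    rate m * (\<integral>\<omega>. (LINT s:{0..T}|lborel. Y s \<omega>) \<partial>M)"
    and "(\<lambda>(t, \<omega>). Y t \<omega>) \<in> borel_measurable (borel \<Otimes>\<^sub>M M)"
proof -
  have B0: "0 \<le> B" using not_empty Xb abs_ge_zero order_trans by (metis ex_in_conv)
  have YM [measurable]: "Y t \<in> borel_measurable M" for t
  proof (cases "0 \<le> t")
    case True
    then show ?thesis by (rule measurable_from_subalg[OF subalgebra_past Y])
  next
    case False
    then have "Y t \<in> borel_measurable M \<longleftrightarrow> (\<lambda>\<omega>. 0::real) \<in> borel_measurable M"
      using supp by (intro measurable_cong) (auto simp: awaiting_def)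
    then show ?thesis by simp
  qed
  show joint [measurable]: "(\<lambda>(t, \<omega>). Y t \<omega>) \<in> borel_measurable (borel \<Otimes>\<^sub>M M)"
    by (rule borel_measurable_right_continuous) (auto intro: rc)
  define \<phi> where "\<phi> = (\<lambda>t. \<integral>\<omega>. Y t \<omega> \<partial>M)"
  have \<phi>m [measurable]: "\<phi> \<in> borel_measurable borel"
    unfolding \<phi>_def by (rule borel_measurable_lebesgue_integral) (use joint in simp)
  have \<phi>b: "\<bar>\<phi> t\<bar> \<le> B" for t
  proof -
    have "\<bar>\<phi> t\<bar> \<le> (\<integral>\<omega>. \<bar>Y t \<omega>\<bar> \<partial>M)" unfolding \<phi>_def by (rule integral_abs_bound)
    also have "\<dots> \<le> (\<integral>\<omega>. B \<partial>M)"
      by (intro integral_mono integrable_abs integrable_const_bound[where B = B]) (auto intro!: AE_I2 Yb simp: B0)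
    finally show ?thesis by (simp add: prob_space)
  qed
  have \<phi>set: "set_integrable lborel {a..b} \<phi>" for a b
    unfolding set_integrable_def
    by (rule integrableI_bounded_set[where A = "{a..b}" and B = B])
       (auto intro!: AE_I2 \<phi>b simp: indicator_def emeasure_lborel_Icc_eq)
  then have \<phi>int: "\<phi> integrable_on {a..b}" for a b
    by (rule set_borel_integral_eq_integral(1))
  have \<phi>rc: "(\<phi> \<longlongrightarrow> \<phi> t) (at_right t)" for t
    unfolding \<phi>_def by (rule tendsto_expectation_at_right[where B = B]) (auto intro: rc Yb)
  interpret P: pair_sigma_finite lborel M ..
  have "integrable (lborel \<Otimes>\<^sub>M M) (\<lambda>(s, \<omega>). indicator {0..T} s * Y s \<omega>)"
  proof (rule integrableI_bounded_set[where A = "{0..T} \<times> space M" and B = B])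
    show "emeasure (lborel \<Otimes>\<^sub>M M) ({0..T} \<times> space M) < \<infinity>"
      by (subst emeasure_pair_measure_Times) (auto simp: emeasure_space_1 ennreal_mult_less_top emeasure_lborel_Icc_eq)
  qed (use B0 in \<open>auto intro!: AE_I2 Yb simp: indicator_def space_pair_measure\<close>)
  then have "(\<integral>\<omega>. (\<integral>s. indicator {0..T} s * Y s \<omega> \<partial>lborel) \<partial>M) = (\<integral>s. (\<integral>\<omega>. indicator {0..T} s * Y s \<omega> \<partial>M) \<partial>lborel)"
    by (rule P.Fubini_integral)
  also have "\<dots> = (LINT s:{0..T}|lborel. \<phi> s)" by (simp add: \<phi>_def set_lebesgue_integral_def)
  also have "\<dots> = integral {0..T} \<phi>" by (rule set_borel_integral_eq_integral(2)[OF \<phi>set])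
  finally have Fub: "(\<integral>\<omega>. (LINT s:{0..T}|lborel. Y s \<omega>) \<partial>M) = integral {0..T} \<phi>"
    by (simp add: set_lebesgue_integral_def)
  define f where "f = (\<lambda>t. \<integral>\<omega>. (if arrival_epoch (Q \<omega>) k \<le> t then X \<omega> else 0) \<partial>M)"
  have fcont: "continuous_on {0..T} f"
    unfolding continuous_on_sequentially
  proof (intro allI ballI impI, elim conjE)
    fix x a assume x: "\<forall>n. x n \<in> {0..T}" and a: "a \<in> {0..T}" and lim: "x \<longlonglongrightarrow> a"
    show "(f \<circ> x) \<longlonglongrightarrow> f a"
      unfolding f_def comp_def
    proof (rule integral_dominated_convergence[where w = "\<lambda>_. B"])
      have "AE \<omega> in M. arrival_epoch (Q \<omega>) k \<noteq> a" using a by (intro arrival_epoch_no_atom) auto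
      then show "AE \<omega> in M. (\<lambda>n. if arrival_epoch (Q \<omega>) k \<le> x n then X \<omega> else 0)
          \<longlonglongrightarrow> (if arrival_epoch (Q \<omega>) k \<le> a then X \<omega> else 0)"
      proof eventually_elim
        case (elim \<omega>)
        have "\<forall>\<^sub>F n in sequentially. (arrival_epoch (Q \<omega>) k \<le> x n) = (arrival_epoch (Q \<omega>) k \<le> a)"
        proof (cases "arrival_epoch (Q \<omega>) k < a")
          case True
          from order_tendstoD(1)[OF lim True] show ?thesis by eventually_elim (use True in auto)
        next
          case False
          then have less: "a < arrival_epoch (Q \<omega>) k" using elim by auto
          from order_tendstoD(2)[OF lim less] show ?thesis by eventually_elim (use less in auto)
        qed
        then show ?case by (rule tendsto_eventually[OF eventually_mono]) simp
      qed
    qed (auto intro!: AE_I2 Xb simp: B0)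
  qed
  define g where "g = (\<lambda>t. f t - rate m * integral {0..t} \<phi>)"
  have "g T = g 0"
  proof (rule constant_of_zero_right_derivative[OF _ _ T])
    show "continuous_on {0..T} g"
      unfolding g_def by (intro continuous_intros fcont indefinite_integral_continuous_1 \<phi>int)
    fix t assume t: "0 \<le> t" "t < T"
    have "((\<lambda>h. (f (t + h) - f t) / h - rate m * ((integral {0..t + h} \<phi> - integral {0..t} \<phi>) / h))
       \<longlongrightarrow> rate m * (\<integral>\<omega>. Y t \<omega> \<partial>M) - rate m * \<phi> t) (at_right 0)"
      unfolding f_def
      by (intro tendsto_diff tendsto_mult tendsto_const right_derivative_integral \<phi>int \<phi>rc t(1)
        arrival_functional_derivative[OF t(1) X Xb X0 Y[OF t(1)] Yb supp freeze L])
    then show "((\<lambda>h. (g (t + h) - g t) / h) \<longlongrightarrow> 0) (at_right 0)"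
      by (simp add: g_def \<phi>_def algebra_simps diff_divide_distrib add_divide_distrib)
  qed
  moreover have "f 0 = 0"
  proof -
    have "f 0 = (\<integral>\<omega>. 0 \<partial>M)"
      unfolding f_def
    proof (rule Bochner_Integration.integral_cong[OF refl])
      fix \<omega> assume "\<omega> \<in> space M"
      then have "\<not> arrival_epoch (Q \<omega>) k \<le> 0" using arrival_epoch_pos[OF valid, of \<omega> k] by simp
      then show "(if arrival_epoch (Q \<omega>) k \<le> 0 then X \<omega> else 0) = 0" by simp
    qed
    then show ?thesis by simp
  qed
  ultimately show "(\<integral>\<omega>. (if arrival_epoch (Q \<omega>) k \<le> T then X \<omega> else 0) \<partial>M) =
    rate m * (\<integral>\<omega>. (LINT s:{0..T}|lborel. Y s \<omega>) \<partial>M)"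
    unfolding Fub by (simp add: g_def f_def)
qed

end

section \<open>Marked arrivals\<close>

lemma eventually_le_at_right: "\<forall>\<^sub>F s in at_right t. (a \<le> s) = (a \<le> t)" for a t :: real
proof (cases "a \<le> t")
  case True
  then show ?thesis by (intro eventually_at_right_less[THEN eventually_mono]) auto
next
  case False
  then show ?thesis
    by (intro eventually_at_right_less_real[of t a, THEN eventually_mono]) auto
qed

lemma eventually_awaiting_at_right: "\<forall>\<^sub>F s in at_right t. awaiting c k q s = awaiting c k q t"
  using eventually_le_at_right[of 0 t] eventually_le_at_right[of "arrival_epoch q (k - 1)" t]
    eventually_le_at_right[of "arrival_epoch q k" t]
  by eventually_elim (simp only: awaiting_def not_le[symmetric])

lemma eventually_busy_at_right: "\<forall>\<^sub>F s in at_right t. busy q i s = busy q i t"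
proof -
  have "\<forall>\<^sub>F s in at_right t. \<forall>j\<in>{..<i}. (service_end q j \<le> s) = (service_end q j \<le> t)"
    by (intro eventually_ball_finite) (auto intro: eventually_le_at_right)
  then show ?thesis
  proof eventually_elim
    case (elim s)
    then have "{j. j < i \<and> s < service_end q j} = {j. j < i \<and> t < service_end q j}"
      by (auto simp: not_le[symmetric])
    then show ?case by (simp add: busy_def)
  qed
qed

lemma abs_exp_minus_diff_le:
  fixes x y :: real assumes "0 \<le> x" "0 \<le> y"
  shows "\<bar>exp (- x) - exp (- y)\<bar> \<le> \<bar>x - y\<bar>"
proof -
  have *: "\<bar>exp (- x) - exp (- y)\<bar> \<le> y - x" if "0 \<le> x" "x \<le> y" for x y :: real
  proof -
    have le: "1 - exp (- (y - x)) \<le> y - x" using exp_ge_add_one_self[of "- (y - x)"] by linarith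
    have "exp (- x) - exp (- y) = exp (- x) * (1 - exp (- (y - x)))"
      by (simp add: algebra_simps exp_add[symmetric])
    also have "\<dots> \<le> 1 * (y - x)"
      using that by (intro mult_mono le) auto
    finally show ?thesis using that by simp
  qed
  show ?thesis using *[of x y] *[of y x] assms by (cases "x \<le> y") (auto simp: abs_minus_commute)
qed

context Mn_Gn_1_queue begin

text \<open>
The weight of an instant \<open>t\<close> at which the last \<open>m\<close> of the first \<open>i\<close> customers are present, so that service \<open>i - m\<close>
is in progress.  For \<open>m = 0\<close> no service is, and the definition is used with \<open>\<theta> = 0\<close> only, when its value is 1.
\<close>

definition residual_discount :: "nat \<Rightarrow> nat \<Rightarrow> real \<Rightarrow> 'a \<Rightarrow> real \<Rightarrow> real" where
  "residual_discount i m \<theta> \<omega> t = exp (- \<theta> * (service_end (Q \<omega>) (i - m) - t))"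

text \<open>
The mark is a factor \<open>V\<close>, known while arrival \<open>k\<close> is awaited, times the discounted residual service time.  As
long as no service is completed, the number in system is the number that the arrival will find, and the
exponential is Lipschitz in the remaining time, so \<open>arrival_compensator\<close> applies.
\<close>

lemma expected_marked_arrival:
  assumes \<theta>: "0 \<le> \<theta>" and m\<theta>: "0 < m \<or> \<theta> = 0"
    and V [measurable]: "V \<in> borel_measurable M" and Vb: "\<And>\<omega>. \<omega> \<in> space M \<Longrightarrow> 0 \<le> V \<omega> \<and> V \<omega> \<le> B"
    and Vpast: "\<And>t. 0 \<le> t \<Longrightarrow> (\<lambda>\<omega>. if awaiting c k (Q \<omega>) t then V \<omega> else 0) \<in> borel_measurable (past M Q t)"
    and T: "0 \<le> T"
  shows "(\<integral>\<omega>. (if initial_number (Q \<omega>) = c \<and> arrival_epoch (Q \<omega>) k \<le> T \<and> number_found (Q \<omega>) k = m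
            then V \<omega> * residual_discount (c + k) m \<theta> \<omega> (arrival_epoch (Q \<omega>) k) else 0) \<partial>M) =
    rate m * (\<integral>\<omega>. (LINT s:{0..T}|lborel. (if awaiting c k (Q \<omega>) s \<and> number_in_system (Q \<omega>) s = m
            then V \<omega> * residual_discount (c + k) m \<theta> \<omega> s else 0)) \<partial>M)"
    and "(\<lambda>(s, \<omega>). if awaiting c k (Q \<omega>) s \<and> number_in_system (Q \<omega>) s = m
            then V \<omega> * residual_discount (c + k) m \<theta> \<omega> s else 0) \<in> borel_measurable (borel \<Otimes>\<^sub>M M)"
proof -
  define X where "X = (\<lambda>\<omega>. if initial_number (Q \<omega>) = c \<and> number_found (Q \<omega>) k = m
            then V \<omega> * residual_discount (c + k) m \<theta> \<omega> (arrival_epoch (Q \<omega>) k) else 0)"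
  define Y where "Y = (\<lambda>s \<omega>. if awaiting c k (Q \<omega>) s \<and> number_in_system (Q \<omega>) s = m
            then V \<omega> * residual_discount (c + k) m \<theta> \<omega> s else 0)"
  have B0: "0 \<le> B" using not_empty Vb order_trans by (metis ex_in_conv)
  have discount_bounds: "0 \<le> residual_discount (c + k) m \<theta> \<omega> t \<and> residual_discount (c + k) m \<theta> \<omega> t \<le> 1"
    if "0 < m \<Longrightarrow> t \<le> service_end (Q \<omega>) (c + k - m)" for t \<omega>
    using m\<theta> \<theta> that by (auto simp: residual_discount_def)
  have prod: "\<bar>V \<omega> * x\<bar> \<le> B" if "\<omega> \<in> space M" "0 \<le> x \<and> x \<le> 1" for \<omega> x
    using mult_mono[of "V \<omega>" B x 1] Vb[OF that(1)] that(2) B0 by (simp add: abs_mult)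
  have Xm: "X \<in> borel_measurable M"
    unfolding X_def residual_discount_def by measurable
  have Xb: "\<bar>X \<omega>\<bar> \<le> B" if \<omega>: "\<omega> \<in> space M" for \<omega>
  proof (cases "initial_number (Q \<omega>) = c \<and> number_found (Q \<omega>) k = m")
    case True
    have e: "customer_epoch (Q \<omega>) (c + k) = arrival_epoch (Q \<omega>) k" using True customer_epoch_arrival[of "Q \<omega>" k] by simp
    have "arrival_epoch (Q \<omega>) k \<le> service_end (Q \<omega>) (c + k - m)" if "0 < m"
      using number_found_eq_iff[OF valid[OF \<omega>] that, of c k] True e by simp
    from prod[OF \<omega> discount_bounds[OF this]] True show ?thesis by (simp add: X_def)
  qed (auto simp: X_def B0)
  have Yend: "t \<le> service_end (Q \<omega>) (c + k - m)" "service_start (Q \<omega>) (c + k - m) \<le> t"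
    if "\<omega> \<in> space M" "awaiting c k (Q \<omega>) t" "number_in_system (Q \<omega>) t = m" "0 < m" for \<omega> t
    using number_in_system_eq_iff[OF valid[OF that(1)] that(4,2)] that(3) by simp_all
  have Yb: "\<bar>Y t \<omega>\<bar> \<le> B" if \<omega>: "\<omega> \<in> space M" for \<omega> t
    using prod[OF \<omega> discount_bounds[of t \<omega>]] Yend(1)[OF \<omega>, of t] B0 by (simp add: Y_def)
  have Ypast: "Y t \<in> borel_measurable (past M Q t)" if t: "0 \<le> t" for t
  proof -
    note Vpast[OF t, measurable]
    have "(\<lambda>\<omega>. (if awaiting c k (Q \<omega>) t then V \<omega> else 0) * (if number_in_system (Q \<omega>) t = m
       then exp (- \<theta> * ((if service_start (Q \<omega>) (c + k - m) \<le> t then service_end (Q \<omega>) (c + k - m) else 0) - t)) else 0))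
       \<in> borel_measurable (past M Q t)"
      by (intro borel_measurable_times Vpast t measurable_If borel_measurable_exp[THEN measurable_compose[rotated]]
          borel_measurable_times borel_measurable_diff borel_measurable_const past_service_end_started) measurable
    also have "?this \<longleftrightarrow> ?thesis"
    proof (rule measurable_cong)
      fix \<omega> assume "\<omega> \<in> space (past M Q t)"
      then show "(if awaiting c k (Q \<omega>) t then V \<omega> else 0) * (if number_in_system (Q \<omega>) t = m
       then exp (- \<theta> * ((if service_start (Q \<omega>) (c + k - m) \<le> t then service_end (Q \<omega>) (c + k - m) else 0) - t)) else 0)
       = Y t \<omega>"
        using m\<theta> Yend(2)[of \<omega> t] by (auto simp: Y_def residual_discount_def)
    qed
    finally show ?thesis .
  qed
  have freeze: "\<bar>X \<omega> - Y t \<omega>\<bar> \<le> B * \<theta> * (arrival_epoch (Q \<omega>) k - t)"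
    if \<omega>: "\<omega> \<in> space M" and aw: "awaiting c k (Q \<omega>) t"
      and nc: "\<And>j. j < c + k \<Longrightarrow> t < service_end (Q \<omega>) j \<Longrightarrow> arrival_epoch (Q \<omega>) k < service_end (Q \<omega>) j"
    for t \<omega>
  proof -
    note v = valid[OF \<omega>]
    let ?a = "arrival_epoch (Q \<omega>) k" and ?e = "service_end (Q \<omega>) (c + k - m)"
    have ta: "t < ?a" and c: "initial_number (Q \<omega>) = c" using aw by (auto simp: awaiting_def)
    have "{j. j < c + k \<and> ?a < service_end (Q \<omega>) j} = {j. j < c + k \<and> t < service_end (Q \<omega>) j}"
      using nc ta by (auto intro: less_trans)
    then have same: "number_found (Q \<omega>) k = number_in_system (Q \<omega>) t"
      using c by (simp add: number_found_busy number_in_system_awaiting[OF v aw] busy_def)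
    show ?thesis
    proof (cases "number_in_system (Q \<omega>) t = m \<and> 0 < m")
      case True
      then have "m \<le> c + k" "t < ?e" using number_in_system_eq_iff[OF v _ aw, of m] by auto
      have "c + k - m < c + k" using True \<open>m \<le> c + k\<close> by linarith
      from nc[OF this \<open>t < ?e\<close>] have ea: "?a < ?e" .
      have "\<bar>exp (- (\<theta> * (?e - ?a))) - exp (- (\<theta> * (?e - t)))\<bar> \<le> \<bar>\<theta> * (?e - ?a) - \<theta> * (?e - t)\<bar>"
        using ea \<open>t < ?e\<close> \<theta> by (intro abs_exp_minus_diff_le) auto
      also have "\<dots> = \<theta> * (?a - t)" using ta \<theta> by (simp add: right_diff_distrib[symmetric] abs_mult)
      finally have le: "\<bar>exp (- (\<theta> * (?e - ?a))) - exp (- (\<theta> * (?e - t)))\<bar> \<le> \<theta> * (?a - t)" .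
      have "\<bar>X \<omega> - Y t \<omega>\<bar> = V \<omega> * \<bar>exp (- (\<theta> * (?e - ?a))) - exp (- (\<theta> * (?e - t)))\<bar>"
        using True same c aw Vb[OF \<omega>]
        by (simp add: X_def Y_def residual_discount_def right_diff_distrib[symmetric] abs_mult)
      also have "\<dots> \<le> B * (\<theta> * (?a - t))" using le Vb[OF \<omega>] B0 by (intro mult_mono) auto
      finally show ?thesis by (simp add: mult.assoc)
    next
      case False
      then have "X \<omega> = Y t \<omega>" using same c aw m\<theta> by (auto simp: X_def Y_def residual_discount_def)
      then show ?thesis using B0 \<theta> ta by simp
    qed
  qed
  have rc: "((\<lambda>s. Y s \<omega>) \<longlongrightarrow> Y t \<omega>) (at_right t)" if \<omega>: "\<omega> \<in> space M" for t \<omega>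
  proof -
    let ?f = "\<lambda>s. if awaiting c k (Q \<omega>) t \<and> number_in_system (Q \<omega>) t = m then V \<omega> * residual_discount (c + k) m \<theta> \<omega> s else 0"
    have "isCont (\<lambda>s. V \<omega> * residual_discount (c + k) m \<theta> \<omega> s) t" unfolding residual_discount_def by (intro continuous_intros)
    then have "((\<lambda>s. V \<omega> * residual_discount (c + k) m \<theta> \<omega> s) \<longlongrightarrow> V \<omega> * residual_discount (c + k) m \<theta> \<omega> t) (at_right t)"
      unfolding isCont_def by (rule tendsto_within_subset) simp
    then have "(?f \<longlongrightarrow> ?f t) (at_right t)"
      by (cases "awaiting c k (Q \<omega>) t \<and> number_in_system (Q \<omega>) t = m") auto
    moreover have "\<forall>\<^sub>F s in at_right t. ?f s = Y s \<omega>"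
      using eventually_awaiting_at_right[of c k "Q \<omega>" t] eventually_busy_at_right[of "Q \<omega>" "c + k" t]
    proof eventually_elim
      case (elim s)
      then show ?case using number_in_system_awaiting[OF valid[OF \<omega>]] by (auto simp: Y_def)
    qed
    ultimately have "((\<lambda>s. Y s \<omega>) \<longlongrightarrow> ?f t) (at_right t)" by (rule Lim_transform_eventually)
    then show ?thesis by (simp add: Y_def)
  qed
  have supp: "awaiting c k (Q \<omega>) t \<and> number_in_system (Q \<omega>) t = m" if "Y t \<omega> \<noteq> 0" for t \<omega>
    using that by (auto simp: Y_def split: if_splits)
  have X0: "initial_number (Q \<omega>) = c" if "X \<omega> \<noteq> 0" for \<omega>
    using that by (auto simp: X_def split: if_splits)
  have L: "0 \<le> B * \<theta>" using B0 \<theta> by simp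
  note comp = arrival_compensator[OF Xm Xb X0 Ypast Yb supp freeze L rc T]
  have "(\<integral>\<omega>. (if initial_number (Q \<omega>) = c \<and> arrival_epoch (Q \<omega>) k \<le> T \<and> number_found (Q \<omega>) k = m
            then V \<omega> * residual_discount (c + k) m \<theta> \<omega> (arrival_epoch (Q \<omega>) k) else 0) \<partial>M) =
    (\<integral>\<omega>. (if arrival_epoch (Q \<omega>) k \<le> T then X \<omega> else 0) \<partial>M)"
    by (intro Bochner_Integration.integral_cong refl) (auto simp: X_def)
  also have "\<dots> = rate m * (\<integral>\<omega>. (LINT s:{0..T}|lborel. Y s \<omega>) \<partial>M)" by (rule comp(1))
  finally show "(\<integral>\<omega>. (if initial_number (Q \<omega>) = c \<and> arrival_epoch (Q \<omega>) k \<le> T \<and> number_found (Q \<omega>) k = m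
            then V \<omega> * residual_discount (c + k) m \<theta> \<omega> (arrival_epoch (Q \<omega>) k) else 0) \<partial>M) =
    rate m * (\<integral>\<omega>. (LINT s:{0..T}|lborel. (if awaiting c k (Q \<omega>) s \<and> number_in_system (Q \<omega>) s = m
            then V \<omega> * residual_discount (c + k) m \<theta> \<omega> s else 0)) \<partial>M)"
    unfolding Y_def .
  show "(\<lambda>(s, \<omega>). if awaiting c k (Q \<omega>) s \<and> number_in_system (Q \<omega>) s = m
            then V \<omega> * residual_discount (c + k) m \<theta> \<omega> s else 0) \<in> borel_measurable (borel \<Otimes>\<^sub>M M)"
    using comp(2) unfolding Y_def .
qed

text \<open>
A coincidence of an arrival with a completion is a mark that is predicted to be 0 at all earlier times, so its
compensator vanishes.
\<close>

lemma completion_arrival_ties_null: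
  "AE \<omega> in M. \<forall>k. \<forall>j<initial_number (Q \<omega>) + k. service_end (Q \<omega>) j \<noteq> arrival_epoch (Q \<omega>) k"
proof -
  have "AE \<omega> in M. initial_number (Q \<omega>) = c \<longrightarrow> arrival_epoch (Q \<omega>) k \<le> real N \<longrightarrow>
      (\<forall>j<c + k. service_end (Q \<omega>) j \<noteq> arrival_epoch (Q \<omega>) k)" for c k N
  proof -
    define X :: "'a \<Rightarrow> real" where "X = (\<lambda>\<omega>. if initial_number (Q \<omega>) = c \<and>
      (\<exists>j<c + k. service_end (Q \<omega>) j = arrival_epoch (Q \<omega>) k) then 1 else 0)"
    have Xm [measurable]: "X \<in> borel_measurable M" unfolding X_def by measurable
    have freeze: "\<bar>X \<omega> - 0\<bar> \<le> 0 * (arrival_epoch (Q \<omega>) k - t)"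
      if "\<omega> \<in> space M" and aw: "awaiting c k (Q \<omega>) t"
        and nc: "\<And>j. j < c + k \<Longrightarrow> t < service_end (Q \<omega>) j \<Longrightarrow> arrival_epoch (Q \<omega>) k < service_end (Q \<omega>) j"
      for t \<omega>
    proof -
      have "t < arrival_epoch (Q \<omega>) k" using aw by (simp add: awaiting_def)
      then have "service_end (Q \<omega>) j \<noteq> arrival_epoch (Q \<omega>) k" if "j < c + k" for j
        using nc[OF that] by auto
      then show ?thesis by (auto simp: X_def)
    qed
    have "(\<integral>\<omega>. (if arrival_epoch (Q \<omega>) k \<le> real N then X \<omega> else 0) \<partial>M) =
      rate 0 * (\<integral>\<omega>. (LINT s:{0..real N}|lborel. 0) \<partial>M)"
      by (rule arrival_compensator(1)[of X 1 c "\<lambda>_ _. 0" k 0 0 "real N", OF Xm _ _ _ _ _ freeze])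
         (auto simp: X_def split: if_splits)
    then have "(\<integral>\<omega>. (if arrival_epoch (Q \<omega>) k \<le> real N then X \<omega> else 0) \<partial>M) = 0"
      by (simp add: set_lebesgue_integral_def)
    moreover have "integrable M (\<lambda>\<omega>. if arrival_epoch (Q \<omega>) k \<le> real N then X \<omega> else 0)"
      by (rule integrable_const_bound[where B = 1]) (auto simp: X_def)
    ultimately have "AE \<omega> in M. (if arrival_epoch (Q \<omega>) k \<le> real N then X \<omega> else 0) = 0"
      by (subst (asm) integral_nonneg_eq_0_iff_AE) (auto simp: X_def)
    then show ?thesis by eventually_elim (auto simp: X_def split: if_splits)
  qed
  then have "AE \<omega> in M. \<forall>c k N. initial_number (Q \<omega>) = c \<longrightarrow> arrival_epoch (Q \<omega>) k \<le> real N \<longrightarrow>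
      (\<forall>j<c + k. service_end (Q \<omega>) j \<noteq> arrival_epoch (Q \<omega>) k)"
    unfolding AE_all_countable by blast
  then show ?thesis
  proof eventually_elim
    case (elim \<omega>)
    show ?case
    proof
      fix k
      obtain N where "arrival_epoch (Q \<omega>) k \<le> real N" using real_arch_simple by blast
      then show "\<forall>j<initial_number (Q \<omega>) + k. service_end (Q \<omega>) j \<noteq> arrival_epoch (Q \<omega>) k"
        using elim by blast
    qed
  qed
qed

end

section \<open>Counting arrivals by the number found\<close>

lemma set_integrable_Icc_bounded:
  fixes f :: "real \<Rightarrow> real"
  assumes [measurable]: "f \<in> borel_measurable borel" and "\<And>x. \<bar>f x\<bar> \<le> B"
  shows "set_integrable lborel {a..b} f"
  unfolding set_integrable_def
  by (rule integrableI_bounded_set[where A = "{a..b}" and B = B])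
     (use assms(2) in \<open>auto intro!: AE_I2 simp: indicator_def emeasure_lborel_Icc_eq\<close>)

lemma set_integral_Icc_const: "a \<le> b \<Longrightarrow> (LINT s:{a..b}|lborel. (c::real)) = c * (b - a)"
  by (simp add: set_lebesgue_integral_def)

lemma borel_measurable_section:
  fixes f :: "real \<Rightarrow> 'a \<Rightarrow> real"
  assumes "(\<lambda>(s, \<omega>). f s \<omega>) \<in> borel_measurable (borel \<Otimes>\<^sub>M M)" "\<omega> \<in> space M"
  shows "(\<lambda>s. f s \<omega>) \<in> borel_measurable borel"
  using measurable_compose[OF measurable_Pair2'[OF assms(2)] assms(1)] by simp

lemma borel_measurable_set_integral_Icc:
  fixes f :: "real \<Rightarrow> 'a \<Rightarrow> real"
  assumes "(\<lambda>(s, \<omega>). f s \<omega>) \<in> borel_measurable (borel \<Otimes>\<^sub>M M)"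
  shows "(\<lambda>\<omega>. LINT s:{a..b}|lborel. f s \<omega>) \<in> borel_measurable M"
proof -
  have [measurable]: "(\<lambda>(\<omega>, s). f s \<omega>) \<in> borel_measurable (M \<Otimes>\<^sub>M borel)"
    using measurable_pair_swap[OF assms] by (simp add: case_prod_beta)
  have [measurable]: "(\<lambda>x. f (snd x) (fst x)) \<in> borel_measurable (M \<Otimes>\<^sub>M borel)"
    using \<open>(\<lambda>(\<omega>, s). f s \<omega>) \<in> _\<close> by (simp add: case_prod_beta)
  have "case_prod (\<lambda>\<omega> s. indicator {a..b} s *\<^sub>R f s \<omega>) \<in> borel_measurable (M \<Otimes>\<^sub>M lborel)"
    unfolding case_prod_beta by measurable
  then show ?thesis
    unfolding set_lebesgue_integral_def by (rule lborel.borel_measurable_lebesgue_integral)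
qed

context Mn_Gn_1_queue begin

definition occupation :: "nat \<Rightarrow> real \<Rightarrow> 'a \<Rightarrow> real" where
  "occupation m T \<omega> = (LINT s:{0..T}|lborel. (if number_in_system (Q \<omega>) s = m then 1 else 0))"

definition interarrival_occupation :: "nat \<Rightarrow> nat \<Rightarrow> nat \<Rightarrow> real \<Rightarrow> 'a \<Rightarrow> real" where
  "interarrival_occupation c m k T \<omega> =
     (LINT s:{0..T}|lborel. (if awaiting c k (Q \<omega>) s \<and> number_in_system (Q \<omega>) s = m then 1 else 0))"

definition arrival_ind :: "nat \<Rightarrow> nat \<Rightarrow> nat \<Rightarrow> real \<Rightarrow> 'a \<Rightarrow> real" where
  "arrival_ind c m k T \<omega> =
     (if initial_number (Q \<omega>) = c \<and> arrival_epoch (Q \<omega>) k \<le> T \<and> number_found (Q \<omega>) k = m then 1 else 0)"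

lemma arrival_ind_measurable [measurable]: "arrival_ind c m k T \<in> borel_measurable M"
  unfolding arrival_ind_def[abs_def] by measurable

lemma arrival_ind_bounds: "0 \<le> arrival_ind c m k T \<omega>" "arrival_ind c m k T \<omega> \<le> 1" "\<bar>arrival_ind c m k T \<omega>\<bar> \<le> 1"
  by (auto simp: arrival_ind_def)

lemma integrable_bounded:
  fixes f :: "'a \<Rightarrow> real"
  assumes "f \<in> borel_measurable M" "\<And>\<omega>. \<omega> \<in> space M \<Longrightarrow> \<bar>f \<omega>\<bar> \<le> B"
  shows "integrable M f"
  by (rule integrable_const_bound[where B = B]) (use assms in \<open>auto intro!: AE_I2\<close>)

lemma integrable_arrival_ind: "integrable M (arrival_ind c m k T)"
  by (rule integrable_bounded[where B = 1]) (auto simp: arrival_ind_bounds)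

lemma expected_arrival_ind:
  assumes "0 \<le> T"
  shows "(\<integral>\<omega>. arrival_ind c m k T \<omega> \<partial>M) = rate m * (\<integral>\<omega>. interarrival_occupation c m k T \<omega> \<partial>M)"
proof -
  have "(\<lambda>\<omega>. if awaiting c k (Q \<omega>) t then 1 else (0::real)) \<in> borel_measurable (past M Q t)" for t
    by measurable
  from expected_marked_arrival(1)[of 0 m "\<lambda>_. 1" 1 c k T, OF _ _ _ _ this assms] show ?thesis
    by (simp add: arrival_ind_def[abs_def] interarrival_occupation_def[abs_def] residual_discount_def cong: if_cong)
qed

lemma awaiting_level_measurable:
  "(\<lambda>(s, \<omega>). if awaiting c k (Q \<omega>) s \<and> number_in_system (Q \<omega>) s = m then 1 else (0::real))
     \<in> borel_measurable (borel \<Otimes>\<^sub>M M)"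
proof -
  have "(\<lambda>\<omega>. if awaiting c k (Q \<omega>) t then 1 else (0::real)) \<in> borel_measurable (past M Q t)" for t
    by measurable
  from expected_marked_arrival(2)[of 0 m "\<lambda>_. 1" 1 c k 0, OF _ _ _ _ this] show ?thesis
    by (simp add: residual_discount_def cong: if_cong)
qed

text \<open>
At each time exactly one arrival is the next one, so the indicator of a level is the sum of its parts between
successive arrivals.
\<close>

lemma level_measurable:
  "(\<lambda>(s, \<omega>). if 0 \<le> s \<and> number_in_system (Q \<omega>) s = m then 1 else (0::real))
     \<in> borel_measurable (borel \<Otimes>\<^sub>M M)"
proof -
  have eq: "(if 0 \<le> s \<and> number_in_system (Q \<omega>) s = m then 1 else (0::real)) =
      (\<Sum>k. if awaiting (initial_number (Q \<omega>)) k (Q \<omega>) s \<and> number_in_system (Q \<omega>) s = m then 1 else 0)"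
    if \<omega>: "\<omega> \<in> space M" for \<omega> s
  proof (cases "0 \<le> s")
    case True
    obtain k where k: "awaiting (initial_number (Q \<omega>)) k (Q \<omega>) s"
      using exists_awaiting[OF valid[OF \<omega>] True] by blast
    have "(\<Sum>l. if awaiting (initial_number (Q \<omega>)) l (Q \<omega>) s \<and> number_in_system (Q \<omega>) s = m then 1 else 0) =
      (\<Sum>l\<in>{k}. if awaiting (initial_number (Q \<omega>)) l (Q \<omega>) s \<and> number_in_system (Q \<omega>) s = m then 1 else (0::real))"
      using awaiting_unique[OF valid[OF \<omega>] _ k] by (intro suminf_finite) auto
    then show ?thesis using k True by simp
  qed (simp add: awaiting_def)
  define f :: "nat \<Rightarrow> nat \<Rightarrow> real \<times> 'a \<Rightarrow> real" where "f = (\<lambda>k c x. if awaiting c k (Q (snd x)) (fst x) \<and>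
    number_in_system (Q (snd x)) (fst x) = m then 1 else 0)"
  have "(\<lambda>x. f k (initial_number (Q (snd x))) x) \<in> borel_measurable (borel \<Otimes>\<^sub>M M)" for k
  proof (rule measurable_compose_countable[of "f k"])
    show "f k c \<in> borel_measurable (borel \<Otimes>\<^sub>M M)" for c
      using awaiting_level_measurable[of c k m] by (simp only: case_prod_beta' f_def)
    show "(\<lambda>x. initial_number (Q (snd x))) \<in> measurable (borel \<Otimes>\<^sub>M M) (count_space UNIV)"
      by (rule measurable_compose[OF measurable_snd initial_number_measurable])
  qed
  then have "(\<lambda>x. \<Sum>k. f k (initial_number (Q (snd x))) x) \<in> borel_measurable (borel \<Otimes>\<^sub>M M)"
    by (rule borel_measurable_suminf)
  also have "?this \<longleftrightarrow> ?thesis"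
  proof (rule measurable_cong)
    fix x :: "real \<times> 'a" assume "x \<in> space (borel \<Otimes>\<^sub>M M)"
    then have "snd x \<in> space M" by (auto simp: space_pair_measure)
    from eq[OF this, of "fst x"]
    show "(\<Sum>k. f k (initial_number (Q (snd x))) x) =
        (case x of (s, \<omega>) \<Rightarrow> if 0 \<le> s \<and> number_in_system (Q \<omega>) s = m then 1 else 0)"
      by (simp only: f_def case_prod_beta)
  qed
  finally show ?thesis .
qed

lemmas awaiting_level_section = borel_measurable_section[OF awaiting_level_measurable]
lemmas level_section = borel_measurable_section[OF level_measurable]

lemma occupation_eq:
  "occupation m T \<omega> = (LINT s:{0..T}|lborel. (if 0 \<le> s \<and> number_in_system (Q \<omega>) s = m then 1 else 0))"
  unfolding occupation_def set_lebesgue_integral_def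
  by (rule Bochner_Integration.integral_cong) (auto simp: indicator_def)

lemma occupation_measurable [measurable]: "occupation m T \<in> borel_measurable M"
  unfolding occupation_eq[abs_def] by (rule borel_measurable_set_integral_Icc[OF level_measurable])

lemma interarrival_occupation_measurable [measurable]: "interarrival_occupation c m k T \<in> borel_measurable M"
  unfolding interarrival_occupation_def[abs_def] by (rule borel_measurable_set_integral_Icc[OF awaiting_level_measurable])

lemma set_integrable_awaiting:
  "\<omega> \<in> space M \<Longrightarrow>
    set_integrable lborel {0..T} (\<lambda>s. if awaiting c k (Q \<omega>) s \<and> number_in_system (Q \<omega>) s = m then 1 else (0::real))"
  by (rule set_integrable_Icc_bounded[where B = 1, OF awaiting_level_section]) auto

lemma set_integrable_level:
  "\<omega> \<in> space M \<Longrightarrow>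
    set_integrable lborel {0..T} (\<lambda>s. if 0 \<le> s \<and> number_in_system (Q \<omega>) s = m then 1 else (0::real))"
  by (rule set_integrable_Icc_bounded[where B = 1, OF level_section]) auto

lemma set_integral_Icc_bounds:
  fixes f :: "real \<Rightarrow> real"
  assumes "set_integrable lborel {0..T} f" "\<And>s. 0 \<le> f s" "\<And>s. f s \<le> b" "0 \<le> T"
  shows "0 \<le> (LINT s:{0..T}|lborel. f s)" "(LINT s:{0..T}|lborel. f s) \<le> b * T"
proof -
  have c: "set_integrable lborel {0..T} (\<lambda>_. b::real)" for b
    by (rule set_integrable_Icc_bounded[where B = "\<bar>b\<bar>"]) auto
  have "(LINT s:{0..T}|lborel. 0) \<le> (LINT s:{0..T}|lborel. f s)"
    by (rule set_integral_mono[OF c assms(1)]) (use assms(2) in auto)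
  then show "0 \<le> (LINT s:{0..T}|lborel. f s)" by (simp add: set_lebesgue_integral_def)
  have "(LINT s:{0..T}|lborel. f s) \<le> (LINT s:{0..T}|lborel. b)"
    by (rule set_integral_mono[OF assms(1) c]) (use assms(3) in auto)
  then show "(LINT s:{0..T}|lborel. f s) \<le> b * T" using set_integral_Icc_const[OF assms(4), of b] by simp
qed

lemma occupation_bounds:
  assumes "\<omega> \<in> space M" "0 \<le> T"
  shows "0 \<le> occupation m T \<omega>" "occupation m T \<omega> \<le> T"
  using set_integral_Icc_bounds[OF set_integrable_level[OF assms(1)] _ _ assms(2), of m 1]
  by (auto simp: occupation_eq)

lemma interarrival_occupation_bounds:
  assumes "\<omega> \<in> space M" "0 \<le> T"
  shows "0 \<le> interarrival_occupation c m k T \<omega>" "interarrival_occupation c m k T \<omega> \<le> T"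
  using set_integral_Icc_bounds[OF set_integrable_awaiting[OF assms(1)] _ _ assms(2), of c k m 1]
  by (auto simp: interarrival_occupation_def)

lemma occupation_eq_measure:
  assumes "\<omega> \<in> space M"
  shows "occupation m T \<omega> = measure lborel {s \<in> {0..T}. number_in_system (Q \<omega>) s = m}"
proof -
  note level_section[OF assms, measurable]
  have eq: "{s \<in> {0..T}. number_in_system (Q \<omega>) s = m} =
    {0..T} \<inter> {s \<in> space borel. (if 0 \<le> s \<and> number_in_system (Q \<omega>) s = m then 1 else (0::real)) = 1}"
    by auto
  have "{s \<in> space borel. (if 0 \<le> s \<and> number_in_system (Q \<omega>) s = m then 1 else (0::real)) = 1} \<in> sets borel"
    by measurable
  then have "{s \<in> {0..T}. number_in_system (Q \<omega>) s = m} \<in> sets lborel" unfolding eq by auto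
  moreover have "occupation m T \<omega> = (\<integral>s. indicator {s \<in> {0..T}. number_in_system (Q \<omega>) s = m} s \<partial>lborel)"
    unfolding occupation_def set_lebesgue_integral_def
    by (rule Bochner_Integration.integral_cong) (auto simp: indicator_def)
  ultimately show ?thesis by simp
qed

lemma sum_interarrival_occupation:
  assumes "\<omega> \<in> space M"
  shows "(\<Sum>k<K. interarrival_occupation c m k T \<omega>) =
    (LINT s:{0..T}|lborel. (\<Sum>k<K. if awaiting c k (Q \<omega>) s \<and> number_in_system (Q \<omega>) s = m then 1 else 0))"
proof -
  have "(\<Sum>k<K. interarrival_occupation c m k T \<omega>) = (\<integral>s. (\<Sum>k<K. indicator {0..T} s *\<^sub>R
      (if awaiting c k (Q \<omega>) s \<and> number_in_system (Q \<omega>) s = m then 1 else 0)) \<partial>lborel)"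
    unfolding interarrival_occupation_def set_lebesgue_integral_def
    by (rule Bochner_Integration.integral_sum[symmetric])
       (rule set_integrable_awaiting[OF assms, unfolded set_integrable_def])
  then show ?thesis by (simp only: scaleR_sum_right set_lebesgue_integral_def)
qed

lemma sum_awaiting_le_1:
  assumes "\<omega> \<in> space M"
  shows "(\<Sum>k<K. if awaiting c k (Q \<omega>) s \<and> number_in_system (Q \<omega>) s = m then 1 else 0) \<le> (1::real)"
proof (cases "\<exists>k. awaiting c k (Q \<omega>) s")
  case True
  then obtain k where k: "awaiting c k (Q \<omega>) s" by blast
  have "(\<Sum>l<K. if awaiting c l (Q \<omega>) s \<and> number_in_system (Q \<omega>) s = m then 1 else 0) \<le>
    (\<Sum>l<K. if l = k then 1 else (0::real))"
    by (intro sum_mono) (auto dest: awaiting_unique[OF valid[OF assms] _ k])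
  also have "\<dots> \<le> 1" by simp
  finally show ?thesis .
qed auto

lemma sum_interarrival_occupation_bounds:
  assumes "\<omega> \<in> space M" "0 \<le> T"
  shows "0 \<le> (\<Sum>k<K. interarrival_occupation c m k T \<omega>)" "(\<Sum>k<K. interarrival_occupation c m k T \<omega>) \<le> T"
proof -
  show "0 \<le> (\<Sum>k<K. interarrival_occupation c m k T \<omega>)" by (intro sum_nonneg interarrival_occupation_bounds assms)
  have i: "set_integrable lborel {0..T} (\<lambda>s. \<Sum>k<K. if awaiting c k (Q \<omega>) s \<and> number_in_system (Q \<omega>) s = m then 1 else (0::real))"
  proof (rule set_integrable_Icc_bounded[where B = 1])
    show "(\<lambda>s. \<Sum>k<K. if awaiting c k (Q \<omega>) s \<and> number_in_system (Q \<omega>) s = m then 1 else (0::real)) \<in> borel_measurable borel"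
      by (rule borel_measurable_sum) (rule awaiting_level_section[OF assms(1)])
    fix s
    have "0 \<le> (\<Sum>k<K. if awaiting c k (Q \<omega>) s \<and> number_in_system (Q \<omega>) s = m then 1 else (0::real))"
      by (rule sum_nonneg) simp
    then show "\<bar>\<Sum>k<K. if awaiting c k (Q \<omega>) s \<and> number_in_system (Q \<omega>) s = m then 1 else (0::real)\<bar> \<le> 1"
      using sum_awaiting_le_1[OF assms(1), of c s m K] by linarith
  qed
  show "(\<Sum>k<K. interarrival_occupation c m k T \<omega>) \<le> T"
    unfolding sum_interarrival_occupation[OF assms(1)]
    using set_integral_Icc_bounds(2)[OF i _ sum_awaiting_le_1[OF assms(1)] assms(2)]
    by (simp add: sum_nonneg)
qed

lemma sum_interarrival_occupation_eq_occupation: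
  assumes \<omega>: "\<omega> \<in> space M" and c: "initial_number (Q \<omega>) = c" and late: "T < arrival_epoch (Q \<omega>) K"
  shows "(\<Sum>k<Suc K. interarrival_occupation c m k T \<omega>) = occupation m T \<omega>"
  unfolding sum_interarrival_occupation[OF \<omega>] occupation_def set_lebesgue_integral_def
proof (rule Bochner_Integration.integral_cong)
  fix s :: real
  show "indicat_real {0..T} s *\<^sub>R (\<Sum>k<Suc K. if awaiting c k (Q \<omega>) s \<and> number_in_system (Q \<omega>) s = m then 1 else 0) =
    indicat_real {0..T} s *\<^sub>R (if number_in_system (Q \<omega>) s = m then 1 else (0::real))"
  proof (cases "s \<in> {0..T}")
    case True
    obtain k where k: "awaiting c k (Q \<omega>) s" using exists_awaiting[OF valid[OF \<omega>], of s] True c by auto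
    have "k < Suc K"
    proof (rule ccontr)
      assume "\<not> k < Suc K"
      then have "arrival_epoch (Q \<omega>) K \<le> arrival_epoch (Q \<omega>) (k - 1)" "0 < k"
        using arrival_epoch_le_iff[OF valid[OF \<omega>]] by auto
      then show False using k late True by (auto simp: awaiting_def)
    qed
    have delta: "(if awaiting c l (Q \<omega>) s \<and> number_in_system (Q \<omega>) s = m then 1 else 0) =
      (if l = k then (if number_in_system (Q \<omega>) s = m then 1 else 0) else (0::real))" for l
      by (cases "l = k") (use k in \<open>auto dest: awaiting_unique[OF valid[OF \<omega>] _ k]\<close>)
    have "(\<Sum>l<Suc K. if awaiting c l (Q \<omega>) s \<and> number_in_system (Q \<omega>) s = m then 1 else 0) =
      (\<Sum>l<Suc K. if l = k then (if number_in_system (Q \<omega>) s = m then 1 else 0) else (0::real))"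
      by (rule sum.cong[OF refl]) (rule delta)
    also have "\<dots> = (if number_in_system (Q \<omega>) s = m then 1 else 0)"
      using \<open>k < Suc K\<close> by (simp del: sum.lessThan_Suc)
    finally show ?thesis by (simp only:)
  qed simp
qed simp

lemma interarrival_occupation_other_initial: "initial_number (Q \<omega>) \<noteq> c \<Longrightarrow> interarrival_occupation c m k T \<omega> = 0"
  by (simp add: interarrival_occupation_def awaiting_def set_lebesgue_integral_def)

lemma integrable_interarrival_occupation: "0 \<le> T \<Longrightarrow> integrable M (interarrival_occupation c m k T)"
  by (rule integrable_bounded[where B = T])
     (use interarrival_occupation_bounds in \<open>auto simp: abs_of_nonneg\<close>)

lemma expected_count:
  assumes "0 \<le> T"
  shows "(\<integral>\<omega>. (\<Sum>k<K. arrival_ind c m k T \<omega>) \<partial>M) = rate m * (\<integral>\<omega>. (\<Sum>k<K. interarrival_occupation c m k T \<omega>) \<partial>M)"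
  by (simp add: Bochner_Integration.integral_sum integrable_arrival_ind integrable_interarrival_occupation assms
      expected_arrival_ind sum_distrib_left)

text \<open>
The times spent awaiting different arrivals are disjoint.
\<close>

lemma expected_count_le:
  assumes "0 \<le> T"
  shows "(\<integral>\<omega>. (\<Sum>k<K. arrival_ind c m k T \<omega>) \<partial>M) \<le> rate m * T"
proof -
  have "(\<integral>\<omega>. (\<Sum>k<K. interarrival_occupation c m k T \<omega>) \<partial>M) \<le> (\<integral>\<omega>. T \<partial>M)"
    by (intro integral_mono Bochner_Integration.integrable_sum integrable_interarrival_occupation
        sum_interarrival_occupation_bounds assms) auto
  then show ?thesis using rate_pos[of m] by (simp add: expected_count assms prob_space)
qed

text \<open>
The number of earlier arrivals that found \<open>m\<close> is known while arrival \<open>k\<close> is awaited, which makes it admissible as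
the factor \<open>V\<close> in \<open>expected_marked_arrival\<close>; it is at most the number counted up to \<open>T\<close>.
\<close>

lemma expected_arrival_ind_times_earlier:
  assumes T: "0 \<le> T" and kK: "k < K"
  shows "(\<integral>\<omega>. arrival_ind c m k T \<omega> * (\<Sum>l<k. arrival_ind c m l T \<omega>) \<partial>M) \<le>
    rate m * (\<integral>\<omega>. interarrival_occupation c m k T \<omega> * (\<Sum>l<K. arrival_ind c m l T \<omega>) \<partial>M)"
proof -
  \<comment> \<open>the horizon \<open>T\<close> is left out: the arrivals before \<open>k\<close> have all come when \<open>k\<close> is awaited\<close>
  define V where "V = (\<lambda>\<omega>. \<Sum>l<k. if number_found (Q \<omega>) l = m then 1 else (0::real))"
  have Vm [measurable]: "V \<in> borel_measurable M" unfolding V_def by measurable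
  have Vb: "0 \<le> V \<omega> \<and> V \<omega> \<le> real k" for \<omega>
  proof -
    have "V \<omega> \<le> (\<Sum>l<k. 1)" unfolding V_def by (intro sum_mono) auto
    then show ?thesis by (simp add: V_def sum_nonneg)
  qed
  have earlier: "arrival_epoch (Q \<omega>) l \<le> t"
    if "\<omega> \<in> space M" "l < k" "arrival_epoch (Q \<omega>) (k - 1) \<le> t" for \<omega> l t
  proof -
    have "arrival_epoch (Q \<omega>) l \<le> arrival_epoch (Q \<omega>) (k - 1)"
      using arrival_epoch_le_iff[OF valid[OF that(1)]] that(2) by simp
    then show ?thesis using that(3) by simp
  qed
  have Vpast: "(\<lambda>\<omega>. if awaiting c k (Q \<omega>) t then V \<omega> else 0) \<in> borel_measurable (past M Q t)" for t
  proof -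
    note past_number_found[measurable]
    have "(\<lambda>\<omega>. if awaiting c k (Q \<omega>) t then \<Sum>l<k. if arrival_epoch (Q \<omega>) l \<le> t \<and> number_found (Q \<omega>) l = m then 1 else (0::real) else 0)
      \<in> borel_measurable (past M Q t)" by measurable
    also have "?this \<longleftrightarrow> ?thesis"
    proof (rule measurable_cong)
      fix \<omega> assume "\<omega> \<in> space (past M Q t)"
      then have \<omega>: "\<omega> \<in> space M" by simp
      show "(if awaiting c k (Q \<omega>) t then \<Sum>l<k. if arrival_epoch (Q \<omega>) l \<le> t \<and> number_found (Q \<omega>) l = m then 1 else (0::real) else 0)
        = (if awaiting c k (Q \<omega>) t then V \<omega> else 0)"
      proof (cases "awaiting c k (Q \<omega>) t")
        case True
        have "arrival_epoch (Q \<omega>) l \<le> t" if "l < k" for l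
          by (rule earlier[OF \<omega> that]) (use True that in \<open>auto simp: awaiting_def\<close>)
        then show ?thesis by (auto simp: V_def intro!: sum.cong)
      qed simp
    qed
    finally show ?thesis .
  qed
  have VC: "V \<omega> = (\<Sum>l<k. arrival_ind c m l T \<omega>)"
    if "\<omega> \<in> space M" "initial_number (Q \<omega>) = c" "0 < k \<longrightarrow> arrival_epoch (Q \<omega>) (k - 1) \<le> T" for \<omega>
    unfolding V_def arrival_ind_def using earlier[OF that(1), of _ T] that by (intro sum.cong) auto
  have mono: "(\<Sum>l<k. arrival_ind c m l T \<omega>) \<le> (\<Sum>l<K. arrival_ind c m l T \<omega>)" for \<omega>
    using kK by (intro sum_mono2) (auto simp: arrival_ind_bounds)
  let ?f = "\<lambda>s \<omega>. if awaiting c k (Q \<omega>) s \<and> number_in_system (Q \<omega>) s = m then V \<omega> else 0"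
  note comp = expected_marked_arrival[of 0 m V "real k" c k T, OF _ _ Vm Vb Vpast T]
  have fm: "(\<lambda>(s, \<omega>). ?f s \<omega>) \<in> borel_measurable (borel \<Otimes>\<^sub>M M)"
    using comp(2) by (simp add: residual_discount_def cong: if_cong)
  have fint: "set_integrable lborel {0..T} (\<lambda>s. ?f s \<omega>)" if "\<omega> \<in> space M" for \<omega>
    by (rule set_integrable_Icc_bounded[where B = "real k", OF borel_measurable_section[OF fm that]])
       (use Vb in \<open>auto simp: abs_of_nonneg\<close>)
  have "(\<integral>\<omega>. arrival_ind c m k T \<omega> * (\<Sum>l<k. arrival_ind c m l T \<omega>) \<partial>M) =
      (\<integral>\<omega>. (if initial_number (Q \<omega>) = c \<and> arrival_epoch (Q \<omega>) k \<le> T \<and> number_found (Q \<omega>) k = m then V \<omega> else 0) \<partial>M)"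
  proof (rule Bochner_Integration.integral_cong[OF refl])
    fix \<omega> assume \<omega>: "\<omega> \<in> space M"
    have "arrival_epoch (Q \<omega>) (k - 1) \<le> T" if "0 < k" "arrival_epoch (Q \<omega>) k \<le> T"
      using that arrival_epoch_le_iff[OF valid[OF \<omega>], of "k - 1" k] by simp
    then show "arrival_ind c m k T \<omega> * (\<Sum>l<k. arrival_ind c m l T \<omega>) =
      (if initial_number (Q \<omega>) = c \<and> arrival_epoch (Q \<omega>) k \<le> T \<and> number_found (Q \<omega>) k = m then V \<omega> else 0)"
      using VC[OF \<omega>] by (cases "arrival_ind c m k T \<omega> = 0") (auto simp: arrival_ind_def[of c m k T] split: if_splits)
  qed
  also have "\<dots> = rate m * (\<integral>\<omega>. (LINT s:{0..T}|lborel. ?f s \<omega>) \<partial>M)"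
    using comp(1) by (simp add: residual_discount_def cong: if_cong)
  also have "\<dots> \<le> rate m * (\<integral>\<omega>. interarrival_occupation c m k T \<omega> * (\<Sum>l<K. arrival_ind c m l T \<omega>) \<partial>M)"
  proof (intro mult_left_mono integral_mono)
    show "integrable M (\<lambda>\<omega>. LINT s:{0..T}|lborel. ?f s \<omega>)"
    proof (rule integrable_bounded[where B = "real k * T"])
      show "(\<lambda>\<omega>. LINT s:{0..T}|lborel. ?f s \<omega>) \<in> borel_measurable M"
        by (rule borel_measurable_set_integral_Icc[OF fm])
      fix \<omega> assume "\<omega> \<in> space M"
      from set_integral_Icc_bounds[OF fint[OF this] _ _ T, of "real k"] Vb
      show "\<bar>LINT s:{0..T}|lborel. ?f s \<omega>\<bar> \<le> real k * T" by (auto simp: abs_of_nonneg)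
    qed
    show "integrable M (\<lambda>\<omega>. interarrival_occupation c m k T \<omega> * (\<Sum>l<K. arrival_ind c m l T \<omega>))"
    proof (rule integrable_bounded[where B = "T * real K"])
      fix \<omega> assume \<omega>: "\<omega> \<in> space M"
      have "(\<Sum>l<K. arrival_ind c m l T \<omega>) \<le> (\<Sum>l<K. 1)" by (intro sum_mono) (simp add: arrival_ind_bounds)
      then show "\<bar>interarrival_occupation c m k T \<omega> * (\<Sum>l<K. arrival_ind c m l T \<omega>)\<bar> \<le> T * real K"
        using interarrival_occupation_bounds[OF \<omega> T, of c m k] T
        by (simp add: abs_mult sum_nonneg arrival_ind_bounds abs_of_nonneg mult_mono)
    qed measurable
    fix \<omega> assume \<omega>: "\<omega> \<in> space M"
    have "(LINT s:{0..T}|lborel. ?f s \<omega>) \<le> (LINT s:{0..T}|lborel.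
        (\<Sum>l<K. arrival_ind c m l T \<omega>) * (if awaiting c k (Q \<omega>) s \<and> number_in_system (Q \<omega>) s = m then 1 else 0))"
    proof (rule set_integral_mono[OF fint[OF \<omega>]])
      show "set_integrable lborel {0..T} (\<lambda>s. (\<Sum>l<K. arrival_ind c m l T \<omega>) *
          (if awaiting c k (Q \<omega>) s \<and> number_in_system (Q \<omega>) s = m then 1 else 0))"
        by (intro set_integrable_mult_right impI set_integrable_awaiting \<omega>)
      fix s assume s: "s \<in> {0..T}"
      show "?f s \<omega> \<le> (\<Sum>l<K. arrival_ind c m l T \<omega>) * (if awaiting c k (Q \<omega>) s \<and> number_in_system (Q \<omega>) s = m then 1 else 0)"
      proof (cases "awaiting c k (Q \<omega>) s")
        case True
        have "0 < k \<longrightarrow> arrival_epoch (Q \<omega>) (k - 1) \<le> T" using True s by (auto simp: awaiting_def)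
        moreover have "initial_number (Q \<omega>) = c" using True by (simp add: awaiting_def)
        ultimately show ?thesis using VC[OF \<omega>] mono[of \<omega>] by simp
      qed simp
    qed
    also have "\<dots> = interarrival_occupation c m k T \<omega> * (\<Sum>l<K. arrival_ind c m l T \<omega>)"
      by (simp only: set_integral_mult_right interarrival_occupation_def mult.commute)
    finally show "(LINT s:{0..T}|lborel. ?f s \<omega>) \<le> interarrival_occupation c m k T \<omega> * (\<Sum>l<K. arrival_ind c m l T \<omega>)" .
  qed (simp add: rate_pos less_imp_le)
  finally show ?thesis .
qed

lemma square_sum_of_zero_one:
  fixes x :: "nat \<Rightarrow> real"
  assumes "\<And>k. x k * x k = x k"
  shows "(\<Sum>k<K. x k) ^ 2 = (\<Sum>k<K. x k) + 2 * (\<Sum>k<K. x k * (\<Sum>l<k. x l))"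
  by (induction K) (auto simp: power2_eq_square algebra_simps assms)

text \<open>
The square of a sum of indicators consists of the sum and of the pairs.  Summed over \<open>k\<close>, the bound of
\<open>expected_arrival_ind_times_earlier\<close> for the pairs is \<open>rate m\<close> times the count times the total time
\<open>T\<close>, in expectation.
\<close>

lemma expected_square_count_le:
  assumes T: "0 \<le> T"
  shows "(\<integral>\<omega>. (\<Sum>k<K. arrival_ind c m k T \<omega>) ^ 2 \<partial>M) \<le> rate m * T + 2 * (rate m * T) ^ 2"
proof -
  let ?C = "\<lambda>\<omega>. \<Sum>k<K. arrival_ind c m k T \<omega>"
  have C: "0 \<le> ?C \<omega>" "?C \<omega> \<le> real K" for \<omega>
    using sum_mono[of "{..<K}" "\<lambda>k. arrival_ind c m k T \<omega>" "\<lambda>_. 1"] by (auto simp: sum_nonneg arrival_ind_bounds)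
  have ih: "integrable M (\<lambda>\<omega>. arrival_ind c m k T \<omega> * (\<Sum>l<k. arrival_ind c m l T \<omega>))" for k
  proof (rule integrable_bounded[where B = "real k"])
    fix \<omega>
    have "(\<Sum>l<k. arrival_ind c m l T \<omega>) \<le> (\<Sum>l<k. 1)" by (intro sum_mono) (simp add: arrival_ind_bounds)
    then show "\<bar>arrival_ind c m k T \<omega> * (\<Sum>l<k. arrival_ind c m l T \<omega>)\<bar> \<le> real k"
      using mult_mono[of "arrival_ind c m k T \<omega>" 1 "\<Sum>l<k. arrival_ind c m l T \<omega>" "real k"]
      by (simp add: abs_mult sum_nonneg arrival_ind_bounds abs_of_nonneg)
  qed measurable
  have iw: "integrable M (\<lambda>\<omega>. interarrival_occupation c m k T \<omega> * ?C \<omega>)" for k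
  proof (rule integrable_bounded[where B = "T * real K"])
    fix \<omega> assume \<omega>: "\<omega> \<in> space M"
    show "\<bar>interarrival_occupation c m k T \<omega> * ?C \<omega>\<bar> \<le> T * real K"
      using interarrival_occupation_bounds[OF \<omega> T, of c m k] T C[of \<omega>]
      by (simp add: abs_mult abs_of_nonneg mult_mono)
  qed measurable
  have iC: "integrable M ?C" by (intro Bochner_Integration.integrable_sum integrable_arrival_ind)
  have sq: "?C \<omega> ^ 2 = ?C \<omega> + 2 * (\<Sum>k<K. arrival_ind c m k T \<omega> * (\<Sum>l<k. arrival_ind c m l T \<omega>))" for \<omega>
    by (rule square_sum_of_zero_one) (simp add: arrival_ind_def)
  have "(\<Sum>k<K. \<integral>\<omega>. arrival_ind c m k T \<omega> * (\<Sum>l<k. arrival_ind c m l T \<omega>) \<partial>M) \<le>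
      (\<Sum>k<K. rate m * (\<integral>\<omega>. interarrival_occupation c m k T \<omega> * ?C \<omega> \<partial>M))"
    by (intro sum_mono expected_arrival_ind_times_earlier T) auto
  also have "\<dots> = rate m * (\<integral>\<omega>. (\<Sum>k<K. interarrival_occupation c m k T \<omega>) * ?C \<omega> \<partial>M)"
    by (simp only: sum_distrib_right[of "\<lambda>k. interarrival_occupation c m k T _"] Bochner_Integration.integral_sum[OF iw]
        sum_distrib_left[of "rate m"])
  also have "\<dots> \<le> rate m * (\<integral>\<omega>. T * ?C \<omega> \<partial>M)"
  proof (intro mult_left_mono integral_mono)
    show "integrable M (\<lambda>\<omega>. (\<Sum>k<K. interarrival_occupation c m k T \<omega>) * ?C \<omega>)"
      unfolding sum_distrib_right[of "\<lambda>k. interarrival_occupation c m k T _"]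
      by (rule Bochner_Integration.integrable_sum) (rule iw)
    show "integrable M (\<lambda>\<omega>. T * ?C \<omega>)" using iC by simp
    show "(\<Sum>k<K. interarrival_occupation c m k T \<omega>) * ?C \<omega> \<le> T * ?C \<omega>" if "\<omega> \<in> space M" for \<omega>
      using sum_interarrival_occupation_bounds[OF that T] C by (intro mult_right_mono) auto
  qed (simp add: rate_pos less_imp_le)
  also have "\<dots> = rate m * T * (\<integral>\<omega>. ?C \<omega> \<partial>M)" by simp
  also have "\<dots> \<le> rate m * T * (rate m * T)"
    using rate_pos[of m] T by (intro mult_left_mono expected_count_le) (auto intro: mult_nonneg_nonneg)
  finally have cross: "(\<Sum>k<K. \<integral>\<omega>. arrival_ind c m k T \<omega> * (\<Sum>l<k. arrival_ind c m l T \<omega>) \<partial>M) \<le> (rate m * T) ^ 2"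
    by (simp add: power2_eq_square)
  define S where "S = (\<lambda>\<omega>. \<Sum>k<K. arrival_ind c m k T \<omega> * (\<Sum>l<k. arrival_ind c m l T \<omega>))"
  have iS: "integrable M S" unfolding S_def by (rule Bochner_Integration.integrable_sum) (rule ih)
  have "(\<integral>\<omega>. ?C \<omega> ^ 2 \<partial>M) = (\<integral>\<omega>. ?C \<omega> + 2 * S \<omega> \<partial>M)" unfolding sq S_def ..
  also have "\<dots> = (\<integral>\<omega>. ?C \<omega> \<partial>M) + 2 * (\<integral>\<omega>. S \<omega> \<partial>M)"
    using Bochner_Integration.integral_add[OF iC, of "\<lambda>\<omega>. 2 * S \<omega>"] iS by simp
  also have "(\<integral>\<omega>. S \<omega> \<partial>M) = (\<Sum>k<K. \<integral>\<omega>. arrival_ind c m k T \<omega> * (\<Sum>l<k. arrival_ind c m l T \<omega>) \<partial>M)"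
    unfolding S_def by (rule Bochner_Integration.integral_sum) (rule ih)
  finally have "(\<integral>\<omega>. ?C \<omega> ^ 2 \<partial>M) =
    (\<integral>\<omega>. ?C \<omega> \<partial>M) + 2 * (\<Sum>k<K. \<integral>\<omega>. arrival_ind c m k T \<omega> * (\<Sum>l<k. arrival_ind c m l T \<omega>) \<partial>M)" .
  then show ?thesis using cross expected_count_le[OF T, of c m K] by linarith
qed

end

section \<open>Service starts\<close>

text \<open>
Distribution functions determine distributions, so the conditional law of \<open>S\<close> given \<open>C\<close> is \<open>G\<close>.
\<close>

lemma (in prob_space) expectation_of_conditional_cdf:
  fixes f :: "real \<Rightarrow> real"
  assumes C [measurable]: "C \<in> sets M" and S [measurable]: "S \<in> borel_measurable M"
    and G: "real_distribution G"
    and law: "\<And>x. 0 < measure M C \<Longrightarrow> \<P>(\<omega> in M. S \<omega> \<le> x \<bar> \<omega> \<in> C) = cdf G x"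
    and f [measurable]: "f \<in> borel_measurable borel"
  shows "(\<integral>\<omega>. indicator C \<omega> * f (S \<omega>) \<partial>M) = measure M C * (\<integral>x. f x \<partial>G)"
proof (cases "measure M C = 0")
  case True
  then have "C \<in> null_sets M" by (simp add: null_setsI emeasure_eq_measure)
  then have "AE \<omega> in M. indicator C \<omega> * f (S \<omega>) = 0"
    by (rule AE_not_in[THEN AE_mp]) (auto intro!: AE_I2)
  then have "(\<integral>\<omega>. indicator C \<omega> * f (S \<omega>) \<partial>M) = 0" by (rule integral_eq_zero_AE)
  then show ?thesis using True by simp
next
  case False
  then have pos: "0 < measure M C" by (simp add: zero_less_measure_iff)
  have ne: "emeasure M C \<noteq> 0" "emeasure M C \<noteq> \<infinity>" using pos by (auto simp: emeasure_eq_measure)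
  define U where "U = uniform_measure M C"
  have CsM: "C \<subseteq> space M" by (rule sets.sets_into_space[OF C])
  have U_eq: "U = density M (\<lambda>\<omega>. ennreal (indicator C \<omega> / measure M C))"
    unfolding U_def uniform_measure_def using pos
    by (intro density_cong) (auto intro!: AE_I2 simp: emeasure_eq_measure indicator_def ennreal_1[symmetric] divide_ennreal simp del: ennreal_1)
  interpret U: prob_space U unfolding U_def by (rule prob_space_uniform_measure[OF ne])
  have SU: "S \<in> borel_measurable U" unfolding U_def by simp
  have dist: "real_distribution (distr U borel S)" by (rule U.real_distribution_distr[OF SU])
  have "cdf (distr U borel S) x = cdf G x" for x
  proof -
    have "cdf (distr U borel S) x = measure U {\<omega> \<in> space M. S \<omega> \<le> x}"
      unfolding cdf_def by (subst measure_distr[OF SU]) (auto simp: U_def intro!: arg_cong[where f = "measure _"])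
    also have "\<dots> = measure M (C \<inter> {\<omega> \<in> space M. S \<omega> \<le> x}) / measure M C"
      unfolding U_def by (rule measure_uniform_measure[OF ne]) measurable
    also have "C \<inter> {\<omega> \<in> space M. S \<omega> \<le> x} = {\<omega> \<in> space M. S \<omega> \<le> x \<and> \<omega> \<in> C}" using CsM by auto
    also have "measure M C = \<P>(\<omega> in M. \<omega> \<in> C)" using CsM by (auto intro!: arg_cong[where f = "measure M"])
    finally show ?thesis using law[OF pos, of x] by (simp add: cond_prob_def)
  qed
  then have eqG: "distr U borel S = G" by (intro cdf_unique dist G ext)
  have "(\<integral>x. f x \<partial>G) = (\<integral>\<omega>. f (S \<omega>) \<partial>U)"
    unfolding eqG[symmetric] by (rule integral_distr[OF SU f])
  also have "\<dots> = (\<integral>\<omega>. (indicator C \<omega> / measure M C) *\<^sub>R f (S \<omega>) \<partial>M)"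
    unfolding U_eq by (rule integral_density) (auto intro!: AE_I2)
  also have "\<dots> = (\<integral>\<omega>. indicator C \<omega> * f (S \<omega>) \<partial>M) / measure M C"
    by simp
  finally show ?thesis using False by simp
qed

context Mn_Gn_1_queue begin

lemma past_at_start_generators:
  "range (\<lambda>n. {\<omega> \<in> space M. initial_number (Q \<omega>) = n}) \<union>
      {{\<omega> \<in> space M. arrival_epoch (Q \<omega>) k \<le> service_start (Q \<omega>) j \<and> arrival_epoch (Q \<omega>) k \<le> s}
        | k s. True} \<union>
      {{\<omega> \<in> space M. service_duration (Q \<omega>) i \<le> x} | i x. i < j} \<subseteq> sets M"
  by auto

lemma space_past_at_start [simp]: "space (past_at_start M Q j) = space M"
  unfolding past_at_start_def
  by (rule space_measure_of) (use past_at_start_generators sets.sets_into_space in blast)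

lemma sets_past_at_start: "sets (past_at_start M Q j) = sigma_sets (space M)
   (range (\<lambda>n. {\<omega> \<in> space M. initial_number (Q \<omega>) = n}) \<union>
      {{\<omega> \<in> space M. arrival_epoch (Q \<omega>) k \<le> service_start (Q \<omega>) j \<and> arrival_epoch (Q \<omega>) k \<le> s}
        | k s. True} \<union>
      {{\<omega> \<in> space M. service_duration (Q \<omega>) i \<le> x} | i x. i < j})"
  unfolding past_at_start_def
  by (rule sets_measure_of) (use past_at_start_generators sets.sets_into_space in blast)

lemma past_at_start_initial: "{\<omega> \<in> space M. initial_number (Q \<omega>) = n} \<in> sets (past_at_start M Q j)"
  unfolding sets_past_at_start by (intro sigma_sets.Basic) auto

text \<open>
Customer \<open>l \<le> j\<close> arrives before service \<open>j\<close> starts, hence is among the arrivals that the generators show.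
\<close>

lemma past_at_start_customer:
  assumes "l \<le> j"
  shows "(\<lambda>\<omega>. customer_epoch (Q \<omega>) l) \<in> borel_measurable (past_at_start M Q j)"
proof (subst borel_measurable_iff_le, rule allI)
  fix s
  let ?F = "past_at_start M Q j"
  have arr: "{\<omega> \<in> space M. arrival_epoch (Q \<omega>) k \<le> service_start (Q \<omega>) j \<and> arrival_epoch (Q \<omega>) k \<le> s} \<in> sets ?F" for k
    unfolding sets_past_at_start by (intro sigma_sets.Basic) auto
  have "customer_epoch (Q \<omega>) l \<le> service_start (Q \<omega>) j" if "\<omega> \<in> space M" for \<omega>
    using customer_epoch_le_start mono_service_start[OF valid[OF that] assms] by (rule order_trans)
  then have "{\<omega> \<in> space ?F. customer_epoch (Q \<omega>) l \<le> s} =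
    (\<Union>n. {\<omega> \<in> space M. initial_number (Q \<omega>) = n} \<inter> (if l < n then (if 0 \<le> s then space M else {}) else
      {\<omega> \<in> space M. arrival_epoch (Q \<omega>) (l - n) \<le> service_start (Q \<omega>) j \<and> arrival_epoch (Q \<omega>) (l - n) \<le> s}))"
    by (force simp: customer_epoch_def split: if_splits)
  also have "\<dots> \<in> sets ?F"
    using arr past_at_start_initial sets.top[of ?F] by (intro sets.countable_UN) auto
  finally show "{\<omega> \<in> space ?F. customer_epoch (Q \<omega>) l \<le> s} \<in> sets ?F" .
qed

lemma past_at_start_duration:
  assumes "i < j"
  shows "(\<lambda>\<omega>. service_duration (Q \<omega>) i) \<in> borel_measurable (past_at_start M Q j)"
  unfolding borel_measurable_iff_le
  using assms by (auto simp: sets_past_at_start intro!: sigma_sets.Basic)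

lemma past_at_start_service_start:
  "l \<le> j \<Longrightarrow> (\<lambda>\<omega>. service_start (Q \<omega>) l) \<in> borel_measurable (past_at_start M Q j)"
proof (induction l)
  case (Suc l)
  then show ?case
    by (auto simp: service_start.simps(2) intro!: borel_measurable_max borel_measurable_add
        past_at_start_customer past_at_start_duration)
qed (simp add: past_at_start_customer)

definition start_ind :: "nat \<Rightarrow> nat \<Rightarrow> nat \<Rightarrow> real \<Rightarrow> 'a \<Rightarrow> real" where
  "start_ind c n j T \<omega> = (if initial_number (Q \<omega>) = c \<and> service_start (Q \<omega>) j \<le> T \<and> number_at_start (Q \<omega>) j = n
     then 1 else 0)"

lemma start_ind_measurable [measurable]: "start_ind c n j T \<in> borel_measurable M"
  unfolding start_ind_def[abs_def] by measurable

lemma start_ind_bounds: "0 \<le> start_ind c n j T \<omega>" "start_ind c n j T \<omega> \<le> 1"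
  by (auto simp: start_ind_def)

text \<open>
For \<open>j > 0\<close> the exception in the service law, for the service in progress at time 0, does not arise.
\<close>

lemma expected_discounted_start:
  assumes n: "1 \<le> n" and j: "0 < j"
  shows "(\<integral>\<omega>. start_ind c n j T \<omega> * exp (- \<theta> * service_duration (Q \<omega>) j) \<partial>M) =
    LST (G n) \<theta> * (\<integral>\<omega>. start_ind c n j T \<omega> \<partial>M)"
proof -
  let ?F = "past_at_start M Q j"
  define E where "E = {\<omega> \<in> space M. initial_number (Q \<omega>) = c} \<inter> {\<omega> \<in> space M. service_start (Q \<omega>) j \<le> T}"
  note past_at_start_service_start[OF order_refl, measurable]
  have "{\<omega> \<in> space ?F. service_start (Q \<omega>) j \<le> T} \<in> sets ?F" by measurable
  then have E: "E \<in> sets ?F" unfolding E_def using past_at_start_initial by auto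
  define C where "C = {\<omega> \<in> space M. \<omega> \<in> E \<and> (0 < j \<or> initial_number (Q \<omega>) = 0) \<and> number_at_start (Q \<omega>) j = n}"
  have Cm: "C \<in> sets M" unfolding C_def E_def by simp
  have ind: "start_ind c n j T \<omega> = indicator C \<omega>" if "\<omega> \<in> space M" for \<omega>
    using that j by (auto simp: start_ind_def C_def E_def)
  have law: "\<P>(\<omega> in M. service_duration (Q \<omega>) j \<le> x \<bar> \<omega> \<in> C) = cdf (G n) x" if "0 < measure M C" for x
  proof -
    have "\<P>(\<omega> in M. service_duration (Q \<omega>) j \<le> x \<bar>
            \<omega> \<in> E \<and> (0 < j \<or> initial_number (Q \<omega>) = 0) \<and> number_at_start (Q \<omega>) j = n) = cdf (G n) x"
      by (rule service_law[OF n E]) (use that in \<open>simp add: C_def\<close>)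
    then show ?thesis by (simp add: cond_prob_def C_def cong: conj_cong)
  qed
  have "(\<integral>\<omega>. start_ind c n j T \<omega> * exp (- \<theta> * service_duration (Q \<omega>) j) \<partial>M) =
    (\<integral>\<omega>. indicator C \<omega> * exp (- \<theta> * service_duration (Q \<omega>) j) \<partial>M)"
    by (intro Bochner_Integration.integral_cong refl) (simp add: ind)
  also have "\<dots> = measure M C * (\<integral>x. exp (- \<theta> * x) \<partial>G n)"
    by (rule expectation_of_conditional_cdf[OF Cm _ service_distribution[OF n] law]) auto
  also have "measure M C = (\<integral>\<omega>. indicator C \<omega> \<partial>M)" using sets.sets_into_space[OF Cm] by (simp add: Int_absorb2)
  also have "\<dots> = (\<integral>\<omega>. start_ind c n j T \<omega> \<partial>M)"
    by (intro Bochner_Integration.integral_cong refl) (simp add: ind)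
  finally show ?thesis by (simp add: LST_def)
qed

lemma LST_bounds:
  assumes "1 \<le> n" "0 \<le> \<theta>"
  shows "0 \<le> LST (G n) \<theta>" "LST (G n) \<theta> \<le> 1"
proof -
  interpret R: real_distribution "G n" by (rule service_distribution[OF assms(1)])
  show "0 \<le> LST (G n) \<theta>" unfolding LST_def by simp
  have "(\<integral>x. exp (- \<theta> * x) \<partial>G n) \<le> (\<integral>x. 1 \<partial>G n)"
  proof (rule integral_mono_AE)
    have ae: "AE x in G n. exp (- \<theta> * x) \<le> 1"
      using service_nonneg[OF assms(1)] by eventually_elim (use assms(2) in simp)
    then show "AE x in G n. exp (- \<theta> * x) \<le> 1" .
    show "integrable (G n) (\<lambda>x. exp (- \<theta> * x))"
      by (rule R.integrable_const_bound[where B = 1]) (use ae in auto)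
  qed simp
  then show "LST (G n) \<theta> \<le> 1" using R.prob_space unfolding LST_def by simp
qed

end

section \<open>Balance at one level\<close>

text \<open>
The balance of the weight \<open>exp (- \<theta> * r)\<close> at one level during one service.  The service lasts from \<open>s\<close> to \<open>d\<close>, the level from the
arrival at \<open>p\<close> to the arrival at \<open>r\<close>.  On the left are the two ways to enter, the exit by completion, and the
weight left at the horizon \<open>T\<close>; on the right are the exit by an arrival and, subtracted, the growth of the weight in
between.  The flag \<open>w\<close> tells whether the level can be entered by an arrival; at level 1 it cannot, since
the customer who arrives at \<open>p\<close> is the one served.
\<close>

lemma phase_identity:
  fixes p r s d T \<theta> :: real and w :: bool
  assumes "p < r" "s \<le> d" "s \<noteq> r" "d \<noteq> r" "w \<Longrightarrow> s \<noteq> p \<and> d \<noteq> p" "\<not> w \<Longrightarrow> p \<le> s"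
  shows "of_bool (s \<le> T \<and> p \<le> s \<and> s < r) * exp (- \<theta> * (d - s))
      + of_bool (w \<and> p \<le> T \<and> s \<le> p \<and> p < d) * exp (- \<theta> * (d - p))
      - of_bool (d \<le> T \<and> (w \<longrightarrow> p < d) \<and> d \<le> r)
      - of_bool (max s p \<le> T \<and> T < min d r) * exp (- \<theta> * (d - T))
    = of_bool (r \<le> T \<and> s \<le> r \<and> r < d) * exp (- \<theta> * (d - r))
      - (if max s p < min (min d r) T
         then exp (- \<theta> * (d - min (min d r) T)) - exp (- \<theta> * (d - max s p)) else 0)"
proof -
  have cases: "p \<le> s \<and> s < r \<and> d < r \<or> p \<le> s \<and> s < r \<and> r < d \<or> s < p \<and> w \<and> d < p \<or> s < p \<and> w \<and> p < d \<and> d < r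
      \<or> s < p \<and> w \<and> p < d \<and> r < d \<or> r < s"
    using assms by (cases w) linarith+
  consider (1) "p \<le> s" "s < r" "d < r" | (2) "p \<le> s" "s < r" "r < d" | (3) "s < p" "w" "d < p"
    | (4) "s < p" "w" "p < d" "d < r" | (5) "s < p" "w" "p < d" "r < d" | (6) "r < s"
    using cases by blast
  then show ?thesis
  proof cases
    case 1
    have [simp]: "max s p = s" "min d r = d" using 1 by auto
    have [simp]: "(w \<and> p \<le> T \<and> s \<le> p \<and> p < d) = False" "(w \<longrightarrow> p < d) = True" "(r \<le> T \<and> s \<le> r \<and> r < d) = False"
      using 1 assms by auto
    consider "T < s" | "s \<le> T" "T < d" | "d \<le> T" by linarith
    then show ?thesis using 1 assms(2,5) by cases (auto simp: min_def)
  next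
    case 2
    have [simp]: "max s p = s" "min d r = r" using 2 by auto
    have [simp]: "(w \<and> p \<le> T \<and> s \<le> p \<and> p < d) = False" "(d \<le> T \<and> (w \<longrightarrow> p < d) \<and> d \<le> r) = False"
      using 2 assms by auto
    consider "T < s" | "s \<le> T" "T < r" | "r \<le> T" by linarith
    then show ?thesis using 2 assms(5) by cases (auto simp: min_def)
  next
    case 3
    then show ?thesis using assms(1) by simp
  next
    case 4
    have [simp]: "max s p = p" "min d r = d" using 4 by auto
    consider "T < p" | "p \<le> T" "T < d" | "d \<le> T" by linarith
    then show ?thesis using 4 by cases (auto simp: min_def)
  next
    case 5
    have [simp]: "max s p = p" "min d r = r" using 5 by auto
    consider "T < p" | "p \<le> T" "T < r" | "r \<le> T" by linarith
    then show ?thesis using 5 assms(1) by cases (auto simp: min_def)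
  next
    case 6
    then show ?thesis using assms(1,2) by simp
  qed
qed

text \<open>
Completions at \<open>d\<close> and \<open>d'\<close> and arrivals at \<open>p\<close> and \<open>r\<close>, merged in time: a completion that leaves a given level and the
arrival that returns to it cancel, except at the horizon.  The two last terms on the right are the same
expression for successive services, so that they telescope.
\<close>

lemma level_crossing_telescope:
  fixes p r d d' T :: real
  assumes "d \<le> d'" "p \<le> r"
  shows "of_bool (d \<le> T \<and> p < d \<and> d \<le> r) - of_bool (r \<le> T \<and> d \<le> r \<and> r < d') =
    (of_bool (d \<le> T \<and> p \<le> T \<and> T < r) + of_bool (d' \<le> r \<and> r \<le> T) - of_bool (d \<le> p \<and> p \<le> T) :: real)"
  using assms by (auto simp: of_bool_def split: if_splits)

lemma set_integral_exp_phase: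
  fixes a b d T \<theta> :: real
  assumes "0 \<le> a"
  shows "\<theta> * (LINT s:{0..T}|lborel. (if a \<le> s \<and> s < b then exp (- \<theta> * (d - s)) else 0)) =
    (if a < min b T then exp (- \<theta> * (d - min b T)) - exp (- \<theta> * (d - a)) else 0)"
proof (cases "a < min b T")
  case True
  let ?m = "min b T"
  have "(LINT s:{0..T}|lborel. (if a \<le> s \<and> s < b then exp (- \<theta> * (d - s)) else 0)) =
      (\<integral>s. exp (- \<theta> * (d - s)) * indicator {a..?m} s \<partial>lborel)"
    unfolding set_lebesgue_integral_def
  proof (rule integral_cong_AE)
    show "AE s in lborel. indicator {0..T} s *\<^sub>R (if a \<le> s \<and> s < b then exp (- \<theta> * (d - s)) else 0) =
        exp (- \<theta> * (d - s)) * indicator {a..?m} s"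
      using AE_lborel_singleton[of b]
      by eventually_elim (use assms in \<open>auto simp: indicator_def\<close>)
  qed measurable
  then have "\<theta> * (LINT s:{0..T}|lborel. (if a \<le> s \<and> s < b then exp (- \<theta> * (d - s)) else 0)) =
      (\<integral>s. (\<theta> * exp (- \<theta> * (d - s))) * indicator {a..?m} s \<partial>lborel)"
    by (simp add: mult.assoc)
  also have "\<dots> = exp (- \<theta> * (d - ?m)) - exp (- \<theta> * (d - a))"
    by (rule integral_FTC_Icc_real)
       (use True in \<open>auto intro!: derivative_eq_intros continuous_intros\<close>)
  finally show ?thesis using True by simp
next
  case False
  have "(LINT s:{0..T}|lborel. (if a \<le> s \<and> s < b then exp (- \<theta> * (d - s)) else 0)) = 0"
    unfolding set_lebesgue_integral_def
  proof (rule integral_eq_zero_AE)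
    show "AE s in lborel. indicator {0..T} s *\<^sub>R (if a \<le> s \<and> s < b then exp (- \<theta> * (d - s)) else 0) = 0"
      using AE_lborel_singleton[of a]
      by eventually_elim (use False in \<open>auto simp: indicator_def\<close>)
  qed
  then show ?thesis using False by (simp only: if_False mult_zero_right)
qed

lemma sum_of_bool_le_1:
  fixes P :: "nat \<Rightarrow> bool"
  assumes "\<And>i j. P i \<Longrightarrow> P j \<Longrightarrow> i = j"
  shows "(\<Sum>l<B. of_bool (P l) :: real) \<le> 1"
proof (cases "\<exists>i. P i")
  case True
  then obtain i where i: "P i" by blast
  have "(\<Sum>l<B. of_bool (P l) :: real) \<le> (\<Sum>l<B. if l = i then 1 else 0)"
    by (intro sum_mono) (auto dest: assms[OF _ i])
  also have "\<dots> \<le> 1" by simp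
  finally show ?thesis .
qed auto

lemma sum_shift_close:
  fixes x :: "nat \<Rightarrow> real"
  assumes "\<And>k. 0 \<le> x k" "\<And>k. x k \<le> 1"
  shows "\<bar>(\<Sum>l<B. x (l + d)) - (\<Sum>k<B. x k)\<bar> \<le> real d"
proof -
  have "(\<Sum>l<B. x (l + d)) + (\<Sum>k<d. x k) = (\<Sum>k<B + d. x k)"
    by (induction B) (auto simp: add_ac)
  moreover have "(\<Sum>k<B + d. x k) = (\<Sum>k<B. x k) + (\<Sum>l<d. x (B + l))"
    by (induction d) (auto simp: add_ac)
  moreover have "(\<Sum>k<d. x k) \<le> (\<Sum>k<d. 1)" "(\<Sum>l<d. x (B + l)) \<le> (\<Sum>l<d. 1)"
    by (intro sum_mono assms)+
  moreover have "0 \<le> (\<Sum>k<d. x k)" "0 \<le> (\<Sum>l<d. x (B + l))" by (intro sum_nonneg assms)+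
  ultimately show ?thesis by simp
qed

context Mn_Gn_1_queue begin

text \<open>
Customers \<open>j, \<dots>, j + n - 1\<close> are present when service \<open>j\<close> ends.  For \<open>n = 1\<close> the condition that customer \<open>j + n - 1 = j\<close> has
arrived before is dropped; it would exclude services of duration 0 that start on arrival.
\<close>

definition departure_ind :: "nat \<Rightarrow> nat \<Rightarrow> nat \<Rightarrow> real \<Rightarrow> 'a \<Rightarrow> real" where
  "departure_ind c n j T \<omega> = of_bool (initial_number (Q \<omega>) = c \<and> service_end (Q \<omega>) j \<le> T \<and>
     (2 \<le> n \<longrightarrow> customer_epoch (Q \<omega>) (j + n - 1) < service_end (Q \<omega>) j) \<and>
     service_end (Q \<omega>) j \<le> customer_epoch (Q \<omega>) (j + n))"

definition discounted_arrival :: "nat \<Rightarrow> nat \<Rightarrow> nat \<Rightarrow> real \<Rightarrow> real \<Rightarrow> 'a \<Rightarrow> real" where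
  "discounted_arrival c m k \<theta> T \<omega> = arrival_ind c m k T \<omega> * residual_discount (c + k) m \<theta> \<omega> (arrival_epoch (Q \<omega>) k)"

lemma arrival_ind_eq_of_bool:
  assumes \<omega>: "\<omega> \<in> space M" and c: "initial_number (Q \<omega>) = c" and m: "0 < m" "m \<le> c + k"
  shows "arrival_ind c m k T \<omega> = of_bool (customer_epoch (Q \<omega>) (c + k) \<le> T \<and>
    service_start (Q \<omega>) (c + k - m) \<le> customer_epoch (Q \<omega>) (c + k) \<and>
    customer_epoch (Q \<omega>) (c + k) < service_end (Q \<omega>) (c + k - m))"
  using number_found_eq_iff[OF valid[OF \<omega>] m(1) c, of k] customer_epoch_arrival[of "Q \<omega>" k] c m
  by (auto simp: arrival_ind_def)

lemma arrival_ind_0_eq_of_bool: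
  assumes \<omega>: "\<omega> \<in> space M" and c: "initial_number (Q \<omega>) = c"
  shows "arrival_ind c 0 (Suc k) T \<omega> = of_bool (customer_epoch (Q \<omega>) (Suc (c + k)) \<le> T \<and>
    service_end (Q \<omega>) (c + k) \<le> customer_epoch (Q \<omega>) (Suc (c + k)))"
proof -
  have e: "arrival_epoch (Q \<omega>) (Suc k) = customer_epoch (Q \<omega>) (Suc (c + k))"
    using customer_epoch_arrival[of "Q \<omega>" "Suc k"] c by simp
  have "number_found (Q \<omega>) (Suc k) = 0 \<longleftrightarrow> service_end (Q \<omega>) (c + k) \<le> customer_epoch (Q \<omega>) (Suc (c + k))"
  proof -
    have "(\<forall>j<c + Suc k. service_end (Q \<omega>) j \<le> x) \<longleftrightarrow> service_end (Q \<omega>) (c + k) \<le> x" for x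
      using mono_service_end[OF valid[OF \<omega>], of _ "c + k"]
      by (metis add_Suc_right less_Suc_eq_le order_refl order_trans)
    then show ?thesis using number_found_eq_0_iff[OF c, of "Suc k"] by simp
  qed
  then show ?thesis using c e by (auto simp: arrival_ind_def)
qed

lemma discounted_arrival_bounds:
  assumes \<omega>: "\<omega> \<in> space M" and "0 \<le> \<theta>" "0 < m"
  shows "0 \<le> discounted_arrival c m k \<theta> T \<omega>" "discounted_arrival c m k \<theta> T \<omega> \<le> arrival_ind c m k T \<omega>"
    "discounted_arrival c m k \<theta> T \<omega> \<le> 1"
proof -
  show "0 \<le> discounted_arrival c m k \<theta> T \<omega>" by (simp add: discounted_arrival_def arrival_ind_def residual_discount_def)
  show le: "discounted_arrival c m k \<theta> T \<omega> \<le> arrival_ind c m k T \<omega>"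
  proof (cases "arrival_ind c m k T \<omega> = 0")
    case False
    then have c: "initial_number (Q \<omega>) = c" and f: "number_found (Q \<omega>) k = m" by (auto simp: arrival_ind_def split: if_splits)
    have "arrival_epoch (Q \<omega>) k \<le> service_end (Q \<omega>) (c + k - m)"
      using number_found_eq_iff[OF valid[OF \<omega>] assms(3) c, of k] f customer_epoch_arrival[of "Q \<omega>" k] c by auto
    then have "residual_discount (c + k) m \<theta> \<omega> (arrival_epoch (Q \<omega>) k) \<le> 1" using assms(2) by (simp add: residual_discount_def)
    then show ?thesis using arrival_ind_bounds(1)[of c m k T \<omega>]
      unfolding discounted_arrival_def by (simp add: mult_left_le)
  qed (simp add: discounted_arrival_def)
  then show "discounted_arrival c m k \<theta> T \<omega> \<le> 1" using arrival_ind_bounds(2) order_trans by blast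
qed

lemma discounted_arrival_measurable [measurable]: "discounted_arrival c m k \<theta> T \<in> borel_measurable M"
  unfolding discounted_arrival_def[abs_def] residual_discount_def by measurable

lemma departure_ind_measurable [measurable]: "departure_ind c n j T \<in> borel_measurable M"
proof -
  have "(\<lambda>\<omega>. if initial_number (Q \<omega>) = c \<and> service_end (Q \<omega>) j \<le> T \<and>
     (2 \<le> n \<longrightarrow> customer_epoch (Q \<omega>) (j + n - 1) < service_end (Q \<omega>) j) \<and>
     service_end (Q \<omega>) j \<le> customer_epoch (Q \<omega>) (j + n) then 1 else (0::real)) \<in> borel_measurable M"
    by measurable
  then show ?thesis by (simp add: departure_ind_def[abs_def] of_bool_def)
qed

lemma departure_ind_bounds: "0 \<le> departure_ind c n j T \<omega>" "departure_ind c n j T \<omega> \<le> 1"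
  by (auto simp: departure_ind_def)

lemma customer_interval_unique:
  assumes "valid_path q" "customer_epoch q i \<le> T" "T < customer_epoch q (Suc i)"
    "customer_epoch q j \<le> T" "T < customer_epoch q (Suc j)"
  shows "i = j"
  using mono_customer_epoch[OF assms(1), of "Suc i" j] mono_customer_epoch[OF assms(1), of "Suc j" i] assms
  by (cases i j rule: linorder_cases) auto

text \<open>
The number in system moves by single steps, so it crosses between \<open>n - 1\<close> and \<open>n\<close> alternately
upwards and downwards.  In the sum over services the differences telescope, apart from one term for
the service at the horizon.  The offset \<open>\<delta>\<close> allows the sum to begin at service \<open>c\<close> or at service \<open>c + 1\<close>.
\<close>

lemma level_crossing:
  assumes \<omega>: "\<omega> \<in> space M" and n: "1 \<le> n"
  shows "\<bar>(\<Sum>l<B. departure_ind c n (c + \<delta> + l) T \<omega>) - (\<Sum>l<B. arrival_ind c (n - 1) (l + (\<delta> + n)) T \<omega>)\<bar> \<le> 2"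
proof (cases "initial_number (Q \<omega>) = c")
  case c: True
  note v = valid[OF \<omega>]
  let ?e = "customer_epoch (Q \<omega>)" and ?d = "service_end (Q \<omega>)"
  let ?j = "\<lambda>l. c + \<delta> + l"
  \<comment> \<open>the correction at the horizon; \<open>T\<close> lies between the epochs of just one pair of successive customers\<close>
  let ?P = "\<lambda>l. ?d (?j l) \<le> T \<and> ?e (?j l + n - 1) \<le> T \<and> T < ?e (?j l + n)"
  have unique: "i = j" if "?P i" "?P j" for i j
    using customer_interval_unique[OF v, of "?j i + n - 1" T "?j j + n - 1"] that n by simp
  have sumP: "0 \<le> (\<Sum>l<B. of_bool (?P l) :: real)" "(\<Sum>l<B. of_bool (?P l) :: real) \<le> 1"
    by (rule sum_nonneg, simp) (rule sum_of_bool_le_1, rule unique)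
  show ?thesis
  proof (cases "2 \<le> n")
    case True
    let ?z = "\<lambda>j. of_bool (?d j \<le> ?e (j + n - 1) \<and> ?e (j + n - 1) \<le> T) :: real"
    have "departure_ind c n (?j l) T \<omega> - arrival_ind c (n - 1) (l + (\<delta> + n)) T \<omega> =
      of_bool (?P l) + (?z (?j (Suc l)) - ?z (?j l))" for l
    proof -
      have idx: "c + (l + (\<delta> + n)) = ?j l + n" "c + (l + (\<delta> + n)) - (n - 1) = Suc (?j l)"
        using True by auto
      have "?e (Suc (?j l)) \<le> ?e (?j l + n)" using True by (intro mono_customer_epoch[OF v]) auto
      then have st: "service_start (Q \<omega>) (Suc (?j l)) \<le> ?e (?j l + n) \<longleftrightarrow> ?d (?j l) \<le> ?e (?j l + n)"
        by (simp add: service_start_Suc)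
      have side: "0 < n - 1" "n - 1 \<le> c + (l + (\<delta> + n))" using True by auto
      have h: "arrival_ind c (n - 1) (l + (\<delta> + n)) T \<omega> =
        of_bool (?e (?j l + n) \<le> T \<and> ?d (?j l) \<le> ?e (?j l + n) \<and> ?e (?j l + n) < ?d (Suc (?j l)))"
        unfolding arrival_ind_eq_of_bool[OF \<omega> c side] unfolding idx(2) unfolding idx(1) st ..
      have dh: "departure_ind c n (?j l) T \<omega> =
        of_bool (?d (?j l) \<le> T \<and> ?e (?j l + n - 1) < ?d (?j l) \<and> ?d (?j l) \<le> ?e (?j l + n))"
        using True c by (simp add: departure_ind_def)
      have le: "?d (?j l) \<le> ?d (Suc (?j l))" "?e (?j l + n - 1) \<le> ?e (?j l + n)"
        by (auto intro: mono_service_end[OF v] mono_customer_epoch[OF v])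
      have "?j (Suc l) + n - 1 = ?j l + n" "?j (Suc l) = Suc (?j l)" by auto
      then show ?thesis unfolding h dh level_crossing_telescope[OF le] by simp
    qed
    then have "(\<Sum>l<B. departure_ind c n (?j l) T \<omega>) - (\<Sum>l<B. arrival_ind c (n - 1) (l + (\<delta> + n)) T \<omega>) =
      (\<Sum>l<B. of_bool (?P l)) + (?z (?j B) - ?z (?j 0))"
      unfolding sum_subtractf[symmetric]
      by (simp only: sum.distrib sum_lessThan_telescope[of "\<lambda>l. ?z (?j l)"])
    moreover have "\<bar>?z (?j B) - ?z (?j 0)\<bar> \<le> 1" by simp
    ultimately show ?thesis using sumP by linarith
  next
    case False
    then have n1: "n = 1" using n by simp
    have "departure_ind c n (?j l) T \<omega> - arrival_ind c (n - 1) (l + (\<delta> + n)) T \<omega> = of_bool (?P l)" for l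
    proof -
      have h: "arrival_ind c (n - 1) (l + (\<delta> + n)) T \<omega> = of_bool (?e (Suc (?j l)) \<le> T \<and> ?d (?j l) \<le> ?e (Suc (?j l)))"
        using arrival_ind_0_eq_of_bool[OF \<omega> c, of "\<delta> + l" T] n1 by (simp add: add_ac)
      have "?e (?j l) \<le> ?d (?j l)" by (rule customer_epoch_le_end[OF v])
      then show ?thesis unfolding h using n1 c by (auto simp: departure_ind_def of_bool_def)
    qed
    then have "(\<Sum>l<B. departure_ind c n (?j l) T \<omega>) - (\<Sum>l<B. arrival_ind c (n - 1) (l + (\<delta> + n)) T \<omega>) =
      (\<Sum>l<B. of_bool (?P l))"
      unfolding sum_subtractf[symmetric] by simp
    then show ?thesis using sumP by linarith
  qed
qed (simp add: departure_ind_def arrival_ind_def)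

definition no_ties :: "'a \<Rightarrow> bool" where
  "no_ties \<omega> \<longleftrightarrow> (\<forall>k. \<forall>j<initial_number (Q \<omega>) + k. service_end (Q \<omega>) j \<noteq> arrival_epoch (Q \<omega>) k)"

lemma no_ties_end:
  assumes "no_ties \<omega>" "initial_number (Q \<omega>) \<le> i" "j < i"
  shows "service_end (Q \<omega>) j \<noteq> customer_epoch (Q \<omega>) i"
  using assms by (auto simp: no_ties_def customer_epoch_def dest: spec[of _ "i - initial_number (Q \<omega>)"])

lemma no_ties_start:
  assumes \<omega>: "\<omega> \<in> space M" and nt: "no_ties \<omega>" "initial_number (Q \<omega>) \<le> i" "Suc j < i"
  shows "service_start (Q \<omega>) (Suc j) \<noteq> customer_epoch (Q \<omega>) i"
  using no_ties_end[OF nt(1,2), of j] customer_epoch_strict[OF valid[OF \<omega>], of "Suc j" i] nt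
  by (auto simp: service_start_Suc max_def)

text \<open>
A service starts when the preceding one ends, with the customers left behind, or on the arrival of its customer to an
empty system.  The second case leads to level 1.
\<close>

lemma starts_from_departures:
  assumes \<omega>: "\<omega> \<in> space M" and nt: "no_ties \<omega>" and n: "1 \<le> n"
  shows "start_ind c n (Suc (c + l)) T \<omega> =
    departure_ind c (Suc n) (c + l) T \<omega> + (if n = 1 then arrival_ind c 0 (Suc l) T \<omega> else 0)"
proof (cases "initial_number (Q \<omega>) = c")
  case c: True
  note v = valid[OF \<omega>]
  let ?e = "customer_epoch (Q \<omega>)" and ?d = "service_end (Q \<omega>) (c + l)" and ?j = "Suc (c + l)"
  have sh: "start_ind c n ?j T \<omega> = of_bool (max ?d (?e ?j) \<le> T \<and> ?e (?j + n - 1) \<le> max ?d (?e ?j) \<and>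
      max ?d (?e ?j) < ?e (?j + n))"
    using number_at_start_eq_iff[OF v, of n ?j] n c by (simp add: start_ind_def service_start_Suc)
  have dh: "departure_ind c (Suc n) (c + l) T \<omega> = of_bool (?d \<le> T \<and> ?e (?j + n - 1) < ?d \<and> ?d \<le> ?e (?j + n))"
    using n c by (simp add: departure_ind_def)
  have t1: "?d \<noteq> ?e (?j + n)" "?d \<noteq> ?e (?j + n - 1)"
    using no_ties_end[OF nt] c n by auto
  have lt: "?e (?j + n - 1) < ?e (?j + n)" using customer_epoch_strict[OF v, of "?j + n - 1" "?j + n"] n c by simp
  show ?thesis
  proof (cases "n = 1")
    case True
    have h: "arrival_ind c 0 (Suc l) T \<omega> = of_bool (?e ?j \<le> T \<and> ?d \<le> ?e ?j)"
      using arrival_ind_0_eq_of_bool[OF \<omega> c, of l T] by simp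
    show ?thesis using True t1 lt unfolding sh dh h by (auto simp: of_bool_def max_def)
  next
    case False
    have "?e ?j < ?e (?j + n - 1)" using customer_epoch_strict[OF v, of ?j "?j + n - 1"] n False c by simp
    then show ?thesis using False t1 lt unfolding sh dh by (auto simp: of_bool_def max_def)
  qed
qed (simp add: start_ind_def departure_ind_def arrival_ind_def)

text \<open>
The growth, up to time \<open>T\<close>, of the weight at level \<open>n\<close> while arrival \<open>k\<close> is awaited.
\<close>

definition phase_integral :: "nat \<Rightarrow> nat \<Rightarrow> nat \<Rightarrow> real \<Rightarrow> 'a \<Rightarrow> real" where
  "phase_integral c n k T \<omega> = rate n * (LINT s:{0..T}|lborel.
     (if awaiting c k (Q \<omega>) s \<and> number_in_system (Q \<omega>) s = n then residual_discount (c + k) n (rate n) \<omega> s else 0))"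

text \<open>
The weight at time \<open>T\<close>, if service \<open>j\<close> is then in progress at level \<open>n\<close>.
\<close>

definition unfinished :: "nat \<Rightarrow> nat \<Rightarrow> nat \<Rightarrow> real \<Rightarrow> 'a \<Rightarrow> real" where
  "unfinished c n j T \<omega> = of_bool (initial_number (Q \<omega>) = c \<and>
      max (service_start (Q \<omega>) j) (customer_epoch (Q \<omega>) (j + n - 1)) \<le> T \<and>
      T < min (service_end (Q \<omega>) j) (customer_epoch (Q \<omega>) (j + n))) * exp (- rate n * (service_end (Q \<omega>) j - T))"

text \<open>
Specialises \<open>phase_identity\<close> to service \<open>c + l + 1\<close>.  Customers \<open>c, c + 1, \<dots>\<close> are those who arrive after time 0, so the
level is entered by arrival number \<open>l + n\<close> and left by arrival number \<open>l + n + 1\<close>.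
\<close>

lemma phase_balance:
  assumes \<omega>: "\<omega> \<in> space M" and nt: "no_ties \<omega>" and n: "1 \<le> n"
  shows "start_ind c n (Suc (c + l)) T \<omega> * exp (- rate n * service_duration (Q \<omega>) (Suc (c + l)))
      + (if 2 \<le> n then discounted_arrival c (n - 1) (l + n) (rate n) T \<omega> else 0)
      - departure_ind c n (Suc (c + l)) T \<omega> - unfinished c n (Suc (c + l)) T \<omega>
    = discounted_arrival c n (Suc (l + n)) (rate n) T \<omega> - phase_integral c n (Suc (l + n)) T \<omega>"
proof (cases "initial_number (Q \<omega>) = c")
  case c: True
  note v = valid[OF \<omega>]
  define j where "j = Suc (c + l)"
  define p where "p = customer_epoch (Q \<omega>) (j + n - 1)"
  define r where "r = customer_epoch (Q \<omega>) (j + n)"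
  define s where "s = service_start (Q \<omega>) j"
  define d where "d = service_end (Q \<omega>) j"
  define \<theta> where "\<theta> = rate n"
  have pr: "p < r" unfolding p_def r_def using customer_epoch_strict[OF v, of "j + n - 1" "j + n"] n c by (simp add: j_def)
  have sd: "s \<le> d" unfolding s_def d_def by (rule service_start_le_end[OF v])
  have sr: "s \<noteq> r" unfolding s_def r_def j_def by (rule no_ties_start[OF \<omega> nt]) (use n c in auto)
  have dr: "d \<noteq> r" unfolding d_def r_def by (rule no_ties_end[OF nt]) (use n c in \<open>auto simp: j_def\<close>)
  have w: "s \<noteq> p \<and> d \<noteq> p" if "2 \<le> n"
    unfolding s_def p_def d_def using no_ties_start[OF \<omega> nt, of "j + n - 1" "c + l"] no_ties_end[OF nt, of "j + n - 1" j] that c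
    by (auto simp: j_def)
  have nw: "p \<le> s" if "\<not> 2 \<le> n"
  proof -
    have "n = 1" using that n by simp
    then show ?thesis unfolding p_def s_def using customer_epoch_le_start[of "Q \<omega>" j] by simp
  qed
  have p0: "0 \<le> p" unfolding p_def by (rule customer_epoch_nonneg[OF v])
  have idx: "c + (l + n) = j + n - 1" "c + Suc (l + n) = j + n" using n by (auto simp: j_def)
  have ep: "arrival_epoch (Q \<omega>) (l + n) = p" "arrival_epoch (Q \<omega>) (Suc (l + n)) = r"
    using customer_epoch_arrival[of "Q \<omega>" "l + n"] customer_epoch_arrival[of "Q \<omega>" "Suc (l + n)"] c
    unfolding p_def r_def idx[symmetric] by auto
  have 1: "start_ind c n j T \<omega> = of_bool (s \<le> T \<and> p \<le> s \<and> s < r)"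
    using number_at_start_eq_iff[OF v, of n j] n c by (simp add: start_ind_def s_def p_def r_def j_def)
  have dur: "service_duration (Q \<omega>) j = d - s" by (simp add: d_def s_def service_end_def)
  have 2: "(if 2 \<le> n then discounted_arrival c (n - 1) (l + n) \<theta> T \<omega> else 0) =
    of_bool (2 \<le> n \<and> p \<le> T \<and> s \<le> p \<and> p < d) * exp (- \<theta> * (d - p))"
  proof (cases "2 \<le> n")
    case True
    have i: "c + (l + n) - (n - 1) = j" using True by (simp add: j_def)
    have "arrival_ind c (n - 1) (l + n) T \<omega> = of_bool (p \<le> T \<and> s \<le> p \<and> p < d)"
      using arrival_ind_eq_of_bool[OF \<omega> c, of "n - 1" "l + n" T] True unfolding i idx p_def s_def d_def by simp
    then show ?thesis using True i ep by (simp add: discounted_arrival_def residual_discount_def d_def)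
  qed simp
  have i: "c + Suc (l + n) - n = j" by (simp add: j_def)
  have 3: "departure_ind c n j T \<omega> = of_bool (d \<le> T \<and> (2 \<le> n \<longrightarrow> p < d) \<and> d \<le> r)"
    using c by (simp add: departure_ind_def d_def p_def r_def)
  have 4: "unfinished c n j T \<omega> = of_bool (max s p \<le> T \<and> T < min d r) * exp (- \<theta> * (d - T))"
    using c by (simp add: unfinished_def s_def d_def p_def r_def \<theta>_def)
  have 5: "discounted_arrival c n (Suc (l + n)) \<theta> T \<omega> = of_bool (r \<le> T \<and> s \<le> r \<and> r < d) * exp (- \<theta> * (d - r))"
  proof -
    have "arrival_ind c n (Suc (l + n)) T \<omega> = of_bool (r \<le> T \<and> s \<le> r \<and> r < d)"
      using arrival_ind_eq_of_bool[OF \<omega> c, of n "Suc (l + n)" T] n unfolding i idx r_def s_def d_def by simp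
    then show ?thesis using i ep by (simp add: discounted_arrival_def residual_discount_def d_def)
  qed
  have 6: "phase_integral c n (Suc (l + n)) T \<omega> = (if max s p < min (min d r) T
         then exp (- \<theta> * (d - min (min d r) T)) - exp (- \<theta> * (d - max s p)) else 0)"
  proof -
    have "(if awaiting c (Suc (l + n)) (Q \<omega>) t \<and> number_in_system (Q \<omega>) t = n
        then residual_discount (c + Suc (l + n)) n \<theta> \<omega> t else 0) =
      (if max s p \<le> t \<and> t < min d r then exp (- \<theta> * (d - t)) else 0)" for t
    proof -
      have aw: "awaiting c (Suc (l + n)) (Q \<omega>) t \<longleftrightarrow> p \<le> t \<and> t < r"
        using c ep p0 by (auto simp: awaiting_def)
      have "number_in_system (Q \<omega>) t = n \<longleftrightarrow> s \<le> t \<and> t < d" if "p \<le> t \<and> t < r"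
        using number_in_system_eq_iff[OF v _ aw[THEN iffD2, OF that], of n] n unfolding i s_def d_def by simp
      moreover have "residual_discount (c + Suc (l + n)) n \<theta> \<omega> t = exp (- \<theta> * (d - t))" by (simp only: residual_discount_def i d_def)
      ultimately show ?thesis unfolding aw by auto
    qed
    then have "phase_integral c n (Suc (l + n)) T \<omega> =
      \<theta> * (LINT t:{0..T}|lborel. (if max s p \<le> t \<and> t < min d r then exp (- \<theta> * (d - t)) else 0))"
      unfolding phase_integral_def \<theta>_def by simp
    also have "\<dots> = (if max s p < min (min d r) T
         then exp (- \<theta> * (d - min (min d r) T)) - exp (- \<theta> * (d - max s p)) else 0)"
      by (rule set_integral_exp_phase) (use p0 in simp)
    finally show ?thesis .
  qed
  show ?thesis
    unfolding j_def[symmetric] \<theta>_def[symmetric] 1 2 3 4 5 6 dur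
    by (rule phase_identity[OF pr sd sr dr w nw])
qed (simp add: start_ind_def discounted_arrival_def arrival_ind_def departure_ind_def unfinished_def phase_integral_def
      awaiting_def set_lebesgue_integral_def)

lemma sum_unfinished_bounds:
  assumes \<omega>: "\<omega> \<in> space M"
  shows "0 \<le> (\<Sum>l<B. unfinished c n (Suc (c + l)) T \<omega>)" "(\<Sum>l<B. unfinished c n (Suc (c + l)) T \<omega>) \<le> 1"
proof -
  let ?P = "\<lambda>l. service_start (Q \<omega>) (Suc (c + l)) \<le> T \<and> T < service_end (Q \<omega>) (Suc (c + l))"
  show "0 \<le> (\<Sum>l<B. unfinished c n (Suc (c + l)) T \<omega>)" by (intro sum_nonneg) (simp add: unfinished_def)
  have "(\<Sum>l<B. unfinished c n (Suc (c + l)) T \<omega>) \<le> (\<Sum>l<B. of_bool (?P l))"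
    using rate_pos[of n] by (intro sum_mono) (auto simp: unfinished_def)
  also have "\<dots> \<le> 1"
  proof (rule sum_of_bool_le_1)
    fix i j assume "?P i" "?P j"
    then show "i = j" using service_in_progress_unique[OF valid[OF \<omega>], of "Suc (c + i)" T "Suc (c + j)"] by simp
  qed
  finally show "(\<Sum>l<B. unfinished c n (Suc (c + l)) T \<omega>) \<le> 1" .
qed

end

section \<open>The balance in expectation\<close>

lemma (in prob_space) expectation_close:
  fixes f g :: "'a \<Rightarrow> real"
  assumes f: "integrable M f" and g: "integrable M g" and le: "AE \<omega> in M. \<bar>f \<omega> - g \<omega>\<bar> \<le> K"
  shows "\<bar>(\<integral>\<omega>. f \<omega> \<partial>M) - (\<integral>\<omega>. g \<omega> \<partial>M)\<bar> \<le> K"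
proof -
  have "\<bar>\<integral>\<omega>. f \<omega> - g \<omega> \<partial>M\<bar> \<le> (\<integral>\<omega>. \<bar>f \<omega> - g \<omega>\<bar> \<partial>M)" by (rule integral_abs_bound)
  also have "\<dots> \<le> (\<integral>\<omega>. K \<partial>M)"
    by (rule integral_mono_AE) (use f g le in auto)
  finally show ?thesis using f g by (simp add: prob_space)
qed

context Mn_Gn_1_queue begin

lemma no_ties_AE: "AE \<omega> in M. no_ties \<omega>"
  using completion_arrival_ties_null by (simp add: no_ties_def)

text \<open>
On average arrivals remove as much weight as its growth produces.  This cancellation
determines the discount rate \<open>rate n\<close>.
\<close>

lemma discounted_arrival_integral:
  assumes T: "0 \<le> T" and n: "1 \<le> n"
  shows "integrable M (phase_integral c n k T)"
    and "(\<integral>\<omega>. discounted_arrival c n k (rate n) T \<omega> \<partial>M) = (\<integral>\<omega>. phase_integral c n k T \<omega> \<partial>M)"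
proof -
  have "(\<lambda>\<omega>. if awaiting c k (Q \<omega>) t then 1 else (0::real)) \<in> borel_measurable (past M Q t)" for t
    by measurable
  note comp = expected_marked_arrival[of "rate n" n "\<lambda>_. 1" 1 c k T, OF _ _ _ _ this T]
  let ?f = "\<lambda>s \<omega>. if awaiting c k (Q \<omega>) s \<and> number_in_system (Q \<omega>) s = n then residual_discount (c + k) n (rate n) \<omega> s else 0"
  have fm: "(\<lambda>(s, \<omega>). ?f s \<omega>) \<in> borel_measurable (borel \<Otimes>\<^sub>M M)"
    using comp(2) rate_pos[of n] n by (simp add: less_imp_le cong: if_cong)
  have fb: "0 \<le> ?f s \<omega>" "?f s \<omega> \<le> 1" if "\<omega> \<in> space M" for s \<omega>
  proof -
    show "0 \<le> ?f s \<omega>" by (simp add: residual_discount_def)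
    show "?f s \<omega> \<le> 1"
      using number_in_system_eq_iff[OF valid[OF that], of n c k s] n rate_pos[of n] by (auto simp: residual_discount_def)
  qed
  show "integrable M (phase_integral c n k T)"
  proof (rule integrable_bounded[where B = "rate n * T"])
    show "phase_integral c n k T \<in> borel_measurable M"
      unfolding phase_integral_def[abs_def]
      by (intro borel_measurable_times borel_measurable_const borel_measurable_set_integral_Icc[OF fm])
    fix \<omega> assume \<omega>: "\<omega> \<in> space M"
    have "set_integrable lborel {0..T} (\<lambda>s. ?f s \<omega>)"
      by (rule set_integrable_Icc_bounded[where B = 1, OF borel_measurable_section[OF fm \<omega>]])
         (use fb[OF \<omega>] in \<open>simp add: abs_of_nonneg\<close>)
    from set_integral_Icc_bounds[OF this fb(1)[OF \<omega>] fb(2)[OF \<omega>] T]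
    show "\<bar>phase_integral c n k T \<omega>\<bar> \<le> rate n * T"
      using rate_pos[of n] by (simp add: phase_integral_def abs_mult mult_left_mono)
  qed
  have "(\<integral>\<omega>. discounted_arrival c n k (rate n) T \<omega> \<partial>M) =
    (\<integral>\<omega>. (if initial_number (Q \<omega>) = c \<and> arrival_epoch (Q \<omega>) k \<le> T \<and> number_found (Q \<omega>) k = n
            then 1 * residual_discount (c + k) n (rate n) \<omega> (arrival_epoch (Q \<omega>) k) else 0) \<partial>M)"
    by (intro Bochner_Integration.integral_cong refl) (simp add: discounted_arrival_def arrival_ind_def)
  also have "\<dots> = rate n * (\<integral>\<omega>. (LINT s:{0..T}|lborel. ?f s \<omega>) \<partial>M)"
    using comp(1) rate_pos[of n] n by (simp add: less_imp_le cong: if_cong)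
  also have "\<dots> = (\<integral>\<omega>. phase_integral c n k T \<omega> \<partial>M)" by (simp add: phase_integral_def[abs_def])
  finally show "(\<integral>\<omega>. discounted_arrival c n k (rate n) T \<omega> \<partial>M) = (\<integral>\<omega>. phase_integral c n k T \<omega> \<partial>M)" .
qed

text \<open>
Summing \<open>phase_balance\<close> over the services and taking expectations cancels growth against removal by arrivals; then
\<open>starts_from_departures\<close> and \<open>level_crossing\<close> express starts and departures by arrivals.  The bound on the
error comes from the horizon and from shifts of the index range, and depends neither on \<open>T\<close> nor on the number \<open>B\<close>
of arrivals considered, so it disappears after division by the length of time.
\<close>

lemma expected_balance_bounded:
  assumes n: "1 \<le> n" and T: "0 \<le> T"
  shows "\<bar>LST (G n) (rate n) * ((\<integral>\<omega>. (\<Sum>k<B. arrival_ind c n k T \<omega>) \<partial>M) +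
        (if n = 1 then (\<integral>\<omega>. (\<Sum>k<B. arrival_ind c 0 k T \<omega>) \<partial>M) else 0))
      + (if 2 \<le> n then (\<integral>\<omega>. (\<Sum>k<B. discounted_arrival c (n - 1) k (rate n) T \<omega>) \<partial>M) else 0)
      - (\<integral>\<omega>. (\<Sum>k<B. arrival_ind c (n - 1) k T \<omega>) \<partial>M)\<bar> \<le> 3 * real n + 8"
proof -
  define g where "g = LST (G n) (rate n)"
  have g: "0 \<le> g" "g \<le> 1" using LST_bounds[OF n, of "rate n"] rate_pos[of n] by (auto simp: g_def)
  \<comment> \<open>index \<open>l\<close> stands for service \<open>c + l + 1\<close>, which is not in progress at time 0, so that the service law holds\<close>
  define x1 where "x1 = (\<lambda>l. start_ind c n (Suc (c + l)) T)"
  define xs where "xs = (\<lambda>l \<omega>. start_ind c n (Suc (c + l)) T \<omega> * exp (- rate n * service_duration (Q \<omega>) (Suc (c + l))))"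
  define dm where "dm = (\<lambda>l \<omega>. if 2 \<le> n then discounted_arrival c (n - 1) (l + n) (rate n) T \<omega> else 0)"
  define cp where "cp = (\<lambda>l. departure_ind c n (Suc (c + l)) T)"
  define dn where "dn = (\<lambda>l. discounted_arrival c n (Suc (l + n)) (rate n) T)"
  define ph where "ph = (\<lambda>l. phase_integral c n (Suc (l + n)) T)"
  have th: "0 \<le> rate n" using rate_pos[of n] by simp
  have ix1: "integrable M (x1 l)" for l
    unfolding x1_def by (rule integrable_bounded[where B = 1]) (auto simp: start_ind_bounds abs_of_nonneg)
  have ixs: "integrable M (xs l)" for l
  proof (rule integrable_bounded[where B = 1])
    show "xs l \<in> borel_measurable M" unfolding xs_def by measurable
    fix \<omega> assume "\<omega> \<in> space M"
    then have "exp (- rate n * service_duration (Q \<omega>) (Suc (c + l))) \<le> 1"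
      using th service_duration_nonneg by simp
    then show "\<bar>xs l \<omega>\<bar> \<le> 1"
      unfolding xs_def abs_mult using start_ind_bounds[of c n "Suc (c + l)" T \<omega>]
      by (intro mult_le_one) auto
  qed
  have idm: "integrable M (dm l)" for l
  proof (rule integrable_bounded[where B = 1])
    show "dm l \<in> borel_measurable M" unfolding dm_def by measurable
    show "\<bar>dm l \<omega>\<bar> \<le> 1" if "\<omega> \<in> space M" for \<omega>
      using discounted_arrival_bounds[OF that th, of "n - 1" c "l + n" T] by (simp add: dm_def)
  qed
  have idisc: "integrable M (discounted_arrival c m k (rate n) T)" if "0 < m" for m k
    by (rule integrable_bounded[where B = 1])
       (use discounted_arrival_bounds[OF _ th that] in \<open>auto simp: abs_of_nonneg\<close>)
  have idn: "integrable M (dn l)" for l unfolding dn_def using n by (intro idisc) simp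
  have icp: "integrable M (cp l)" for l
    unfolding cp_def by (rule integrable_bounded[where B = 1]) (auto simp: departure_ind_bounds abs_of_nonneg)
  have iph: "integrable M (ph l)" for l unfolding ph_def by (rule discounted_arrival_integral(1)[OF T n])
  define X1 where "X1 = (\<lambda>\<omega>. \<Sum>l<B. x1 l \<omega>)"
  define Dm where "Dm = (\<lambda>\<omega>. \<Sum>l<B. dm l \<omega>)"
  define Cp where "Cp = (\<lambda>\<omega>. \<Sum>l<B. cp l \<omega>)"
  define H where "H = (\<lambda>m \<omega>. \<Sum>k<B. arrival_ind c m k T \<omega>)"
  define U where "U = (\<lambda>\<omega>. \<Sum>k<B. discounted_arrival c (n - 1) k (rate n) T \<omega>)"
  have iX1: "integrable M X1" and iDm: "integrable M Dm" and iCp: "integrable M Cp" and iH: "integrable M (H m)" for m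
    unfolding X1_def Dm_def Cp_def H_def
    by (intro Bochner_Integration.integrable_sum ix1 idm icp integrable_arrival_ind)+
  have main: "\<bar>g * (\<integral>\<omega>. X1 \<omega> \<partial>M) + (\<integral>\<omega>. Dm \<omega> \<partial>M) - (\<integral>\<omega>. Cp \<omega> \<partial>M)\<bar> \<le> 1"
  proof -
    let ?F = "\<lambda>\<omega>. \<Sum>l<B. xs l \<omega> + dm l \<omega> - cp l \<omega> - (dn l \<omega> - ph l \<omega>)"
    have il: "integrable M (\<lambda>\<omega>. xs l \<omega> + dm l \<omega> - cp l \<omega> - (dn l \<omega> - ph l \<omega>))" for l
      by (intro Bochner_Integration.integrable_add Bochner_Integration.integrable_diff ixs idm icp idn iph)
    have "\<bar>(\<integral>\<omega>. ?F \<omega> \<partial>M) - (\<integral>\<omega>. 0 \<partial>M)\<bar> \<le> 1"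
    proof (rule expectation_close)
      show "AE \<omega> in M. \<bar>?F \<omega> - 0\<bar> \<le> 1"
        using no_ties_AE AE_space
      proof eventually_elim
        case (elim \<omega>)
        have "?F \<omega> = (\<Sum>l<B. unfinished c n (Suc (c + l)) T \<omega>)"
          using phase_balance[OF elim(2,1) n, of c _ T]
          by (intro sum.cong refl) (simp add: xs_def dm_def cp_def dn_def ph_def algebra_simps)
        then show ?case using sum_unfinished_bounds[OF elim(2), of c n T B] by simp
      qed
    qed (auto intro!: Bochner_Integration.integrable_sum il)
    moreover have "(\<integral>\<omega>. ?F \<omega> \<partial>M) = (\<Sum>l<B. g * (\<integral>\<omega>. x1 l \<omega> \<partial>M) + (\<integral>\<omega>. dm l \<omega> \<partial>M) - (\<integral>\<omega>. cp l \<omega> \<partial>M))"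
    proof -
      have "(\<integral>\<omega>. xs l \<omega> + dm l \<omega> - cp l \<omega> - (dn l \<omega> - ph l \<omega>) \<partial>M) =
        g * (\<integral>\<omega>. x1 l \<omega> \<partial>M) + (\<integral>\<omega>. dm l \<omega> \<partial>M) - (\<integral>\<omega>. cp l \<omega> \<partial>M)" for l
      proof -
        have "(\<integral>\<omega>. xs l \<omega> + dm l \<omega> - cp l \<omega> - (dn l \<omega> - ph l \<omega>) \<partial>M) =
          (\<integral>\<omega>. xs l \<omega> \<partial>M) + (\<integral>\<omega>. dm l \<omega> \<partial>M) - (\<integral>\<omega>. cp l \<omega> \<partial>M) - ((\<integral>\<omega>. dn l \<omega> \<partial>M) - (\<integral>\<omega>. ph l \<omega> \<partial>M))"
          using ixs[of l] idm[of l] icp[of l] idn[of l] iph[of l] by simp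
        moreover have "(\<integral>\<omega>. dn l \<omega> \<partial>M) = (\<integral>\<omega>. ph l \<omega> \<partial>M)"
          unfolding dn_def ph_def by (rule discounted_arrival_integral(2)[OF T n])
        moreover have "(\<integral>\<omega>. xs l \<omega> \<partial>M) = g * (\<integral>\<omega>. x1 l \<omega> \<partial>M)"
          unfolding xs_def x1_def g_def by (rule expected_discounted_start[OF n]) simp
        ultimately show ?thesis by simp
      qed
      then show ?thesis by (subst Bochner_Integration.integral_sum) (auto simp: il)
    qed
    moreover have "(\<Sum>l<B. g * (\<integral>\<omega>. x1 l \<omega> \<partial>M) + (\<integral>\<omega>. dm l \<omega> \<partial>M) - (\<integral>\<omega>. cp l \<omega> \<partial>M)) =
      g * (\<integral>\<omega>. X1 \<omega> \<partial>M) + (\<integral>\<omega>. Dm \<omega> \<partial>M) - (\<integral>\<omega>. Cp \<omega> \<partial>M)"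
      unfolding X1_def Dm_def Cp_def
      by (simp add: Bochner_Integration.integral_sum ix1 idm icp sum.distrib sum_subtractf sum_distrib_left)
    ultimately show ?thesis by simp
  qed
  have shift: "\<bar>(\<Sum>l<B. arrival_ind c m (l + d) T \<omega>) - H m \<omega>\<bar> \<le> real d" for m d \<omega>
    unfolding H_def by (rule sum_shift_close) (auto simp: arrival_ind_bounds)
  \<comment> \<open>2 from level crossing, \<open>n + 1\<close> from the index shift, 1 from the shift for arrivals that find an empty system\<close>
  have starts: "\<bar>(\<integral>\<omega>. X1 \<omega> \<partial>M) - (\<integral>\<omega>. H n \<omega> + (if n = 1 then H 0 \<omega> else 0) \<partial>M)\<bar> \<le> real n + 4"
  proof (rule expectation_close[OF iX1])
    show "integrable M (\<lambda>\<omega>. H n \<omega> + (if n = 1 then H 0 \<omega> else 0))"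
      using iH by (cases "n = 1") auto
    show "AE \<omega> in M. \<bar>X1 \<omega> - (H n \<omega> + (if n = 1 then H 0 \<omega> else 0))\<bar> \<le> real n + 4"
      using no_ties_AE AE_space
    proof eventually_elim
      case (elim \<omega>)
      have X1: "X1 \<omega> = (\<Sum>l<B. departure_ind c (Suc n) (c + 0 + l) T \<omega>) +
          (if n = 1 then (\<Sum>l<B. arrival_ind c 0 (l + 1) T \<omega>) else 0)"
        unfolding X1_def x1_def starts_from_departures[OF elim(2,1) n] by (simp add: sum.distrib)
      have 1: "\<bar>(\<Sum>l<B. departure_ind c (Suc n) (c + 0 + l) T \<omega>) - (\<Sum>l<B. arrival_ind c (Suc n - 1) (l + (0 + Suc n)) T \<omega>)\<bar> \<le> 2"
        by (rule level_crossing[OF elim(2)]) simp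
      have 2: "\<bar>(\<Sum>l<B. arrival_ind c (Suc n - 1) (l + (0 + Suc n)) T \<omega>) - H n \<omega>\<bar> \<le> real n + 1"
        using shift[of n "Suc n" \<omega>] by simp
      have 3: "\<bar>(if n = 1 then (\<Sum>l<B. arrival_ind c 0 (l + 1) T \<omega>) else 0) - (if n = 1 then H 0 \<omega> else 0)\<bar> \<le> 1"
        using shift[of 0 1 \<omega>] by simp
      show ?case unfolding X1 using 1 2 3 by linarith
    qed
  qed
  \<comment> \<open>2 from level crossing, \<open>n + 1\<close> from the index shift\<close>
  have deps: "\<bar>(\<integral>\<omega>. Cp \<omega> \<partial>M) - (\<integral>\<omega>. H (n - 1) \<omega> \<partial>M)\<bar> \<le> real n + 3"
  proof (rule expectation_close[OF iCp iH])
    show "AE \<omega> in M. \<bar>Cp \<omega> - H (n - 1) \<omega>\<bar> \<le> real n + 3"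
    proof (rule AE_I2)
      fix \<omega> assume \<omega>: "\<omega> \<in> space M"
      have "\<bar>Cp \<omega> - (\<Sum>l<B. arrival_ind c (n - 1) (l + (1 + n)) T \<omega>)\<bar> \<le> 2"
        using level_crossing[OF \<omega> n, of c 1 T B] by (simp add: Cp_def cp_def)
      then show "\<bar>Cp \<omega> - H (n - 1) \<omega>\<bar> \<le> real n + 3"
        using shift[of "n - 1" "1 + n" \<omega>] by linarith
    qed
  qed
  have disc: "\<bar>(\<integral>\<omega>. Dm \<omega> \<partial>M) - (if 2 \<le> n then (\<integral>\<omega>. U \<omega> \<partial>M) else 0)\<bar> \<le> real n"
  proof (cases "2 \<le> n")
    case True
    have "\<bar>(\<integral>\<omega>. Dm \<omega> \<partial>M) - (\<integral>\<omega>. U \<omega> \<partial>M)\<bar> \<le> real n"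
    proof (rule expectation_close[OF iDm])
      show "integrable M U" unfolding U_def by (intro Bochner_Integration.integrable_sum idisc) (use True in simp)
      show "AE \<omega> in M. \<bar>Dm \<omega> - U \<omega>\<bar> \<le> real n"
      proof (rule AE_I2)
        fix \<omega> assume \<omega>: "\<omega> \<in> space M"
        have "\<bar>(\<Sum>l<B. discounted_arrival c (n - 1) (l + n) (rate n) T \<omega>) - U \<omega>\<bar> \<le> real n"
          unfolding U_def
          by (rule sum_shift_close) (use discounted_arrival_bounds[OF \<omega> th, of "n - 1"] True in auto)
        then show "\<bar>Dm \<omega> - U \<omega>\<bar> \<le> real n" using True by (simp add: Dm_def dm_def)
      qed
    qed
    then show ?thesis using True by simp
  qed (simp add: Dm_def dm_def)
  have H_split: "(\<integral>\<omega>. H n \<omega> + (if n = 1 then H 0 \<omega> else 0) \<partial>M) = (\<integral>\<omega>. H n \<omega> \<partial>M) + (if n = 1 then (\<integral>\<omega>. H 0 \<omega> \<partial>M) else 0)"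
    using iH by (cases "n = 1") auto
  have "\<bar>g * (\<integral>\<omega>. X1 \<omega> \<partial>M) - g * ((\<integral>\<omega>. H n \<omega> \<partial>M) + (if n = 1 then (\<integral>\<omega>. H 0 \<omega> \<partial>M) else 0))\<bar> \<le> real n + 4"
    unfolding right_diff_distrib[symmetric] abs_mult 
    using mult_mono[OF _ starts[unfolded H_split], of "\<bar>g\<bar>" 1] g by simp
  moreover have "\<bar>b + u - h\<bar> \<le> 3 * K + 8"
    if "\<bar>a - b\<bar> \<le> K + 4" "\<bar>a + e - y\<bar> \<le> 1" "\<bar>y - h\<bar> \<le> K + 3" "\<bar>e - u\<bar> \<le> K" for a b e u y h K :: real
    using that by linarith
  ultimately have "\<bar>g * ((\<integral>\<omega>. H n \<omega> \<partial>M) + (if n = 1 then (\<integral>\<omega>. H 0 \<omega> \<partial>M) else 0))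
      + (if 2 \<le> n then (\<integral>\<omega>. U \<omega> \<partial>M) else 0) - (\<integral>\<omega>. H (n - 1) \<omega> \<partial>M)\<bar> \<le> 3 * real n + 8"
    using main deps disc by blast
  then show ?thesis unfolding g_def H_def U_def .
qed

end

section \<open>Long-run averages\<close>

lemma initial_segment_nat:
  fixes P :: "nat \<Rightarrow> bool"
  assumes "\<And>i j. i \<le> j \<Longrightarrow> P j \<Longrightarrow> P i"
  shows "\<exists>N. {k. k < K \<and> P k} = {..<N}"
proof (induction K)
  case 0
  show ?case by (rule exI[of _ 0]) simp
next
  case (Suc K)
  show ?case
  proof (cases "P K")
    case True
    then have "{k. k < Suc K \<and> P k} = {..<Suc K}" using assms[of _ K] by auto
    then show ?thesis by blast
  next
    case False
    then have "{k. k < Suc K \<and> P k} = {k. k < K \<and> P k}" by (auto simp: less_Suc_eq)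
    then show ?thesis using Suc by simp
  qed
qed

lemma cdf_tendsto_of_rationals:
  assumes F: "real_distribution F" and \<mu>: "\<And>M. real_distribution (\<mu> M)"
    and lim: "\<And>x. x \<in> \<rat> \<Longrightarrow> (\<lambda>M. cdf (\<mu> M) x) \<longlonglongrightarrow> cdf F x"
  shows "weak_conv_m \<mu> F"
  unfolding weak_conv_m_def weak_conv_def
proof (intro allI impI)
  fix x assume cont: "isCont (cdf F) x"
  interpret F: real_distribution F by (rule F)
  show "(\<lambda>M. cdf (\<mu> M) x) \<longlonglongrightarrow> cdf F x"
  proof (rule LIMSEQ_I)
    fix \<epsilon> :: real assume \<epsilon>: "0 < \<epsilon>"
    from cont \<epsilon> obtain d where d: "d > 0" "\<And>y. \<bar>y - x\<bar> < d \<Longrightarrow> \<bar>cdf F y - cdf F x\<bar> < \<epsilon> / 2"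
      unfolding isCont_def LIM_def by (metis dist_real_def abs_0 cancel_comm_monoid_add_class.diff_cancel half_gt_zero)
    obtain a where a: "a \<in> \<rat>" "x - d < a" "a < x" using Rats_dense_in_real[of "x - d" x] d by auto
    obtain b where b: "b \<in> \<rat>" "x < b" "b < x + d" using Rats_dense_in_real[of x "x + d"] d by auto
    have Fa: "\<bar>cdf F a - cdf F x\<bar> < \<epsilon> / 2" and Fb: "\<bar>cdf F b - cdf F x\<bar> < \<epsilon> / 2"
      using d(2)[of a] d(2)[of b] a b by (simp_all add: abs_if)
    obtain M1 where M1: "\<And>M. M \<ge> M1 \<Longrightarrow> norm (cdf (\<mu> M) a - cdf F a) < \<epsilon> / 2"
      using LIMSEQ_D[OF lim[OF a(1)], of "\<epsilon> / 2"] \<epsilon> by auto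
    obtain M2 where M2: "\<And>M. M \<ge> M2 \<Longrightarrow> norm (cdf (\<mu> M) b - cdf F b) < \<epsilon> / 2"
      using LIMSEQ_D[OF lim[OF b(1)], of "\<epsilon> / 2"] \<epsilon> by auto
    have "norm (cdf (\<mu> M) x - cdf F x) < \<epsilon>" if "M \<ge> max M1 M2" for M
    proof -
      interpret N: real_distribution "\<mu> M" by (rule \<mu>)
      have "cdf (\<mu> M) a \<le> cdf (\<mu> M) x" "cdf (\<mu> M) x \<le> cdf (\<mu> M) b"
        using a b by (auto intro: N.cdf_nondecreasing)
      then show ?thesis using M1[of M] M2[of M] that Fa Fb unfolding real_norm_def by linarith
    qed
    then show "\<exists>no. \<forall>n\<ge>no. norm (cdf (\<mu> n) x - cdf F x) < \<epsilon>" by blast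
  qed
qed

lemma LST_bounds_nonneg:
  assumes F: "real_distribution F" and neg: "\<And>x. x \<in> \<rat> \<Longrightarrow> x < 0 \<Longrightarrow> cdf F x = 0" and \<theta>: "0 \<le> \<theta>"
  shows "LST F \<theta> = (\<integral>x. exp (- \<theta> * max x 0) \<partial>F)" "0 \<le> LST F \<theta>" "LST F \<theta> \<le> 1"
proof -
  interpret F: real_distribution F by (rule F)
  have "AE x in F. \<forall>q\<in>\<rat>. q < 0 \<longrightarrow> \<not> x \<le> q"
  proof (rule AE_ball_countable[THEN iffD2, OF countable_rat], intro ballI)
    fix q :: real assume q: "q \<in> \<rat>"
    show "AE x in F. q < 0 \<longrightarrow> \<not> x \<le> q"
    proof (cases "q < 0")
      case True
      have "measure F {..q} = 0" using neg[OF q True] by (simp add: cdf_def)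
      then have "AE x in F. x \<notin> {..q}" by (subst (asm) F.prob_eq_0) auto
      then show ?thesis by simp
    qed simp
  qed
  then have nn: "AE x in F. 0 \<le> x"
  proof eventually_elim
    case (elim x)
    show ?case
    proof (rule ccontr)
      assume "\<not> 0 \<le> x"
      then obtain q where "q \<in> \<rat>" "x < q" "q < 0" using Rats_dense_in_real[of x 0] by auto
      then show False using elim by auto
    qed
  qed
  show eq: "LST F \<theta> = (\<integral>x. exp (- \<theta> * max x 0) \<partial>F)"
    unfolding LST_def
  proof (rule integral_cong_AE)
    show "AE x in F. exp (- \<theta> * x) = exp (- \<theta> * max x 0)" using nn by eventually_elim simp
  qed auto
  show "0 \<le> LST F \<theta>" unfolding LST_def by simp
  have "(\<integral>x. exp (- \<theta> * max x 0) \<partial>F) \<le> (\<integral>x. 1 \<partial>F)"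
    using \<theta> by (intro integral_mono F.integrable_const_bound[where B = 1]) auto
  then show "LST F \<theta> \<le> 1" using F.prob_space unfolding eq by simp
qed

text \<open>
If the empirical distribution functions converge to that of \<open>F\<close>, the empirical distributions converge weakly,
and their Laplace transforms converge.  The form without division also covers the case that no index satisfies \<open>P\<close>.
\<close>

lemma empirical_LST:
  fixes r :: "nat \<Rightarrow> real" and P :: "nat \<Rightarrow> bool"
  assumes F: "real_distribution F" and \<theta>: "0 \<le> \<theta>" and r0: "\<And>k. P k \<Longrightarrow> 0 \<le> r k"
    and neg: "\<And>x. x \<in> \<rat> \<Longrightarrow> x < 0 \<Longrightarrow> cdf F x = 0"
    and lim: "\<And>x. x \<in> \<rat> \<Longrightarrow>
      (\<lambda>m. real (card {k. k < m \<and> P k \<and> r k \<le> x}) / real (card {k. k < m \<and> P k})) \<longlonglongrightarrow> cdf F x"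
    and \<epsilon>: "0 < \<epsilon>"
  shows "\<exists>m0. \<forall>m\<ge>m0. \<bar>\<Sum>k | k < m \<and> P k. exp (- \<theta> * r k) - LST F \<theta>\<bar> \<le> \<epsilon> * real (card {k. k < m \<and> P k})"
proof (cases "\<exists>k. P k")
  case False
  then show ?thesis by auto
next
  case True
  then obtain k0 where k0: "P k0" by blast
  \<comment> \<open>all these sets contain \<open>k0\<close>, so that the empirical distributions exist\<close>
  define S where "S = (\<lambda>m. {k. k < m + Suc k0 \<and> P k})"
  have S: "finite (S m)" "S m \<noteq> {}" for m using k0 by (auto simp: S_def intro!: exI[of _ k0])
  have cS: "card (S m) > 0" for m using S by (simp add: card_gt_0_iff)
  define \<mu> where "\<mu> = (\<lambda>m. distr (measure_pmf (pmf_of_set (S m))) borel r)"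
  have rd: "real_distribution (\<mu> m)" for m
    unfolding \<mu>_def by (rule prob_space.real_distribution_distr[OF measure_pmf.prob_space_axioms]) simp
  have cdf: "cdf (\<mu> m) x = real (card {k. k < m + Suc k0 \<and> P k \<and> r k \<le> x}) / real (card {k. k < m + Suc k0 \<and> P k})" for m x
  proof -
    have "cdf (\<mu> m) x = measure (measure_pmf (pmf_of_set (S m))) {k. r k \<le> x}"
      unfolding cdf_def \<mu>_def by (subst measure_distr) (auto intro!: arg_cong[where f = "measure _"])
    also have "\<dots> = real (card (S m \<inter> {k. r k \<le> x})) / real (card (S m))"
      by (rule measure_pmf_of_set[OF S(2,1)])
    also have "S m \<inter> {k. r k \<le> x} = {k. k < m + Suc k0 \<and> P k \<and> r k \<le> x}" by (auto simp: S_def)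
    finally show ?thesis by (simp only: S_def)
  qed
  have wc: "weak_conv_m \<mu> F"
  proof (rule cdf_tendsto_of_rationals[OF F rd])
    fix x :: real assume "x \<in> \<rat>"
    from LIMSEQ_ignore_initial_segment[OF lim[OF this], of "Suc k0"]
    show "(\<lambda>m. cdf (\<mu> m) x) \<longlonglongrightarrow> cdf F x" by (simp only: cdf)
  qed
  \<comment> \<open>with \<open>max x 0\<close> the integrand is bounded on the whole line, as weak convergence requires\<close>
  have L: "(\<lambda>m. \<integral>x. exp (- \<theta> * max x 0) \<partial>\<mu> m) \<longlonglongrightarrow> (\<integral>x. exp (- \<theta> * max x 0) \<partial>F)"
  proof (rule weak_conv_imp_integral_bdd_continuous_conv[OF rd F wc, where B = 1])
    show "isCont (\<lambda>x. exp (- \<theta> * max x 0)) x" for x by (intro continuous_intros)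
    show "norm (exp (- \<theta> * max x 0)) \<le> 1" for x using \<theta> by simp
  qed
  have int: "(\<integral>x. exp (- \<theta> * max x 0) \<partial>\<mu> m) = (\<Sum>k\<in>S m. exp (- \<theta> * r k)) / real (card (S m))" for m
  proof -
    have "(\<integral>x. exp (- \<theta> * max x 0) \<partial>\<mu> m) = (\<integral>k. exp (- \<theta> * max (r k) 0) \<partial>measure_pmf (pmf_of_set (S m)))"
      unfolding \<mu>_def by (rule integral_distr) auto
    also have "\<dots> = (\<Sum>k\<in>S m. exp (- \<theta> * max (r k) 0)) / real (card (S m))"
      by (rule integral_pmf_of_set[OF S(2,1)])
    also have "(\<Sum>k\<in>S m. exp (- \<theta> * max (r k) 0)) = (\<Sum>k\<in>S m. exp (- \<theta> * r k))"
      using r0 by (intro sum.cong) (auto simp: S_def)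
    finally show ?thesis .
  qed
  have LST_eq: "LST F \<theta> = (\<integral>x. exp (- \<theta> * max x 0) \<partial>F)"
    by (rule LST_bounds_nonneg(1)[OF F _ \<theta>]) (rule neg)
  have lim_S: "(\<lambda>m. (\<Sum>k\<in>S m. exp (- \<theta> * r k)) / real (card (S m))) \<longlonglongrightarrow> LST F \<theta>"
    using L by (simp only: int LST_eq)
  obtain m1 where m1: "\<And>m. m \<ge> m1 \<Longrightarrow>
      norm ((\<Sum>k\<in>S m. exp (- \<theta> * r k)) / real (card (S m)) - LST F \<theta>) < \<epsilon>"
    using LIMSEQ_D[OF lim_S \<epsilon>] by blast
  show ?thesis
  proof (intro exI allI impI)
    fix m assume m: "m1 + Suc k0 \<le> m"
    define m' where "m' = m - Suc k0"
    have Sm: "S m' = {k. k < m \<and> P k}" using m by (simp add: S_def m'_def)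
    have "\<bar>(\<Sum>k\<in>S m'. exp (- \<theta> * r k)) / real (card (S m')) - LST F \<theta>\<bar> \<le> \<epsilon>"
    proof -
      have "m1 \<le> m'" using m by (simp add: m'_def)
      from m1[OF this] show ?thesis unfolding real_norm_def by (rule less_imp_le)
    qed
    then have "\<bar>(\<Sum>k\<in>S m'. exp (- \<theta> * r k)) / real (card (S m')) - LST F \<theta>\<bar> * real (card (S m')) \<le> \<epsilon> * real (card (S m'))"
      by (intro mult_right_mono) auto
    also have "\<bar>(\<Sum>k\<in>S m'. exp (- \<theta> * r k)) / real (card (S m')) - LST F \<theta>\<bar> * real (card (S m')) =
      \<bar>((\<Sum>k\<in>S m'. exp (- \<theta> * r k)) / real (card (S m')) - LST F \<theta>) * real (card (S m'))\<bar>"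
      by (simp add: abs_mult)
    also have "((\<Sum>k\<in>S m'. exp (- \<theta> * r k)) / real (card (S m')) - LST F \<theta>) * real (card (S m')) =
      (\<Sum>k\<in>S m'. exp (- \<theta> * r k) - LST F \<theta>)"
      using cS[of m'] by (simp add: sum_subtractf left_diff_distrib)
    finally show "\<bar>\<Sum>k | k < m \<and> P k. exp (- \<theta> * r k) - LST F \<theta>\<bar> \<le> \<epsilon> * real (card {k. k < m \<and> P k})"
      unfolding Sm .
  qed
qed

context Mn_Gn_1_queue begin

lemma late_arrivals_unlikely: "(\<lambda>K. \<P>(\<omega> in M. arrival_epoch (Q \<omega>) K \<le> t)) \<longlonglongrightarrow> 0"
proof -
  have "(\<lambda>K. \<P>(\<omega> in M. arrival_epoch (Q \<omega>) K \<le> t)) \<longlonglongrightarrow> measure M (\<Inter>K. {\<omega> \<in> space M. arrival_epoch (Q \<omega>) K \<le> t})"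
  proof (rule finite_Lim_measure_decseq)
    show "decseq (\<lambda>K. {\<omega> \<in> space M. arrival_epoch (Q \<omega>) K \<le> t})"
    proof (rule decseq_SucI, rule subsetI)
      fix K \<omega> assume "\<omega> \<in> {\<omega> \<in> space M. arrival_epoch (Q \<omega>) (Suc K) \<le> t}"
      then show "\<omega> \<in> {\<omega> \<in> space M. arrival_epoch (Q \<omega>) K \<le> t}"
        using arrival_epoch_le_iff[OF valid, of \<omega> K "Suc K"] by auto
    qed
  qed auto
  also have "(\<Inter>K. {\<omega> \<in> space M. arrival_epoch (Q \<omega>) K \<le> t}) = {}"
  proof (rule equals0I)
    fix \<omega> assume \<omega>: "\<omega> \<in> (\<Inter>K. {\<omega> \<in> space M. arrival_epoch (Q \<omega>) K \<le> t})"
    then obtain K where "t < arrival_epoch (Q \<omega>) K" using arrivals_eventually_late[OF valid, of \<omega> t] by blast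
    moreover have "arrival_epoch (Q \<omega>) K \<le> t" using \<omega> by blast
    ultimately show False by simp
  qed
  finally show ?thesis by simp
qed

text \<open>
By \<open>expected_count\<close> the expected count is \<open>rate m\<close> times the expected occupation time, up to the unlikely event that the first
\<open>K N\<close> arrivals are exhausted before time \<open>N\<close>.  Time fractions are bounded by 1, so their almost sure limit is also
the limit of their expectations.
\<close>

lemma expected_count_rate:
  assumes st: "steady_state_prob M Q m p"
    and late: "(\<lambda>N. \<P>(\<omega> in M. arrival_epoch (Q \<omega>) (K N) \<le> real N)) \<longlonglongrightarrow> 0"
  shows "(\<lambda>N. (\<integral>\<omega>. (\<Sum>k<Suc (K N). arrival_ind c m k (real N) \<omega>) \<partial>M) / real N)
     \<longlonglongrightarrow> rate m * (p * \<P>(\<omega> in M. initial_number (Q \<omega>) = c))"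
proof -
  let ?J = "{\<omega> \<in> space M. initial_number (Q \<omega>) = c}"
  let ?W = "\<lambda>N \<omega>. \<Sum>k<Suc (K N). interarrival_occupation c m k (real N) \<omega>"
  define f where "f = (\<lambda>N \<omega>. indicator ?J \<omega> * (occupation m (real N) \<omega> / real N))"
  have f_bound: "\<bar>f N \<omega>\<bar> \<le> 1" if "\<omega> \<in> space M" for N \<omega>
    using occupation_bounds[OF that, of "real N" m] by (cases "N = 0") (auto simp: f_def indicator_def divide_le_eq_1)
  have fm [measurable]: "f N \<in> borel_measurable M" for N unfolding f_def by measurable
  have "(\<lambda>N. \<integral>\<omega>. f N \<omega> \<partial>M) \<longlonglongrightarrow> (\<integral>\<omega>. indicator ?J \<omega> * p \<partial>M)"
  proof (rule integral_dominated_convergence[where w = "\<lambda>_. 1"])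
    show "AE \<omega> in M. (\<lambda>N. f N \<omega>) \<longlonglongrightarrow> indicator ?J \<omega> * p"
      using st[unfolded steady_state_prob_def] AE_space
    proof eventually_elim
      case (elim \<omega>)
      have "(\<lambda>N. occupation m (real N) \<omega> / real N) \<longlonglongrightarrow> p"
        using filterlim_compose[OF elim(1) filterlim_real_sequentially]
        by (simp add: occupation_eq_measure[OF elim(2)])
      then show ?case unfolding f_def by (intro tendsto_mult tendsto_const)
    qed
  qed (auto intro!: AE_I2 f_bound)
  then have lim_f: "(\<lambda>N. \<integral>\<omega>. f N \<omega> \<partial>M) \<longlonglongrightarrow> p * \<P>(\<omega> in M. initial_number (Q \<omega>) = c)"
    by (simp add: mult.commute)
  have iW: "integrable M (?W N)" for N by (intro Bochner_Integration.integrable_sum integrable_interarrival_occupation) simp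
  have diff: "\<bar>(\<integral>\<omega>. ?W N \<omega> / real N \<partial>M) - (\<integral>\<omega>. f N \<omega> \<partial>M)\<bar> \<le> \<P>(\<omega> in M. arrival_epoch (Q \<omega>) (K N) \<le> real N)" for N
  proof -
    let ?L = "{\<omega> \<in> space M. arrival_epoch (Q \<omega>) (K N) \<le> real N}"
    have if': "integrable M (f N)" by (rule integrable_bounded[where B = 1]) (auto intro: f_bound)
    have "\<bar>\<integral>\<omega>. ?W N \<omega> / real N - f N \<omega> \<partial>M\<bar> \<le> (\<integral>\<omega>. \<bar>?W N \<omega> / real N - f N \<omega>\<bar> \<partial>M)" by (rule integral_abs_bound)
    also have "\<dots> \<le> (\<integral>\<omega>. indicator ?L \<omega> \<partial>M)"
    proof (rule integral_mono)
      show "integrable M (\<lambda>\<omega>. \<bar>?W N \<omega> / real N - f N \<omega>\<bar>)"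
        by (intro integrable_abs Bochner_Integration.integrable_diff if' integrable_divide_zero impI iW)
      fix \<omega> assume \<omega>: "\<omega> \<in> space M"
      show "\<bar>?W N \<omega> / real N - f N \<omega>\<bar> \<le> indicator ?L \<omega>"
      proof (cases "initial_number (Q \<omega>) = c")
        case False
        then show ?thesis by (simp add: f_def interarrival_occupation_other_initial)
      next
        case c: True
        show ?thesis
        proof (cases "\<omega> \<in> ?L")
          case True
          have "0 \<le> ?W N \<omega> / real N" "?W N \<omega> / real N \<le> 1"
            using sum_interarrival_occupation_bounds[OF \<omega>, of "real N" c m "Suc (K N)"] by (cases "N = 0"; simp add: divide_le_eq_1)+
          moreover have "0 \<le> f N \<omega>" using occupation_bounds(1)[OF \<omega>, of "real N" m] by (simp add: f_def)
          ultimately show ?thesis using True f_bound[OF \<omega>, of N] by simp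
        next
          case False
          then have "real N < arrival_epoch (Q \<omega>) (K N)" using \<omega> by auto
          from sum_interarrival_occupation_eq_occupation[OF \<omega> c this, of m] show ?thesis
            using c \<omega> by (simp only: f_def) (simp add: indicator_def)
        qed
      qed
    qed (auto simp: emeasure_eq_measure)
    finally show ?thesis using iW[of N] if' by simp
  qed
  have "(\<lambda>N. (\<integral>\<omega>. ?W N \<omega> / real N \<partial>M) - (\<integral>\<omega>. f N \<omega> \<partial>M)) \<longlonglongrightarrow> 0"
    by (rule Lim_null_comparison[OF _ late]) (use diff in simp)
  from tendsto_add[OF this lim_f]
  have "(\<lambda>N. \<integral>\<omega>. ?W N \<omega> / real N \<partial>M) \<longlonglongrightarrow> p * \<P>(\<omega> in M. initial_number (Q \<omega>) = c)" by simp
  from tendsto_mult_left[OF this, of "rate m"] show ?thesis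
    using expected_count[of "real _" c m "Suc (K _)"] by simp
qed

lemma residual_service_pos:
  assumes "\<omega> \<in> space M" "number_found (Q \<omega>) k = m" "0 < m"
  shows "0 < residual_service (Q \<omega>) (arrival_epoch (Q \<omega>) k)"
proof -
  have "customer_epoch (Q \<omega>) (initial_number (Q \<omega>) + k) < service_end (Q \<omega>) (initial_number (Q \<omega>) + k - m)"
    using number_found_eq_iff[OF valid[OF assms(1)] assms(3) refl, of k] assms(2) by blast
  then show ?thesis
    unfolding residual_service_found[OF valid[OF assms(1)] refl assms(2,3)] customer_epoch_arrival by simp
qed

text \<open>
The residual service time of a service in progress is positive, so all empirical fractions vanish.
\<close>

lemma steady_state_residual_nonneg:
  assumes R: "steady_state_residual M Q m F" and m: "0 < m" and x: "x < 0"
  shows "cdf F x = 0"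
proof -
  have "AE \<omega> in M. (\<lambda>j. real (card {k. k < j \<and> number_found (Q \<omega>) k = m \<and>
                            residual_service (Q \<omega>) (arrival_epoch (Q \<omega>) k) \<le> x})
             / real (card {k. k < j \<and> number_found (Q \<omega>) k = m})) \<longlonglongrightarrow> cdf F x"
    using R by (simp add: steady_state_residual_def)
  then have "AE \<omega> in M. cdf F x = 0"
    using AE_space
  proof eventually_elim
    case (elim \<omega>)
    have none: "{k. k < j \<and> number_found (Q \<omega>) k = m \<and> residual_service (Q \<omega>) (arrival_epoch (Q \<omega>) k) \<le> x} = {}" for j
      using residual_service_pos[OF elim(2) _ m] x by force
    have "(\<lambda>j. 0) \<longlonglongrightarrow> cdf F x" using elim(1) unfolding none by simp
    then show ?case by (simp add: LIMSEQ_const_iff)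
  qed
  then show ?thesis by simp
qed

lemma steady_state_residual_LST:
  assumes R: "steady_state_residual M Q m F" and m: "0 < m" and \<theta>: "0 \<le> \<theta>" and \<epsilon>: "0 < \<epsilon>"
  shows "AE \<omega> in M. \<exists>j0. \<forall>j\<ge>j0. \<bar>\<Sum>k | k < j \<and> number_found (Q \<omega>) k = m.
      exp (- \<theta> * residual_service (Q \<omega>) (arrival_epoch (Q \<omega>) k)) - LST F \<theta>\<bar>
    \<le> \<epsilon> * real (card {k. k < j \<and> number_found (Q \<omega>) k = m})"
proof -
  have "AE \<omega> in M. \<forall>x\<in>\<rat>. (\<lambda>j. real (card {k. k < j \<and> number_found (Q \<omega>) k = m \<and>
                            residual_service (Q \<omega>) (arrival_epoch (Q \<omega>) k) \<le> x})
             / real (card {k. k < j \<and> number_found (Q \<omega>) k = m})) \<longlonglongrightarrow> cdf F x"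
    by (rule AE_ball_countable[THEN iffD2, OF countable_rat])
       (use R in \<open>simp add: steady_state_residual_def\<close>)
  then show ?thesis
    using AE_space
  proof eventually_elim
    case (elim \<omega>)
    show ?case
    proof (rule empirical_LST[OF _ \<theta>])
      show "real_distribution F" using R by (simp add: steady_state_residual_def)
      show "0 \<le> residual_service (Q \<omega>) (arrival_epoch (Q \<omega>) k)" if "number_found (Q \<omega>) k = m" for k
        using residual_service_pos[OF elim(2) that m] by simp
      show "cdf F x = 0" if "x < 0" for x by (rule steady_state_residual_nonneg[OF R m that])
      show "(\<lambda>j. real (card {k. k < j \<and> number_found (Q \<omega>) k = m \<and>
                            residual_service (Q \<omega>) (arrival_epoch (Q \<omega>) k) \<le> x})
             / real (card {k. k < j \<and> number_found (Q \<omega>) k = m})) \<longlonglongrightarrow> cdf F x" if "x \<in> \<rat>" for x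
        using elim(1) that by blast
    qed (rule \<epsilon>)
  qed
qed

text \<open>
Along almost every path the sum of the deviations is at most \<open>\<epsilon>\<close> times the count, from some random index on.  Before a fixed index
\<open>i\<close> the sum is at most \<open>i\<close>.  On the event \<open>Bad i\<close> that the bound fails later than \<open>i\<close>, of small probability, the sum is
at most the count \<open>H\<close>, and \<open>H \<le> \<eta> / t * H\<^sup>2 + t / \<eta>\<close>, where \<open>t\<close> is the length of time: the expectation of \<open>H\<^sup>2\<close> is of order
\<open>t\<^sup>2\<close>.
\<close>

lemma expected_residual_deviation:
  assumes R: "steady_state_residual M Q m F" and m: "0 < m" and \<theta>: "0 \<le> \<theta>"
  shows "(\<lambda>N. (\<integral>\<omega>. (\<Sum>k<K N. discounted_arrival c m k \<theta> (real N) \<omega> - LST F \<theta> * arrival_ind c m k (real N) \<omega>) \<partial>M) / real N)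
    \<longlonglongrightarrow> 0"
proof (rule LIMSEQ_I)
  fix \<delta> :: real assume \<delta>: "0 < \<delta>"
  define r where "r = LST F \<theta>"
  have Fd: "real_distribution F" using R by (simp add: steady_state_residual_def)
  have r: "0 \<le> r" "r \<le> 1"
    unfolding r_def using LST_bounds_nonneg(2,3)[OF Fd steady_state_residual_nonneg[OF R m] \<theta>] by auto
  define \<kappa> where "\<kappa> = rate m"
  have \<kappa>: "0 < \<kappa>" by (simp add: \<kappa>_def rate_pos)
  \<comment> \<open>the error is split into four parts, each less than or equal to \<open>\<delta> / 4\<close> per unit of time\<close>
  define \<epsilon> where "\<epsilon> = \<delta> / (4 * \<kappa>)"
  define q where "q = \<kappa> + 2 * \<kappa> ^ 2"
  have q: "0 < q" using \<kappa> by (simp add: q_def add_pos_nonneg)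
  define \<eta> where "\<eta> = \<delta> / (4 * q)"
  have \<epsilon>: "0 < \<epsilon>" "\<epsilon> * \<kappa> = \<delta> / 4" and \<eta>: "0 < \<eta>" "\<eta> * q = \<delta> / 4" using \<delta> \<kappa> q by (auto simp: \<epsilon>_def \<eta>_def)
  define h where "h = (\<lambda>k \<omega>. if initial_number (Q \<omega>) = c \<and> number_found (Q \<omega>) k = m then 1 else (0::real))"
  define dh where "dh = (\<lambda>k \<omega>. h k \<omega> * residual_discount (c + k) m \<theta> \<omega> (arrival_epoch (Q \<omega>) k))"
  define S where "S = (\<lambda>j \<omega>. \<Sum>k<j. dh k \<omega> - r * h k \<omega>)"
  define C where "C = (\<lambda>j \<omega>. \<Sum>k<j. h k \<omega>)"
  have hm [measurable]: "h k \<in> borel_measurable M" for k unfolding h_def by measurable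
  have dhm [measurable]: "dh k \<in> borel_measurable M" for k unfolding dh_def residual_discount_def by measurable
  have Sm [measurable]: "S j \<in> borel_measurable M" and Cm [measurable]: "C j \<in> borel_measurable M" for j
    unfolding S_def C_def by measurable
  have hb: "0 \<le> h k \<omega>" "h k \<omega> \<le> 1" for k \<omega> by (auto simp: h_def)
  have dhb: "\<bar>dh k \<omega> - r * h k \<omega>\<bar> \<le> h k \<omega>" if \<omega>: "\<omega> \<in> space M" for k \<omega>
  proof (cases "h k \<omega> = 0")
    case False
    then have h1: "h k \<omega> = 1" "initial_number (Q \<omega>) = c" "number_found (Q \<omega>) k = m" by (auto simp: h_def split: if_splits)
    have "residual_discount (c + k) m \<theta> \<omega> (arrival_epoch (Q \<omega>) k) = exp (- \<theta> * residual_service (Q \<omega>) (arrival_epoch (Q \<omega>) k))"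
      using residual_service_found[OF valid[OF \<omega>] h1(2,3) m] by (simp add: residual_discount_def)
    moreover have "exp (- \<theta> * residual_service (Q \<omega>) (arrival_epoch (Q \<omega>) k)) \<le> 1"
      using residual_service_pos[OF \<omega> h1(3) m] \<theta> by simp
    ultimately have "0 \<le> dh k \<omega>" "dh k \<omega> \<le> 1" using h1 by (simp_all add: dh_def)
    then show ?thesis using r h1(1) by simp
  qed (simp add: dh_def)
  have SC: "\<bar>S j \<omega>\<bar> \<le> C j \<omega>" if "\<omega> \<in> space M" for j \<omega>
    unfolding S_def C_def by (rule order_trans[OF sum_abs sum_mono]) (rule dhb[OF that])
  have C_le: "C j \<omega> \<le> real j" for j \<omega>
    using sum_mono[of "{..<j}" "\<lambda>k. h k \<omega>" "\<lambda>_. 1"] hb by (simp add: C_def)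
  have AE_S: "AE \<omega> in M. \<exists>j0. \<forall>j\<ge>j0. \<bar>S j \<omega>\<bar> \<le> \<epsilon> * C j \<omega>"
    using steady_state_residual_LST[OF R m \<theta> \<epsilon>(1)] AE_space
  proof eventually_elim
    case (elim \<omega>)
    show ?case
    proof (cases "initial_number (Q \<omega>) = c")
      case True
      have "S j \<omega> = (\<Sum>k | k < j \<and> number_found (Q \<omega>) k = m.
          exp (- \<theta> * residual_service (Q \<omega>) (arrival_epoch (Q \<omega>) k)) - LST F \<theta>)" for j
      proof -
        have "S j \<omega> = (\<Sum>k\<in>{..<j}. if number_found (Q \<omega>) k = m then
          exp (- \<theta> * residual_service (Q \<omega>) (arrival_epoch (Q \<omega>) k)) - LST F \<theta> else 0)"
          unfolding S_def
        proof (rule sum.cong[OF refl])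
          fix k
          show "dh k \<omega> - r * h k \<omega> = (if number_found (Q \<omega>) k = m then
            exp (- \<theta> * residual_service (Q \<omega>) (arrival_epoch (Q \<omega>) k)) - LST F \<theta> else 0)"
            using True residual_service_found[OF valid[OF elim(2)] True _ m, of k]
            by (auto simp: dh_def h_def residual_discount_def r_def)
        qed
        also have "\<dots> = (\<Sum>k | k \<in> {..<j} \<and> number_found (Q \<omega>) k = m.
          exp (- \<theta> * residual_service (Q \<omega>) (arrival_epoch (Q \<omega>) k)) - LST F \<theta>)"
          by (rule sum.inter_filter[symmetric]) simp
        finally show ?thesis by simp
      qed
      moreover have "C j \<omega> = real (card {k. k < j \<and> number_found (Q \<omega>) k = m})" for j
      proof -
        have "C j \<omega> = (\<Sum>k\<in>{..<j}. if number_found (Q \<omega>) k = m then 1 else 0)"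
          unfolding C_def h_def using True by (intro sum.cong) auto
        also have "\<dots> = (\<Sum>k | k \<in> {..<j} \<and> number_found (Q \<omega>) k = m. 1)"
          by (rule sum.inter_filter[symmetric]) simp
        finally show ?thesis by simp
      qed
      ultimately show ?thesis using elim(1) by simp
    next
      case False
      then have "S j \<omega> = 0" "C j \<omega> = 0" for j by (simp_all add: S_def C_def dh_def h_def)
      then show ?thesis by simp
    qed
  qed
  define Bad where "Bad = (\<lambda>i. {\<omega> \<in> space M. \<exists>j\<ge>i. \<epsilon> * C j \<omega> < \<bar>S j \<omega>\<bar>})"
  have Badm [measurable]: "Bad i \<in> sets M" for i unfolding Bad_def by measurable
  have "(\<lambda>i. measure M (Bad i)) \<longlonglongrightarrow> measure M (\<Inter>i. Bad i)"
    by (rule finite_Lim_measure_decseq) (auto simp: Bad_def decseq_Suc_iff dest: Suc_leD intro: Suc_leD)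
  moreover have "measure M (\<Inter>i. Bad i) = 0"
  proof -
    have "AE \<omega> in M. \<omega> \<notin> (\<Inter>i. Bad i)"
      using AE_S by eventually_elim (auto simp: Bad_def not_less)
    then show ?thesis by (subst prob_eq_0) auto
  qed
  ultimately have "(\<lambda>i. measure M (Bad i)) \<longlonglongrightarrow> 0" by simp
  then have "\<forall>\<^sub>F i in sequentially. measure M (Bad i) < \<delta> / 4 * \<eta>"
    using \<delta> \<eta>(1) by (intro order_tendstoD(2)[of _ "0::real"]) auto
  then obtain i where i: "measure M (Bad i) < \<delta> / 4 * \<eta>" by (auto simp: eventually_sequentially)
  have Pb: "measure M (Bad i) / \<eta> < \<delta> / 4" using i \<eta>(1) by (simp add: divide_less_eq)
  obtain N0 :: nat where N0: "4 * real i / \<delta> < real N0" using reals_Archimedean2 by blast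
  have "norm ((\<integral>\<omega>. (\<Sum>k<K N. discounted_arrival c m k \<theta> (real N) \<omega> - r * arrival_ind c m k (real N) \<omega>) \<partial>M) / real N - 0) < \<delta>"
    if N: "N \<ge> max 1 N0" for N
  proof -
    define t where "t = real N"
    have t: "1 \<le> t" and iN: "real i / t < \<delta> / 4"
    proof -
      show "1 \<le> t" using N by (simp add: t_def)
      have "4 * real i / \<delta> < t" using N N0 by (simp add: t_def)
      then show "real i / t < \<delta> / 4" using \<delta> \<open>1 \<le> t\<close> by (simp add: field_simps)
    qed
    define H where "H = (\<lambda>\<omega>. \<Sum>k<K N. arrival_ind c m k t \<omega>)"
    define D where "D = (\<lambda>\<omega>. \<Sum>k<K N. discounted_arrival c m k \<theta> t \<omega> - r * arrival_ind c m k t \<omega>)"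
    have H0: "0 \<le> H \<omega>" "H \<omega> \<le> real (K N)" for \<omega>
      using sum_mono[of "{..<K N}" "\<lambda>k. arrival_ind c m k t \<omega>" "\<lambda>_. 1"] by (auto simp: H_def sum_nonneg arrival_ind_bounds)
    have pw: "\<bar>D \<omega>\<bar> \<le> \<epsilon> * H \<omega> + real i + (\<eta> / t * H \<omega> ^ 2 + t / \<eta> * indicator (Bad i) \<omega>)" if \<omega>: "\<omega> \<in> space M" for \<omega>
    proof -
      obtain L where L: "{k. k < K N \<and> arrival_epoch (Q \<omega>) k \<le> t} = {..<L}"
        using initial_segment_nat[of "\<lambda>k. arrival_epoch (Q \<omega>) k \<le> t" "K N"]
          arrival_epoch_le_iff[OF valid[OF \<omega>]] by (meson order_trans)
      have filt: "(\<Sum>k<K N. if arrival_epoch (Q \<omega>) k \<le> t then x k else 0) = (\<Sum>k<L. x k)" for x :: "nat \<Rightarrow> real"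
        using sum.inter_filter[of "{..<K N}" x "\<lambda>k. arrival_epoch (Q \<omega>) k \<le> t"] L by simp
      have DL: "D \<omega> = S L \<omega>"
        unfolding D_def S_def filt[symmetric]
        by (intro sum.cong refl) (auto simp: discounted_arrival_def arrival_ind_def dh_def h_def)
      have HL: "H \<omega> = C L \<omega>"
        unfolding H_def C_def filt[symmetric] by (intro sum.cong refl) (auto simp: arrival_ind_def h_def)
      have quad: "0 \<le> \<eta> / t * H \<omega> ^ 2" using \<eta>(1) t by simp
      show ?thesis
      proof (cases "\<omega> \<in> Bad i")
        case True
        have "H \<omega> \<le> \<eta> / t * H \<omega> ^ 2 + t / \<eta>"
        proof (cases "H \<omega> \<le> t / \<eta>")
          case True
          then show ?thesis using quad by linarith
        next
          case False
          then have "1 \<le> \<eta> / t * H \<omega>" using \<eta>(1) t by (simp add: field_simps)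
          then have "1 * H \<omega> \<le> \<eta> / t * H \<omega> * H \<omega>" using H0(1) by (intro mult_right_mono) auto
          moreover have "0 \<le> t / \<eta>" using \<eta>(1) t by simp
          ultimately show ?thesis by (simp add: power2_eq_square mult.assoc)
        qed
        moreover have "\<bar>D \<omega>\<bar> \<le> H \<omega>" using SC[OF \<omega>, of L] DL HL by simp
        moreover have "0 \<le> \<epsilon> * H \<omega>" using \<epsilon>(1) H0(1) by simp
        ultimately show ?thesis using True by simp
      next
        case False
        have "\<bar>D \<omega>\<bar> \<le> \<epsilon> * H \<omega> + real i"
        proof (cases "i \<le> L")
          case True
          then show ?thesis using False \<omega> unfolding DL HL by (auto simp: Bad_def not_less intro: order_trans)
        next
          case False
          have "\<bar>D \<omega>\<bar> \<le> real i" using SC[OF \<omega>, of L] C_le[of L \<omega>] False unfolding DL by simp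
          moreover have "0 \<le> \<epsilon> * H \<omega>" using \<epsilon>(1) H0(1) by simp
          ultimately show ?thesis by simp
        qed
        then show ?thesis using False quad by simp
      qed
    qed
    have iH: "integrable M H" unfolding H_def by (intro Bochner_Integration.integrable_sum integrable_arrival_ind)
    have Hm [measurable]: "H \<in> borel_measurable M" unfolding H_def by measurable
    have Dm [measurable]: "D \<in> borel_measurable M" unfolding D_def by measurable
    have iH2: "integrable M (\<lambda>\<omega>. H \<omega> ^ 2)"
      by (rule integrable_bounded[where B = "real (K N) ^ 2"]) (use H0 in \<open>auto simp: power_mono\<close>)
    have iI: "integrable M (indicat_real (Bad i))" by (simp add: emeasure_eq_measure)
    have iD: "integrable M D"
    proof (rule integrable_bounded[where B = "real (K N)"])
      fix \<omega> assume \<omega>: "\<omega> \<in> space M"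
      have "\<bar>discounted_arrival c m k \<theta> t \<omega> - r * arrival_ind c m k t \<omega>\<bar> \<le> 1" for k
        using dhb[OF \<omega>, of k] hb[of k \<omega>] by (auto simp: discounted_arrival_def arrival_ind_def dh_def h_def split: if_splits)
      then have "\<bar>D \<omega>\<bar> \<le> (\<Sum>k<K N. 1)" unfolding D_def by (intro order_trans[OF sum_abs sum_mono])
      then show "\<bar>D \<omega>\<bar> \<le> real (K N)" by simp
    qed measurable
    have "\<bar>\<integral>\<omega>. D \<omega> \<partial>M\<bar> \<le> (\<integral>\<omega>. \<bar>D \<omega>\<bar> \<partial>M)" by (rule integral_abs_bound)
    also have "\<dots> \<le> (\<integral>\<omega>. \<epsilon> * H \<omega> + real i + (\<eta> / t * H \<omega> ^ 2 + t / \<eta> * indicator (Bad i) \<omega>) \<partial>M)"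
      by (rule integral_mono[OF _ _ pw])
         (intro integrable_abs iD Bochner_Integration.integrable_add integrable_mult_right impI iH iH2 iI integrable_const; assumption?)+
    also have "\<dots> = \<epsilon> * (\<integral>\<omega>. H \<omega> \<partial>M) + real i + (\<eta> / t * (\<integral>\<omega>. H \<omega> ^ 2 \<partial>M) + t / \<eta> * measure M (Bad i))"
      using iH iH2 iI by (simp add: prob_space)
    also have "\<dots> \<le> \<epsilon> * (\<kappa> * t) + real i + (\<eta> / t * (q * t ^ 2) + t / \<eta> * measure M (Bad i))"
    proof (intro add_mono mult_left_mono order_refl)
      show "(\<integral>\<omega>. H \<omega> \<partial>M) \<le> \<kappa> * t" unfolding H_def \<kappa>_def by (rule expected_count_le) (use t in simp)
      have sq: "(\<integral>\<omega>. H \<omega> ^ 2 \<partial>M) \<le> \<kappa> * t + 2 * (\<kappa> * t) ^ 2"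
        unfolding H_def \<kappa>_def by (rule expected_square_count_le) (use t in simp)
      have "t \<le> t ^ 2" using t self_le_power[of t 2] by simp
      then have "\<kappa> * t \<le> \<kappa> * t ^ 2" using \<kappa> by (intro mult_left_mono) auto
      then show "(\<integral>\<omega>. H \<omega> ^ 2 \<partial>M) \<le> q * t ^ 2"
        using sq by (simp add: q_def power_mult_distrib distrib_right)
    qed (use \<epsilon> \<eta> t in auto)
    finally have bound: "\<bar>\<integral>\<omega>. D \<omega> \<partial>M\<bar> \<le> \<epsilon> * (\<kappa> * t) + real i + (\<eta> / t * (q * t ^ 2) + t / \<eta> * measure M (Bad i))" .
    have "\<bar>\<integral>\<omega>. D \<omega> \<partial>M\<bar> / t \<le> (\<epsilon> * (\<kappa> * t) + real i + (\<eta> / t * (q * t ^ 2) + t / \<eta> * measure M (Bad i))) / t"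
      using bound t by (intro divide_right_mono) auto
    also have "\<dots> = \<epsilon> * \<kappa> + real i / t + \<eta> * q + measure M (Bad i) / \<eta>"
      using t by (simp add: add_divide_distrib power2_eq_square)
    also have "\<dots> < \<delta>" using \<epsilon>(2) \<eta>(2) iN Pb by linarith
    finally show ?thesis using t unfolding D_def t_def by (simp add: abs_divide)
  qed
  then show "\<exists>no. \<forall>N\<ge>no. norm ((\<integral>\<omega>. (\<Sum>k<K N. discounted_arrival c m k \<theta> (real N) \<omega> - LST F \<theta> * arrival_ind c m k (real N) \<omega>) \<partial>M) / real N - 0) < \<delta>"
    unfolding r_def by blast
qed

end

section \<open>The rate balance\<close>

context Mn_Gn_1_queue begin

lemma late_horizon:
  "\<exists>K. (\<lambda>N. \<P>(\<omega> in M. arrival_epoch (Q \<omega>) (K N) \<le> real N)) \<longlonglongrightarrow> 0"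
proof -
  have "\<exists>k. \<P>(\<omega> in M. arrival_epoch (Q \<omega>) k \<le> real N) < 1 / real (Suc N)" for N
    using order_tendstoD(2)[OF late_arrivals_unlikely[of "real N"], of "1 / real (Suc N)"]
    by (auto simp: eventually_sequentially)
  then obtain K where K: "\<And>N. \<P>(\<omega> in M. arrival_epoch (Q \<omega>) (K N) \<le> real N) < 1 / real (Suc N)" by metis
  have "(\<lambda>N. \<P>(\<omega> in M. arrival_epoch (Q \<omega>) (K N) \<le> real N)) \<longlonglongrightarrow> 0"
  proof (rule Lim_null_comparison)
    show "\<forall>\<^sub>F N in sequentially. norm (\<P>(\<omega> in M. arrival_epoch (Q \<omega>) (K N) \<le> real N)) \<le> 1 / real (Suc N)"
      using K by (simp add: less_imp_le)
    show "(\<lambda>N. 1 / real (Suc N)) \<longlonglongrightarrow> 0" using LIMSEQ_Suc[OF lim_1_over_n] by simp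
  qed
  then show ?thesis by blast
qed

lemma exists_likely_initial_number: "\<exists>c. 0 < \<P>(\<omega> in M. initial_number (Q \<omega>) = c)"
proof (rule ccontr)
  assume "\<not> ?thesis"
  then have "\<P>(\<omega> in M. initial_number (Q \<omega>) = c) = 0" for c
    using measure_le_0_iff not_le by blast
  then have "AE \<omega> in M. \<omega> \<notin> {\<omega> \<in> space M. initial_number (Q \<omega>) = c}" for c
    by (subst (asm) prob_eq_0) auto
  then have "AE \<omega> in M. \<forall>c. \<omega> \<notin> {\<omega> \<in> space M. initial_number (Q \<omega>) = c}"
    by (rule AE_all_countable[THEN iffD2, OF allI])
  then have "AE \<omega> in M. False" using AE_space by eventually_elim auto
  then show False by simp
qed

text \<open>
If \<open>\<pi> (n - 1) = 0\<close>, nothing is known about \<open>R (n - 1)\<close>, but then the discounted arrivals that find \<open>n - 1\<close> are negligible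
together with all arrivals that find \<open>n - 1\<close>.
\<close>

lemma rate_balance:
  fixes \<pi> :: "nat \<Rightarrow> real" and R :: "nat \<Rightarrow> real \<Rightarrow> real"
  assumes st: "\<And>m. steady_state_prob M Q m (\<pi> m)"
    and R0: "\<And>s. 0 \<le> s \<Longrightarrow> R 0 s = LST (G 1) s"
    and R: "\<And>m. \<lbrakk>1 \<le> m; 0 < \<pi> m\<rbrakk> \<Longrightarrow> \<exists>F. steady_state_residual M Q m F \<and> (\<forall>s\<ge>0. R m s = LST F s)"
    and n: "1 \<le> n"
  shows "\<pi> (n - 1) * rate (n - 1) * (1 - R (n - 1) (rate n)) = \<pi> n * rate n * LST (G n) (rate n)"
proof -
  \<comment> \<open>the number of arrivals considered up to time \<open>N\<close>; with high probability no further ones come by then\<close>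
  obtain K where K: "(\<lambda>N. \<P>(\<omega> in M. arrival_epoch (Q \<omega>) (K N) \<le> real N)) \<longlonglongrightarrow> 0"
    using late_horizon by blast
  obtain c where c: "0 < \<P>(\<omega> in M. initial_number (Q \<omega>) = c)"
    using exists_likely_initial_number by blast
  define p where "p = \<P>(\<omega> in M. initial_number (Q \<omega>) = c)"
  define \<theta> where "\<theta> = rate n"
  define g where "g = LST (G n) \<theta>"
  have \<theta>: "0 \<le> \<theta>" using rate_pos[of n] by (simp add: \<theta>_def)
  define a where "a = (\<lambda>m N. (\<integral>\<omega>. (\<Sum>k<Suc (K N). arrival_ind c m k (real N) \<omega>) \<partial>M) / real N)"
  define u where "u = (\<lambda>N. (\<integral>\<omega>. (\<Sum>k<Suc (K N). discounted_arrival c (n - 1) k \<theta> (real N) \<omega>) \<partial>M) / real N)"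
  define l where "l = (\<lambda>m. rate m * (\<pi> m * p))"
  have a: "a m \<longlonglongrightarrow> l m" for m
    unfolding a_def l_def p_def by (rule expected_count_rate[OF st K])
  have balance: "(\<lambda>N. g * (a n N + (if n = 1 then a 0 N else 0)) + (if 2 \<le> n then u N else 0) - a (n - 1) N) \<longlonglongrightarrow> 0"
  proof (rule Lim_null_comparison)
    have "norm (g * (a n N + (if n = 1 then a 0 N else 0)) + (if 2 \<le> n then u N else 0) - a (n - 1) N)
      \<le> (3 * real n + 8) / real N" for N
    proof -
      have "g * (a n N + (if n = 1 then a 0 N else 0)) + (if 2 \<le> n then u N else 0) - a (n - 1) N =
        (g * ((\<integral>\<omega>. (\<Sum>k<Suc (K N). arrival_ind c n k (real N) \<omega>) \<partial>M) +
        (if n = 1 then (\<integral>\<omega>. (\<Sum>k<Suc (K N). arrival_ind c 0 k (real N) \<omega>) \<partial>M) else 0))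
      + (if 2 \<le> n then (\<integral>\<omega>. (\<Sum>k<Suc (K N). discounted_arrival c (n - 1) k (rate n) (real N) \<omega>) \<partial>M) else 0)
      - (\<integral>\<omega>. (\<Sum>k<Suc (K N). arrival_ind c (n - 1) k (real N) \<omega>) \<partial>M)) / real N"
        by (cases "n = 1"; cases "2 \<le> n")
           (simp_all only: a_def u_def \<theta>_def if_True if_False add_divide_distrib diff_divide_distrib
             times_divide_eq_right distrib_left add_0_right div_0 simp_thms)
      also have "norm \<dots> \<le> (3 * real n + 8) / real N"
        using expected_balance_bounded[OF n, of "real N" c "Suc (K N)"]
        unfolding real_norm_def abs_divide g_def \<theta>_def by (simp add: divide_right_mono)
      finally show ?thesis .
    qed
    then show "\<forall>\<^sub>F N in sequentially. norm (g * (a n N + (if n = 1 then a 0 N else 0)) + (if 2 \<le> n then u N else 0) - a (n - 1) N)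
      \<le> (3 * real n + 8) / real N" by simp
    show "(\<lambda>N. (3 * real n + 8) / real N) \<longlonglongrightarrow> 0" by (rule lim_const_over_n)
  qed
  have "g * l n = l (n - 1) * (1 - R (n - 1) \<theta>)"
  proof (cases "n = 1")
    case True
    have "(\<lambda>N. g * (a n N + a 0 N) - a 0 N) \<longlonglongrightarrow> g * (l n + l 0) - l 0"
      by (intro tendsto_diff tendsto_mult tendsto_const tendsto_add a)
    moreover have "(\<lambda>N. g * (a n N + a 0 N) - a 0 N) \<longlonglongrightarrow> 0" using balance True by simp
    ultimately have "g * (l n + l 0) - l 0 = 0" by (rule LIMSEQ_unique)
    moreover have "R (n - 1) \<theta> = g" using R0[OF \<theta>] True by (simp add: g_def)
    ultimately show ?thesis using True by (simp add: algebra_simps)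
  next
    case False
    then have n2: "2 \<le> n" and m: "0 < n - 1" using n by auto
    have u: "u \<longlonglongrightarrow> R (n - 1) \<theta> * l (n - 1)"
    proof (cases "0 < \<pi> (n - 1)")
      case True
      obtain F where F: "steady_state_residual M Q (n - 1) F" "\<And>s. s \<ge> 0 \<Longrightarrow> R (n - 1) s = LST F s"
      proof -
        have "1 \<le> n - 1" using m by simp
        from R[OF this True] show ?thesis using that by blast
      qed
      define r where "r = LST F \<theta>"
      let ?d = "\<lambda>N. (\<integral>\<omega>. (\<Sum>k<Suc (K N). discounted_arrival c (n - 1) k \<theta> (real N) \<omega> - r * arrival_ind c (n - 1) k (real N) \<omega>) \<partial>M) / real N"
      have d: "?d \<longlonglongrightarrow> 0" unfolding r_def by (rule expected_residual_deviation[OF F(1) m \<theta>])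
      have iu: "integrable M (discounted_arrival c (n - 1) k \<theta> T)" for k T
        by (rule integrable_bounded[where B = 1])
           (use discounted_arrival_bounds[OF _ \<theta> m] in \<open>auto simp: abs_of_nonneg\<close>)
      have u_eq: "u N = ?d N + r * a (n - 1) N" for N
      proof -
        define f where "f = (\<lambda>\<omega>. \<Sum>k<Suc (K N). discounted_arrival c (n - 1) k \<theta> (real N) \<omega>)"
        define h where "h = (\<lambda>\<omega>. \<Sum>k<Suc (K N). arrival_ind c (n - 1) k (real N) \<omega>)"
        have fh: "integrable M f" "integrable M h"
          unfolding f_def h_def by (intro Bochner_Integration.integrable_sum iu integrable_arrival_ind)+
        have "?d N = (\<integral>\<omega>. f \<omega> - r * h \<omega> \<partial>M) / real N"
          by (simp only: f_def h_def sum_subtractf sum_distrib_left)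
        also have "(\<integral>\<omega>. f \<omega> - r * h \<omega> \<partial>M) = (\<integral>\<omega>. f \<omega> \<partial>M) - r * (\<integral>\<omega>. h \<omega> \<partial>M)"
          using fh by simp
        finally have "?d N = ((\<integral>\<omega>. f \<omega> \<partial>M) - r * (\<integral>\<omega>. h \<omega> \<partial>M)) / real N" .
        moreover have "u N = (\<integral>\<omega>. f \<omega> \<partial>M) / real N" "a (n - 1) N = (\<integral>\<omega>. h \<omega> \<partial>M) / real N"
          by (simp_all only: u_def a_def f_def h_def)
        ultimately show ?thesis by (simp only: diff_divide_distrib times_divide_eq_right diff_add_cancel)
      qed
      have "(\<lambda>N. ?d N + r * a (n - 1) N) \<longlonglongrightarrow> 0 + r * l (n - 1)"
        by (intro tendsto_add d tendsto_mult tendsto_const a)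
      then have "u \<longlonglongrightarrow> 0 + r * l (n - 1)" by (simp only: u_eq[symmetric])
      then show ?thesis using F(2)[OF \<theta>] by (simp add: r_def)
    next
      case False
      have arrival_ind_sum: "0 \<le> (\<integral>\<omega>. (\<Sum>k<Suc (K N). arrival_ind c m k (real N) \<omega>) \<partial>M)" for m N
        by (intro integral_nonneg_AE AE_I2 sum_nonneg arrival_ind_bounds)
      have "0 \<le> l (n - 1)"
        by (rule LIMSEQ_le_const[OF a]) (auto simp: a_def simp del: sum.lessThan_Suc intro!: divide_nonneg_nonneg arrival_ind_sum)
      moreover have "l (n - 1) \<le> 0"
        using False rate_pos[of "n - 1"] c unfolding l_def p_def
        by (intro mult_nonneg_nonpos mult_nonpos_nonneg) auto
      ultimately have l0: "l (n - 1) = 0" by simp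
      have "u \<longlonglongrightarrow> 0"
      proof (rule Lim_null_comparison)
        show "a (n - 1) \<longlonglongrightarrow> 0" using a[of "n - 1"] l0 by simp
        have "norm (u N) \<le> a (n - 1) N" for N
        proof -
          have "0 \<le> (\<integral>\<omega>. (\<Sum>k<Suc (K N). discounted_arrival c (n - 1) k \<theta> (real N) \<omega>) \<partial>M)"
            by (intro integral_nonneg_AE AE_I2 sum_nonneg discounted_arrival_bounds \<theta> m)
          moreover have "(\<integral>\<omega>. (\<Sum>k<Suc (K N). discounted_arrival c (n - 1) k \<theta> (real N) \<omega>) \<partial>M) \<le>
            (\<integral>\<omega>. (\<Sum>k<Suc (K N). arrival_ind c (n - 1) k (real N) \<omega>) \<partial>M)"
          proof (rule integral_mono)
            show "integrable M (\<lambda>\<omega>. \<Sum>k<Suc (K N). discounted_arrival c (n - 1) k \<theta> (real N) \<omega>)"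
              by (intro Bochner_Integration.integrable_sum integrable_bounded[where B = 1])
                 (use discounted_arrival_bounds[OF _ \<theta> m] in \<open>auto simp: abs_of_nonneg\<close>)
            show "integrable M (\<lambda>\<omega>. \<Sum>k<Suc (K N). arrival_ind c (n - 1) k (real N) \<omega>)"
              by (intro Bochner_Integration.integrable_sum integrable_arrival_ind)
            show "(\<Sum>k<Suc (K N). discounted_arrival c (n - 1) k \<theta> (real N) \<omega>) \<le> (\<Sum>k<Suc (K N). arrival_ind c (n - 1) k (real N) \<omega>)"
              if "\<omega> \<in> space M" for \<omega>
              by (intro sum_mono discounted_arrival_bounds(2)[OF that \<theta> m])
          qed
          ultimately show ?thesis
            unfolding u_def a_def real_norm_def abs_divide by (simp add: divide_right_mono del: sum.lessThan_Suc)
        qed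
        then show "\<forall>\<^sub>F N in sequentially. norm (u N) \<le> a (n - 1) N" by simp
      qed
      then show ?thesis by (simp only: l0 mult_zero_right)
    qed
    have "(\<lambda>N. g * a n N + u N - a (n - 1) N) \<longlonglongrightarrow> g * l n + R (n - 1) \<theta> * l (n - 1) - l (n - 1)"
      by (intro tendsto_diff tendsto_add u tendsto_mult tendsto_const a)
    moreover have "(\<lambda>N. g * a n N + u N - a (n - 1) N) \<longlonglongrightarrow> 0" using balance n2 False by simp
    ultimately have "g * l n + R (n - 1) \<theta> * l (n - 1) - l (n - 1) = 0" by (rule LIMSEQ_unique)
    then show ?thesis by (simp add: algebra_simps)
  qed
  then have "p * (\<pi> n * rate n * g) = p * (\<pi> (n - 1) * rate (n - 1) * (1 - R (n - 1) \<theta>))"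
    by (simp add: l_def mult_ac)
  then show ?thesis using c by (simp add: p_def[symmetric] g_def \<theta>_def)
qed

end

theorem theorem10:
  fixes M :: "'a measure"
    and Q :: "'a \<Rightarrow> queue_path"
    and rate :: "nat \<Rightarrow> real"
    and G :: "nat \<Rightarrow> real measure"
    and \<pi> :: "nat \<Rightarrow> real"
    and R :: "nat \<Rightarrow> real \<Rightarrow> real"
    and n :: nat
  assumes "Mn_Gn_1_queue M Q rate G"
    and "stable_queue M Q"
    and "\<And>n. steady_state_prob M Q n (\<pi> n)"
    and "\<And>s. 0 \<le> s \<Longrightarrow> R 0 s = LST (G 1) s"
    and "\<And>n. \<lbrakk>1 \<le> n; 0 < \<pi> n\<rbrakk> \<Longrightarrow>
           \<exists>F. steady_state_residual M Q n F \<and> (\<forall>s\<ge>0. R n s = LST F s)"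
    and "1 \<le> n"
  shows "\<pi> (n - 1) * rate (n - 1) * (1 - R (n - 1) (rate n)) = \<pi> n * rate n * LST (G n) (rate n)"
  by (rule Mn_Gn_1_queue.rate_balance[OF assms(1,3-6)])

end
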